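(* Let $q=2^{2^f}+1$ be a Fermat prime (with $f\ge 0$ an integer), and let $\gamma$ be a positive integer. Then, for every positive integer $m$, the generating function $F_m(q;z)=1+\sum_{\lambda\ge1}f_\lambda^{(q)}(m)z^\lambda$ of free subgroup numbers of $\Gamma_m(q)$, when reduced modulo $2^\gamma$, can be expressed as a polynomial in $\Phi_{2^f}(z)$ of degree at most $2^{2^f}\gamma-1$ with coefficients that are Laurent polynomials in $z^{1/(q-2)}$ over the integers.
   Context: For integers $m\ge1$ and primes $q\ge3$, $\Gamma_m(q)=\langle x,y\mid x^{2m}=y^{qm}=1,\ x^2=y^q\rangle=C_{2m}\underset{C_m}{\ast}C_{qm}$, and $f_\lambda^{(q)}(m)$ is the number of free subgroups of index $2qm\lambda$ in $\Gamma_m(q)$. For a positive integer $h$, $\Phi_h(z)=\sum_{n\ge0}z^{2^{nh}/(2^h-1)}$. Series are regarded as formal Laurent series in $z^{1/(q-2)}$ (note $q-2=2^{2^f}-1$) with integer coefficients; "reduced modulo $M$, can be expressed as" means that coefficients of equal powers agree modulo $M$. *)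

theory Defs
  imports
    "HOL-Algebra.Coset"
    "HOL-Computational_Algebra.Computational_Algebra"
    "HOL-Number_Theory.Cong"
begin

section \<open>Group presentations and free groups\<close>

text \<open>
  A letter \<open>(a, True)\<close> stands for the generator \<open>a\<close>, and \<open>(a, False)\<close> for its formal inverse.
\<close>

type_synonym 'a word = "('a \<times> bool) list"

abbreviation words_over :: "'a set \<Rightarrow> 'a word set" where
  "words_over S \<equiv> lists (S \<times> UNIV)"

text \<open>
  The least congruence on the words over \<open>S\<close> that identifies \<open>a a\<^sup>-\<^sup>1\<close> and \<open>a\<^sup>-\<^sup>1 a\<close> with the
  empty word, and \<open>l\<close> with \<open>r\<close> for every defining relation \<open>l = r\<close>, given as the pair
  \<open>(l, r) \<in> R\<close>.
\<close>

inductive_set word_cong :: "'a set \<Rightarrow> ('a word \<times> 'a word) set \<Rightarrow> ('a word \<times> 'a word) set"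
  for S :: "'a set" and R :: "('a word \<times> 'a word) set"
where
  refl: "w \<in> words_over S \<Longrightarrow> (w, w) \<in> word_cong S R"
| sym: "(v, w) \<in> word_cong S R \<Longrightarrow> (w, v) \<in> word_cong S R"
| trans: "(u, v) \<in> word_cong S R \<Longrightarrow> (v, w) \<in> word_cong S R \<Longrightarrow> (u, w) \<in> word_cong S R"
| cancel: "u \<in> words_over S \<Longrightarrow> v \<in> words_over S \<Longrightarrow> a \<in> S \<Longrightarrow>
    (u @ [(a, b), (a, \<not> b)] @ v, u @ v) \<in> word_cong S R"
| relation: "u \<in> words_over S \<Longrightarrow> v \<in> words_over S \<Longrightarrow>
    l \<in> words_over S \<Longrightarrow> r \<in> words_over S \<Longrightarrow> (l, r) \<in> R \<Longrightarrow>
    (u @ l @ v, u @ r @ v) \<in> word_cong S R"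

definition presented_group :: "'a set \<Rightarrow> ('a word \<times> 'a word) set \<Rightarrow> 'a word set monoid" where
  "presented_group S R =
    \<lparr>carrier = words_over S // word_cong S R,
     monoid.mult = (\<lambda>A B. \<Union>u\<in>A. \<Union>v\<in>B. word_cong S R `` {u @ v}),
     monoid.one = word_cong S R `` {[]}\<rparr>"

definition free_group :: "'a set \<Rightarrow> 'a word set monoid" where
  "free_group S = presented_group S {}"

text \<open>
  Letting the free generators range over the element type of \<open>G\<close> is no restriction, since a
  basis of \<open>G\<close> is a subset of \<open>carrier G\<close>.
\<close>

definition is_free_group :: "('a, 'b) monoid_scheme \<Rightarrow> bool" where
  "is_free_group G \<longleftrightarrow> (\<exists>S :: 'a set. free_group S \<cong> G)"

lemma word_cong_words:
  "(v, w) \<in> word_cong S R \<Longrightarrow> v \<in> words_over S \<and> w \<in> words_over S"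
  by (induction rule: word_cong.induct) auto

lemma equiv_word_cong: "equiv (words_over S) (word_cong S R)"
proof (rule equivI)
  show "word_cong S R \<subseteq> words_over S \<times> words_over S"
    by (rule subrelI) (simp only: mem_Sigma_iff word_cong_words simp_thms)
  show "refl_on (words_over S) (word_cong S R)"
    by (rule refl_onI) (rule word_cong.refl)
  show "Relation.sym (word_cong S R)"
    by (rule symI) (rule word_cong.sym)
  show "Relation.trans (word_cong S R)"
    by (rule transI) (rule word_cong.trans)
qed

lemma word_cong_context:
  assumes "(v, w) \<in> word_cong S R" "p \<in> words_over S" "s \<in> words_over S"
  shows "(p @ v @ s, p @ w @ s) \<in> word_cong S R"
  using assms
proof (induction rule: word_cong.induct)
  case (refl w)
  then show ?case by (simp add: word_cong.refl)
next
  case (sym v w)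
  then show ?case by (simp add: word_cong.sym)
next
  case (trans u v w)
  then show ?case by (meson word_cong.trans)
next
  case (cancel u v a b)
  then show ?case
    using word_cong.cancel[of "p @ u" S "v @ s" a b R] by simp
next
  case (relation u v l r)
  then show ?case
    using word_cong.relation[of "p @ u" S "v @ s" l r R] by simp
qed

lemma word_cong_append:
  assumes "(u, u') \<in> word_cong S R" "(v, v') \<in> word_cong S R"
  shows "(u @ v, u' @ v') \<in> word_cong S R"
proof (rule word_cong.trans)
  show "(u @ v, u' @ v) \<in> word_cong S R"
    using word_cong_context[OF assms(1), of "[]" v] word_cong_words[OF assms(2)] by simp
  show "(u' @ v, u' @ v') \<in> word_cong S R"
    using word_cong_context[OF assms(2), of u' "[]"] word_cong_words[OF assms(1)] by simp
qed

lemma presented_group_mult: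
  assumes "u \<in> words_over S" "v \<in> words_over S"
  shows "word_cong S R `` {u} \<otimes>\<^bsub>presented_group S R\<^esub> word_cong S R `` {v}
    = word_cong S R `` {u @ v}"
proof -
  let ?c = "\<lambda>w. word_cong S R `` {w}"
  have "?c (u' @ v') = ?c (u @ v)" if "u' \<in> ?c u" "v' \<in> ?c v" for u' v'
  proof -
    have "(u @ v, u' @ v') \<in> word_cong S R"
      using that by (intro word_cong_append) simp_all
    from equiv_class_eq[OF equiv_word_cong this] show ?thesis by (rule HOL.sym)
  qed
  then have "(\<Union>u'\<in>?c u. \<Union>v'\<in>?c v. ?c (u' @ v')) = (\<Union>u'\<in>?c u. \<Union>v'\<in>?c v. ?c (u @ v))"
    by (intro SUP_cong HOL.refl)
  moreover have "u \<in> ?c u" "v \<in> ?c v"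
    using assms by (simp_all only: Image_singleton_iff word_cong.refl)
  then have "(\<Union>u'\<in>?c u. \<Union>v'\<in>?c v. ?c (u @ v)) = ?c (u @ v)"
    by blast
  ultimately show ?thesis
    by (simp only: presented_group_def monoid.simps partial_object.simps)
qed

lemma inverse_word_cong:
  assumes "w \<in> words_over S"
  shows "(rev (map (\<lambda>(a, b). (a, \<not> b)) w) @ w, []) \<in> word_cong S R"
  using assms
proof (induction w)
  case Nil
  then show ?case by (simp add: word_cong.refl)
next
  case (Cons x w)
  obtain a b where x: "x = (a, b)" by (cases x)
  have "rev (map (\<lambda>(a, b). (a, \<not> b)) w) \<in> words_over S"
    using Cons.hyps by (force simp: in_lists_conv_set)
  then have "(rev (map (\<lambda>(a, b). (a, \<not> b)) w) @ [(a, \<not> b), (a, \<not> \<not> b)] @ w,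
      rev (map (\<lambda>(a, b). (a, \<not> b)) w) @ w) \<in> word_cong S R"
    using Cons.hyps x by (intro word_cong.cancel) auto
  moreover have "(rev (map (\<lambda>(a, b). (a, \<not> b)) w) @ w, []) \<in> word_cong S R"
    using Cons by simp
  ultimately have "(rev (map (\<lambda>(a, b). (a, \<not> b)) w) @ [(a, \<not> b), (a, \<not> \<not> b)] @ w, [])
      \<in> word_cong S R"
    by (rule word_cong.trans)
  then show ?case by (simp add: x)
qed

lemma group_presented_group: "group (presented_group S R)"
proof (rule groupI)
  let ?G = "presented_group S R" and ?c = "\<lambda>w. word_cong S R `` {w}"
  have car: "carrier ?G = ?c ` words_over S" and one: "\<one>\<^bsub>?G\<^esub> = ?c []"
    by (auto simp: presented_group_def quotient_def)
  show "x \<otimes>\<^bsub>?G\<^esub> y \<in> carrier ?G" if "x \<in> carrier ?G" "y \<in> carrier ?G" for x y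
  proof -
    from that obtain v w where vw: "v \<in> words_over S" "w \<in> words_over S" "x = ?c v" "y = ?c w"
      unfolding car by blast
    then have "x \<otimes>\<^bsub>?G\<^esub> y = ?c (v @ w)" by (simp only: presented_group_mult)
    moreover have "v @ w \<in> words_over S" using vw by simp
    ultimately show ?thesis unfolding car by blast
  qed
  show "\<one>\<^bsub>?G\<^esub> \<in> carrier ?G"
    by (auto simp: car one)
  show "x \<otimes>\<^bsub>?G\<^esub> y \<otimes>\<^bsub>?G\<^esub> z = x \<otimes>\<^bsub>?G\<^esub> (y \<otimes>\<^bsub>?G\<^esub> z)"
    if "x \<in> carrier ?G" "y \<in> carrier ?G" "z \<in> carrier ?G" for x y z
  proof -
    from that obtain u v w where "u \<in> words_over S" "v \<in> words_over S" "w \<in> words_over S"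
      "x = ?c u" "y = ?c v" "z = ?c w" unfolding car by blast
    moreover from this have "u @ v \<in> words_over S" "v @ w \<in> words_over S" by simp_all
    ultimately show ?thesis by (simp only: presented_group_mult append_assoc)
  qed
  show "\<one>\<^bsub>?G\<^esub> \<otimes>\<^bsub>?G\<^esub> x = x" if "x \<in> carrier ?G" for x
  proof -
    from that obtain w where "w \<in> words_over S" "x = ?c w" unfolding car by blast
    then show ?thesis by (simp only: one presented_group_mult lists.Nil append_Nil)
  qed
  show "\<exists>y\<in>carrier ?G. y \<otimes>\<^bsub>?G\<^esub> x = \<one>\<^bsub>?G\<^esub>" if "x \<in> carrier ?G" for x
  proof -
    from that obtain w where w: "w \<in> words_over S" "x = ?c w" unfolding car by blast
    let ?i = "rev (map (\<lambda>(a, b). (a, \<not> b)) w)"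
    have i: "?i \<in> words_over S" using w(1) by (force simp: in_lists_conv_set)
    have "?c (?i @ w) = ?c []"
      using equiv_class_eq[OF equiv_word_cong inverse_word_cong[OF w(1)]] .
    then have "?c ?i \<otimes>\<^bsub>?G\<^esub> x = \<one>\<^bsub>?G\<^esub>"
      using w i by (simp only: presented_group_mult one)
    with i show ?thesis unfolding car by blast
  qed
qed


section \<open>The groups \<open>\<Gamma>\<^sub>m(q)\<close> and their free subgroup numbers\<close>

datatype gen = X | Y

definition Gamma :: "nat \<Rightarrow> nat \<Rightarrow> gen word set monoid" where
  "Gamma m q = presented_group UNIV
    {(replicate (2 * m) (X, True), []),
     (replicate (q * m) (Y, True), []),
     (replicate 2 (X, True), replicate q (Y, True))}"

text \<open>
  The cardinality below is that of a finite set whenever \<open>2 * q * m * k > 0\<close>, because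
  \<open>Gamma m q\<close> is finitely generated; subgroups of infinite index are not counted then, as
  \<^const>\<open>card\<close> is \<open>0\<close> on infinite sets.
\<close>

definition free_subgroup_number :: "nat \<Rightarrow> nat \<Rightarrow> nat \<Rightarrow> nat" where
  "free_subgroup_number q m k =
    card {H. subgroup H (Gamma m q) \<and> is_free_group ((Gamma m q)\<lparr>carrier := H\<rparr>) \<and>
             card (rcosets\<^bsub>Gamma m q\<^esub> H) = 2 * q * m * k}"

definition free_subgroup_gf :: "nat \<Rightarrow> nat \<Rightarrow> int fps" where
  "free_subgroup_gf q m =
    Abs_fps (\<lambda>k. if k = 0 then 1 else int (free_subgroup_number q m k))"


section \<open>Series in fractional powers of \<open>z\<close>\<close>

text \<open>
  A formal Laurent series in \<open>z\<^bsup>1/N\<^esup>\<close> is represented by the Laurent series in the variable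
  \<open>t = z\<^bsup>1/N\<^esup>\<close>; so a series in \<open>z\<close> is turned into one in \<open>t\<close> by the substitution \<open>z = t\<^sup>N\<close>,
  that is, by \<^term>\<open>\<lambda>F. fls_compose_power F N\<close>.

  The series \<open>\<Phi>\<^sub>h(z) = (\<Sum>n\<ge>0. z\<^bsup>2^(n h)/(2^h - 1)\<^esup>)\<close> is represented with \<open>N = 2^h - 1\<close>, so it becomes
  \<open>\<Sum>n\<ge>0. t\<^bsup>2^(n h)\<^esup>\<close>, where the exponents are distinct as long as \<open>h > 0\<close>.
\<close>

definition Phi :: "nat \<Rightarrow> int fls" where
  "Phi h = fps_to_fls (Abs_fps (\<lambda>k. if \<exists>n. k = 2 ^ (n * h) then 1 else 0))"

definition is_laurent_poly :: "int fls \<Rightarrow> bool" where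
  "is_laurent_poly c \<longleftrightarrow> finite {n. fls_nth c n \<noteq> 0}"

definition fls_cong :: "int \<Rightarrow> int fls \<Rightarrow> int fls \<Rightarrow> bool" where
  "fls_cong M A B \<longleftrightarrow> (\<forall>n. [fls_nth A n = fls_nth B n] (mod M))"

end

theory Submission
  imports Defs "HOL-Combinatorics.Permutations"
begin

text \<open>
  A transitive \<open>\<Gamma>\<^sub>m(q)\<close>-set of degree \<open>n = 2qmk\<close> has free point stabilisers iff \<open>x\<close> and \<open>y\<close> act on
  it with all cycles of length \<open>2m\<close> and \<open>qm\<close>. In one direction this holds because free groups are
  torsion-free. In the other, the \<open>y\<close>-orbits and \<open>x\<close>-orbits form the vertices and edges of a connected
  graph, and the edges outside a spanning tree give a free basis. Hence, by the exponential formula,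
  \<open>F = 1 + D G / G\<close> with \<open>D = 2qm z d/dz\<close>, where \<open>G\<close> is the generating function of the numbers of all
  pairs of such permutations with \<open>x\<^sup>2 = y\<^sup>q\<close>, divided by \<open>n!\<close>. These numbers are explicit quotients of
  factorials, so \<open>G\<close> solves a linear differential equation, and \<open>u = F - 1\<close> satisfies the Riccati-type
  equation \<open>u = z (D + u + c\<^sub>1 m) \<dots> (D + u + c\<^sub>q\<^sub>-\<^sub>1 m) 1\<close>, where the \<open>c\<^sub>i\<close> are the odd numbers below \<open>2q\<close>
  other than \<open>q\<close>.

  Since \<open>D\<close> is divisible by 2 and the number \<open>q - 1 = 2\<^sup>h\<close> of factors is even, the right-hand side is a
  2-adic contraction, once \<open>u\<close> has been replaced by \<open>u + (m mod 2)\<close>. Its fixed point modulo 2 is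
  \<open>\<Phi>\<^sub>h / t\<close> for odd \<open>m\<close> and \<open>0\<close> for even \<open>m\<close>, where \<open>t = z\<^bsup>1/(q-2)\<^esup>\<close>. The Laurent polynomials in \<open>t\<close>
  together with \<open>\<Phi>\<^sub>h\<close> generate a ring which modulo \<open>2\<^sup>\<gamma>\<close> is closed under \<open>D\<close>, so the iteration stays in
  this ring. The bound on the degree comes from the monic relation
  \<open>(\<Phi>\<^sub>h\<^bsup>2^h\<^esup> - \<Phi>\<^sub>h + t)\<^sup>\<gamma> = 0\<close> modulo \<open>2\<^sup>\<gamma>\<close>.
\<close>

text \<open>Two properties of q drive the arithmetic. Since q - 1 is even, a change of the shifted
  unknown F by 2^k e with k >= 1 changes the product, modulo 2^(k+1), by (q - 1) F^(q-2) 2^k e,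
  which vanishes. Since q - 1 is a power of 2, the nonlinear term modulo 2 is a Frobenius power and
  hence additive, which makes the start of the iteration explicit. The obstacle is the variable t:
  there z d/dz becomes t d/dt divided by q - 2. As q - 2 is odd this division is possible modulo
  \<open>2 ^ \<gamma>\<close>, but the transferred equation is then only a congruence. On the group
  side, freeness of a stabiliser is shown without normal forms in \<open>Gamma m q\<close>: the
  action on the points is lifted to pairs of a point and an element of an abstract free group, and
  the lift recovers each free element from its image. Stabilisers of one base point are counted
  instead of transitive actions, which removes the (n - 1)! relabellings fixing that point.\<close>

unbundle Formal_Power_Series.fps_syntax
unbundle Formal_Laurent_Series.fps_syntax

section \<open>Congruences between Laurent series\<close>

lemma fls_of_int_mult_nth [simp]: "(of_int M * (f :: int fls)) $$ n = M * f $$ n"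
proof -
  have "(of_int M :: int fls) = fls_const M" by (simp add: fls_of_int)
  then show ?thesis by simp
qed

text \<open>Identifies coefficientwise congruence with divisibility in the ring of Laurent series,
  so that later congruences can be handled by ring identities.\<close>

lemma of_int_dvd_fls_iff: "of_int M dvd (f :: int fls) \<longleftrightarrow> (\<forall>n. M dvd f $$ n)"
proof
  assume "of_int M dvd f"
  then show "\<forall>n. M dvd f $$ n" by (auto elim!: dvdE)
next
  assume M: "\<forall>n. M dvd f $$ n"
  have "f = of_int M * Abs_fls (\<lambda>n. f $$ n div M)"
  proof (rule fls_eqI)
    fix n
    have "Abs_fls (\<lambda>n. f $$ n div M) $$ n = f $$ n div M"
      by (rule nth_Abs_fls_lower_bound[of "fls_subdegree f"]) simp
    with M show "f $$ n = (of_int M * Abs_fls (\<lambda>n. f $$ n div M)) $$ n" by simp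
  qed
  then show "of_int M dvd f" by (metis dvd_triv_left)
qed

lemma fls_cong_iff_dvd: "fls_cong M A B \<longleftrightarrow> of_int M dvd A - B"
  by (simp add: fls_cong_def of_int_dvd_fls_iff cong_iff_dvd_diff)

text \<open>The operator t d/dt. Being diagonal on monomials, it does not enlarge supports, and it
  matches z d/dz up to a factor under z = t^N.\<close>

definition fls_euler :: "int fls \<Rightarrow> int fls" where
  "fls_euler f = fls_X * fls_deriv f"

lemma fls_euler_nth [simp]: "fls_euler f $$ n = n * f $$ n"
  by (simp add: fls_euler_def fls_X_times_conv_shift)

lemma fls_euler_add: "fls_euler (f + g) = fls_euler f + fls_euler g"
  by (simp add: fls_eq_iff algebra_simps)

lemma fls_euler_of_int_mult: "fls_euler (of_int M * f) = of_int M * fls_euler f"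
  by (simp add: fls_eq_iff)

lemma fls_euler_mult: "fls_euler (f * g) = fls_euler f * g + f * fls_euler g"
  by (simp add: fls_euler_def algebra_simps)

lemma euler_dvd: "of_int M dvd f \<Longrightarrow> of_int M dvd fls_euler f"
  by (auto simp: of_int_dvd_fls_iff)

section \<open>Laurent polynomials in the basic series\<close>

lemma is_laurent_poly_0 [simp]: "is_laurent_poly 0"
  by (simp add: is_laurent_poly_def)

lemma is_laurent_poly_X_intpow [simp]: "is_laurent_poly (fls_X_intpow k)"
  unfolding is_laurent_poly_def by (rule finite_subset[of _ "{k}"]) auto

lemma is_laurent_poly_1 [simp]: "is_laurent_poly 1"
  using is_laurent_poly_X_intpow[of 0] by simp

lemma is_laurent_poly_of_int [simp]: "is_laurent_poly (of_int k)"
  by (simp add: is_laurent_poly_def fls_of_int)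

lemma is_laurent_poly_add [intro]:
  "is_laurent_poly a \<Longrightarrow> is_laurent_poly b \<Longrightarrow> is_laurent_poly (a + b)"
  unfolding is_laurent_poly_def
  by (rule finite_subset[of _ "{n. a $$ n \<noteq> 0} \<union> {n. b $$ n \<noteq> 0}"]) auto

lemma is_laurent_poly_uminus [intro]: "is_laurent_poly a \<Longrightarrow> is_laurent_poly (- a)"
  by (simp add: is_laurent_poly_def)

lemma is_laurent_poly_mult [intro]:
  assumes "is_laurent_poly a" "is_laurent_poly b"
  shows "is_laurent_poly (a * b)"
proof -
  let ?A = "{n. a $$ n \<noteq> 0}" and ?B = "{n. b $$ n \<noteq> 0}"
  have "{n. (a * b) $$ n \<noteq> 0} \<subseteq> (\<lambda>(i, j). i + j) ` (?A \<times> ?B)"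
  proof
    fix n assume "n \<in> {n. (a * b) $$ n \<noteq> 0}"
    then have "(\<Sum>i=fls_subdegree a..n - fls_subdegree b. a $$ i * b $$ (n - i)) \<noteq> 0"
      unfolding mem_Collect_eq fls_times_nth(2)[of a b n] .
    then obtain i where "a $$ i * b $$ (n - i) \<noteq> 0"
      by (metis (no_types, lifting) sum.neutral)
    then show "n \<in> (\<lambda>(i, j). i + j) ` (?A \<times> ?B)"
      by (intro image_eqI[of _ _ "(i, n - i)"]) auto
  qed
  then show ?thesis
    using assms unfolding is_laurent_poly_def
    by (elim finite_subset) (intro finite_imageI finite_SigmaI)
qed

lemma is_laurent_poly_sum [intro]:
  "(\<And>i. i \<in> I \<Longrightarrow> is_laurent_poly (a i)) \<Longrightarrow> is_laurent_poly (\<Sum>i\<in>I. a i)"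
  by (induction I rule: infinite_finite_induct) auto

lemma is_laurent_poly_euler [intro]: "is_laurent_poly a \<Longrightarrow> is_laurent_poly (fls_euler a)"
  unfolding is_laurent_poly_def by (rule finite_subset[of _ "{n. a $$ n \<noteq> 0}"]) auto

definition laurent_coeffs :: "int fls poly \<Rightarrow> bool" where
  "laurent_coeffs P \<longleftrightarrow> (\<forall>i. is_laurent_poly (coeff P i))"

lemma laurent_coeffs_pCons [simp]:
  "laurent_coeffs (pCons a P) \<longleftrightarrow> is_laurent_poly a \<and> laurent_coeffs P"
  unfolding laurent_coeffs_def by (auto simp: coeff_pCons split: nat.splits)

lemma laurent_coeffs_0 [simp]: "laurent_coeffs 0"
  by (simp add: laurent_coeffs_def)

lemma laurent_coeffs_1 [simp]: "laurent_coeffs 1"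
  unfolding one_pCons by simp

lemma laurent_coeffs_add [intro]:
  "laurent_coeffs P \<Longrightarrow> laurent_coeffs Q \<Longrightarrow> laurent_coeffs (P + Q)"
  by (auto simp: laurent_coeffs_def)

lemma laurent_coeffs_smult [intro]:
  "is_laurent_poly c \<Longrightarrow> laurent_coeffs P \<Longrightarrow> laurent_coeffs (smult c P)"
  by (auto simp: laurent_coeffs_def)

lemma laurent_coeffs_uminus [intro]: "laurent_coeffs P \<Longrightarrow> laurent_coeffs (- P)"
  by (auto simp: laurent_coeffs_def)

lemma laurent_coeffs_mult [intro]:
  "laurent_coeffs P \<Longrightarrow> laurent_coeffs Q \<Longrightarrow> laurent_coeffs (P * Q)"
  unfolding laurent_coeffs_def coeff_mult by blast

lemma laurent_coeffs_power [intro]: "laurent_coeffs P \<Longrightarrow> laurent_coeffs (P ^ n)"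
  by (induction n) auto

text \<open>The subring generated by the Laurent polynomials and \<open>w\<close>, enlarged by all
  multiples of \<open>M\<close>. The degree in \<open>w\<close> is left free to make closure under
  products immediate; it is cut down only at the end.\<close>

definition poly_in_mod :: "int \<Rightarrow> int fls \<Rightarrow> int fls set" where
  "poly_in_mod M w = {B. \<exists>P. laurent_coeffs P \<and> of_int M dvd B - poly P w}"

lemma poly_in_modI: "laurent_coeffs P \<Longrightarrow> of_int M dvd B - poly P w \<Longrightarrow> B \<in> poly_in_mod M w"
  by (auto simp: poly_in_mod_def)

lemma poly_in_mod_cong:
  assumes "A \<in> poly_in_mod M w" "of_int M dvd B - A"
  shows "B \<in> poly_in_mod M w"
proof -
  from assms(1) obtain P where P: "laurent_coeffs P" "of_int M dvd A - poly P w"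
    by (auto simp: poly_in_mod_def)
  have "of_int M dvd (B - A) + (A - poly P w)" using assms(2) P(2) by (rule dvd_add)
  with P(1) show ?thesis by (intro poly_in_modI[of P]) simp_all
qed

lemma poly_in_mod_laurent [intro]: "is_laurent_poly c \<Longrightarrow> c \<in> poly_in_mod M w"
  by (rule poly_in_modI[of "[:c:]"]) simp_all

lemma poly_in_mod_self [intro]: "w \<in> poly_in_mod M w"
  by (rule poly_in_modI[of "[:0, 1:]"]) simp_all

lemma poly_in_mod_add [intro]:
  assumes "A \<in> poly_in_mod M w" "B \<in> poly_in_mod M w"
  shows "A + B \<in> poly_in_mod M w"
proof -
  from assms obtain P Q where P: "laurent_coeffs P" "of_int M dvd A - poly P w"
    and Q: "laurent_coeffs Q" "of_int M dvd B - poly Q w"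
    by (auto simp: poly_in_mod_def)
  have "of_int M dvd (A - poly P w) + (B - poly Q w)" using P(2) Q(2) by (rule dvd_add)
  with P Q show ?thesis by (intro poly_in_modI[of "P + Q"]) (auto simp: algebra_simps)
qed

lemma poly_in_mod_mult [intro]:
  assumes "A \<in> poly_in_mod M w" "B \<in> poly_in_mod M w"
  shows "A * B \<in> poly_in_mod M w"
proof -
  from assms obtain P Q where P: "laurent_coeffs P" "of_int M dvd A - poly P w"
    and Q: "laurent_coeffs Q" "of_int M dvd B - poly Q w"
    by (auto simp: poly_in_mod_def)
  have "of_int M dvd (A - poly P w) * B + poly P w * (B - poly Q w)"
    using P(2) Q(2) by (intro dvd_add dvd_mult dvd_mult2)
  with P Q show ?thesis by (intro poly_in_modI[of "P * Q"]) (auto simp: algebra_simps)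
qed

text \<open>By the Leibniz rule, closure under the Euler operator needs to be known for the
  generator \<open>w\<close> only. The error term stays divisible because the operator is linear
  over the integers.\<close>

lemma poly_in_mod_euler:
  assumes w: "fls_euler w \<in> poly_in_mod M w" and A: "A \<in> poly_in_mod M w"
  shows "fls_euler A \<in> poly_in_mod M w"
proof -
  have *: "poly P w \<in> poly_in_mod M w \<and> fls_euler (poly P w) \<in> poly_in_mod M w"
    if "laurent_coeffs P" for P
    using that
  proof (induction P)
    case 0
    then show ?case by (auto simp: fls_euler_def)
  next
    case (pCons a P)
    then have a: "is_laurent_poly a" and IH: "poly P w \<in> poly_in_mod M w"
      "fls_euler (poly P w) \<in> poly_in_mod M w" by auto
    have "fls_euler (poly (pCons a P) w)
        = fls_euler a + (fls_euler w * poly P w + w * fls_euler (poly P w))"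
      by (simp add: fls_euler_add fls_euler_mult)
    moreover have "\<dots> \<in> poly_in_mod M w" using a IH w by blast
    moreover have "poly (pCons a P) w \<in> poly_in_mod M w"
      using a IH unfolding poly_pCons by blast
    ultimately show ?case by simp
  qed
  from A obtain P where P: "laurent_coeffs P" "of_int M dvd A - poly P w"
    by (auto simp: poly_in_mod_def)
  have "fls_euler A = fls_euler (poly P w) + fls_euler (A - poly P w)"
    by (simp flip: fls_euler_add)
  with euler_dvd[OF P(2)] have "of_int M dvd fls_euler A - fls_euler (poly P w)" by simp
  with *[OF P(1)] show ?thesis by (blast intro: poly_in_mod_cong)
qed

text \<open>Division by a monic relation in Horner fashion: multiplying a remainder by
  \<open>w\<close> creates at most one term of degree \<open>n\<close>, which the relation
  replaces.\<close>

lemma poly_in_mod_reduce_degree: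
  assumes "A \<in> poly_in_mod M w"
    and R: "laurent_coeffs R" "of_int M dvd w ^ n - poly R w" "degree R < n"
  obtains P where "laurent_coeffs P" "degree P < n" "of_int M dvd A - poly P w"
proof -
  let ?red = "\<lambda>B. \<exists>P. laurent_coeffs P \<and> degree P < n \<and> of_int M dvd B - poly P w"
  have n: "n > 0" using R(3) by simp
  have "?red (poly P w)" if "laurent_coeffs P" for P
    using that
  proof (induction P)
    case 0
    then show ?case using n by (intro exI[of _ 0]) simp
  next
    case (pCons a P)
    then obtain Q where Q: "laurent_coeffs Q" "degree Q < n" "of_int M dvd poly P w - poly Q w"
      by auto
    \<comment> \<open>After multiplication by \<open>w\<close> this coefficient belongs to w^n; its
      term is taken out of \<open>Q\<close> and returned as a multiple of \<open>R\<close>.\<close>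
    define c where "c = coeff Q (n - 1)"
    define T where "T = pCons 0 (Q - monom c (n - 1)) + smult c R + [:a:]"
    have lT: "laurent_coeffs T"
    proof -
      have "laurent_coeffs (Q - monom c (n - 1))"
        using Q(1) by (auto simp: laurent_coeffs_def c_def)
      then show ?thesis using pCons.prems Q(1) R(1)
        unfolding T_def by (intro laurent_coeffs_add laurent_coeffs_smult)
          (auto simp: laurent_coeffs_def[of Q] c_def)
    qed
    have "degree T < n"
    proof -
      have "coeff T i = 0" if "i \<ge> n" for i
      proof -
        define j where "j = i - 1"
        have j: "i = Suc j" using that n by (simp add: j_def)
        have "coeff Q j = 0" if "j > n - 1" using that Q(2) by (intro coeff_eq_0) auto
        moreover have "coeff R i = 0" using \<open>i \<ge> n\<close> R(3) by (intro coeff_eq_0) auto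
        ultimately show ?thesis using j \<open>i \<ge> n\<close> n
          by (auto simp: T_def c_def)
      qed
      then show ?thesis using n by (metis degree_0 leading_coeff_0_iff not_less)
    qed
    moreover have "of_int M dvd poly (pCons a P) w - poly T w"
    proof -
      have "poly (pCons a P) w - poly T w
          = w * (poly P w - poly Q w) + c * (w ^ n - poly R w)"
        using n by (cases n) (auto simp: T_def poly_monom algebra_simps)
      then show ?thesis using Q(3) R(2) by simp
    qed
    ultimately show ?case using lT by blast
  qed
  moreover from assms(1) obtain P where P: "laurent_coeffs P" "of_int M dvd A - poly P w"
    by (auto simp: poly_in_mod_def)
  ultimately obtain Q where Q: "laurent_coeffs Q" "degree Q < n" "of_int M dvd poly P w - poly Q w"
    by blast
  have "of_int M dvd (A - poly P w) + (poly P w - poly Q w)" using P(2) Q(3) by (rule dvd_add)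
  with Q that show thesis by simp
qed

section \<open>The Frobenius map modulo 2\<close>

text \<open>Induction by squaring: the difference of squares inherits the divisibility, and the only
  new term is the cross term 2 y z.\<close>

lemma two_dvd_power_add:
  fixes a b :: "'a :: comm_ring_1"
  shows "2 dvd (a + b) ^ (2 ^ h) - (a ^ (2 ^ h) + b ^ (2 ^ h))"
proof (induction h)
  case 0
  then show ?case by simp
next
  case (Suc h)
  define x y z where "x = (a + b) ^ (2 ^ h)" and "y = a ^ (2 ^ h)" and "z = b ^ (2 ^ h)"
  have sq: "c ^ (2 ^ Suc h) = (c ^ (2 ^ h)) ^ 2" for c :: 'a
    by (simp add: power_mult[symmetric] mult.commute)
  have "x ^ 2 - (y ^ 2 + z ^ 2) = (x - (y + z)) * (x + (y + z)) + 2 * (y * z)"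
    by (simp add: power2_eq_square algebra_simps)
  also have "2 dvd \<dots>"
    using Suc by (intro dvd_add dvd_mult2) (simp_all add: x_def y_def z_def)
  finally show ?case by (simp only: sq x_def y_def z_def)
qed

lemma two_dvd_power_diff:
  fixes a b :: "'a :: comm_ring_1"
  shows "2 dvd (a - b) ^ (2 ^ h) - (a ^ (2 ^ h) - b ^ (2 ^ h))"
proof -
  have "2 dvd - (((a - b) + b) ^ (2 ^ h) - ((a - b) ^ (2 ^ h) + b ^ (2 ^ h)))"
    using two_dvd_power_add[of "a - b" b h] by (simp only: dvd_minus_iff)
  then show ?thesis by (simp add: algebra_simps)
qed

lemma two_dvd_power_sum:
  fixes a :: "'i \<Rightarrow> 'a :: comm_ring_1"
  assumes "finite I"
  shows "2 dvd (\<Sum>i\<in>I. a i) ^ (2 ^ h) - (\<Sum>i\<in>I. a i ^ (2 ^ h))"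
  using assms
proof (induction I)
  case empty
  then show ?case by (simp add: power_0_left)
next
  case (insert j I)
  have "2 dvd ((a j + (\<Sum>i\<in>I. a i)) ^ (2 ^ h) - (a j ^ (2 ^ h) + (\<Sum>i\<in>I. a i) ^ (2 ^ h)))
      + ((\<Sum>i\<in>I. a i) ^ (2 ^ h) - (\<Sum>i\<in>I. a i ^ (2 ^ h)))"
    by (intro dvd_add two_dvd_power_add insert.IH)
  then show ?case using insert.hyps by (simp add: algebra_simps)
qed

text \<open>A series without constant term that is fixed by the Frobenius map equals all of its iterates,
  whose orders of vanishing are unbounded.\<close>
lemma two_dvd_of_frobenius_fixed:
  fixes V :: "int fls"
  assumes V: "\<And>n. n \<le> 0 \<Longrightarrow> V $$ n = 0" and fixed: "2 dvd V - V ^ (2 ^ h)" and h: "h \<ge> 1"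
  shows "2 dvd V"
proof (cases "V = 0")
  case False
  have iter: "2 dvd V - V ^ (2 ^ (h * n))" for n
  proof (induction n)
    case 0
    then show ?case by simp
  next
    case (Suc n)
    \<comment> \<open>Raising the given relation to the power 2^(hn) and splitting that power by
      additivity relates consecutive iterates.\<close>
    have "(V - V ^ (2 ^ h)) dvd (V - V ^ (2 ^ h)) ^ (2 ^ (h * n))"
      by (intro dvd_power) simp
    then have "2 dvd (V - V ^ (2 ^ h)) ^ (2 ^ (h * n))" using fixed by (rule dvd_trans[rotated])
    moreover have "2 dvd (V - V ^ (2 ^ h)) ^ (2 ^ (h * n))
        - (V ^ (2 ^ (h * n)) - (V ^ (2 ^ h)) ^ (2 ^ (h * n)))"
      by (rule two_dvd_power_diff)
    ultimately have "2 dvd V ^ (2 ^ (h * n)) - (V ^ (2 ^ h)) ^ (2 ^ (h * n))"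
      by (metis dvd_diff_right_iff)
    then have "2 dvd (V - V ^ (2 ^ (h * n))) + (V ^ (2 ^ (h * n)) - V ^ (2 ^ (h * Suc n)))"
      by (intro dvd_add Suc) (simp add: power_mult[symmetric] power_add)
    then show ?case by simp
  qed
  have sub: "fls_subdegree V \<ge> 1"
    using V False by (metis fls_subdegree_geI int_one_le_iff_zero_less nth_fls_subdegree_nonzero not_le)
  have "2 dvd V $$ k" for k
  proof -
    define n where "n = nat k"
    have "k < int (2 ^ (h * n))"
    proof -
      have "n < 2 ^ n" by (rule less_exp)
      also have "\<dots> \<le> 2 ^ (h * n)" using h by (intro power_increasing) auto
      finally have "int n < int (2 ^ (h * n))" by (simp only: of_nat_less_iff)
      moreover have "k \<le> int n" by (simp add: n_def)
      ultimately show ?thesis by linarith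
    qed
    also have "\<dots> \<le> int (2 ^ (h * n)) * fls_subdegree V"
      using mult_left_mono[OF sub, of "int (2 ^ (h * n))"] by simp
    also have "\<dots> = fls_subdegree (V ^ (2 ^ (h * n)))" by (simp add: fls_subdegree_pow)
    finally have "(V ^ (2 ^ (h * n))) $$ k = 0" by simp
    moreover have "2 dvd (V - V ^ (2 ^ (h * n))) $$ k"
      using iter[of n] of_int_dvd_fls_iff[of 2] by simp
    ultimately show ?thesis by simp
  qed
  then show ?thesis using of_int_dvd_fls_iff[of 2 V] by simp
qed simp

section \<open>The basic series: Frobenius relation and Euler derivative\<close>

lemma Phi_nth: "Phi h $$ k = (if \<exists>n. k = 2 ^ (n * h) then 1 else 0)"
proof -
  have "(\<exists>n. nat k = 2 ^ (n * h)) \<longleftrightarrow> (\<exists>n. k = 2 ^ (n * h))" if "k \<ge> 0"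
    using that by (metis nat_eq_iff2 nat_2 nat_power_eq of_nat_numeral of_nat_power zero_le_numeral)
  moreover have "\<not> (\<exists>n. k = 2 ^ (n * h))" if "k < 0"
    using that by (metis not_less zero_le_numeral zero_le_power)
  ultimately show ?thesis by (auto simp: Phi_def)
qed

text \<open>Modulo 2, the Frobenius power sends t^(2^(ih)) to t^(2^((i+1)h)); it shifts the series
  by one term and loses only the first one, t. As additivity is available for finite sums, each
  coefficient is checked on a truncation.\<close>

lemma Phi_frobenius:
  assumes h: "h \<ge> 1"
  shows "2 dvd Phi h - (fls_X + Phi h ^ (2 ^ h))"
proof -
  define R where "R n = Phi h - (\<Sum>i<n. fls_X_intpow (2 ^ (i * h)))" for n
  have inj: "(2 :: int) ^ (i * h) = 2 ^ (j * h) \<longleftrightarrow> i = j" for i j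
    using h by (auto simp: power_inject_exp)
  have R_nth: "R n $$ k = 0" if "k < 2 ^ (n * h)" for n k
  proof -
    have "(\<Sum>i<n. fls_X_intpow (2 ^ (i * h)) $$ k) = (\<Sum>i<n. if k = 2 ^ (i * h) then 1 else (0 :: int))"
      by (intro sum.cong) auto
    also have "\<dots> = (if \<exists>n. k = 2 ^ (n * h) then 1 else 0)"
    proof (cases "\<exists>j. k = 2 ^ (j * h)")
      case True
      then obtain j where j: "k = 2 ^ (j * h)" by blast
      then have "j < n" using that h
        by (metis mult_le_mono1 not_less one_le_numeral power_increasing)
      then show ?thesis using j by (simp add: inj)
    next
      case False
      then show ?thesis by auto
    qed
    finally show ?thesis by (simp add: R_def fls_nth_sum Phi_nth)
  qed
  have "even ((Phi h - (fls_X + Phi h ^ (2 ^ h))) $$ k)" for k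
  proof -
    \<comment> \<open>With this many terms the tail \<open>R n\<close>, its power and the boundary
      monomial t^(2^(nh)) all have coefficient 0 at \<open>k\<close>.\<close>
    define n where "n = Suc (nat k)"
    have kn: "k < 2 ^ (n * h)"
    proof -
      have "n < 2 ^ n" by (rule less_exp)
      also have "\<dots> \<le> 2 ^ (n * h)" using h by (intro power_increasing) auto
      finally have "int n < int (2 ^ (n * h))" by (simp only: of_nat_less_iff)
      moreover have "k < int n" by (simp add: n_def)
      ultimately have "k < int (2 ^ (n * h))" by linarith
      then show ?thesis by simp
    qed
    define s where "s = (\<Sum>i<n. fls_X_intpow (2 ^ (i * h)) :: int fls)"
    have Phi: "Phi h = s + R n" by (simp add: R_def s_def)
    have pw: "(fls_X_intpow (2 ^ (i * h)) :: int fls) ^ (2 ^ h) = fls_X_intpow (2 ^ (Suc i * h))" for i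
      unfolding fls_X_intpow_power by (simp add: power_add)
    have "2 dvd ((s + R n) ^ (2 ^ h) - (s ^ (2 ^ h) + R n ^ (2 ^ h)))
        + (s ^ (2 ^ h) - (\<Sum>i<n. fls_X_intpow (2 ^ (Suc i * h))))"
      unfolding s_def by (intro dvd_add two_dvd_power_add)
        (use two_dvd_power_sum[of "{..<n}" "\<lambda>i. fls_X_intpow (2 ^ (i * h)) :: int fls" h] in
          \<open>simp only: pw finite_lessThan\<close>)
    then have "2 dvd Phi h ^ (2 ^ h) - (R n ^ (2 ^ h) + (\<Sum>i<n. fls_X_intpow (2 ^ (Suc i * h))))"
      by (simp add: Phi algebra_simps)
    then have ev: "even ((Phi h ^ (2 ^ h) - (R n ^ (2 ^ h) + (\<Sum>i<n. fls_X_intpow (2 ^ (Suc i * h))))) $$ k)"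
      using of_int_dvd_fls_iff[of 2] by simp
    have Rp: "(R n ^ (2 ^ h)) $$ k = 0"
    proof (cases "R n = 0")
      case False
      have ge: "fls_subdegree (R n) \<ge> 2 ^ (n * h)"
        using False R_nth by (intro fls_subdegree_geI) auto
      have "(1 :: int) \<le> 2 ^ h" by simp
      then have "1 * fls_subdegree (R n) \<le> 2 ^ h * fls_subdegree (R n)"
        using ge by (intro mult_right_mono) (auto intro: order_trans[of 0 "2 ^ (n * h)"])
      then have "k < fls_subdegree (R n ^ (2 ^ h))"
        using kn ge by (simp add: fls_subdegree_pow)
      then show ?thesis by simp
    qed (simp add: power_0_left)
    have "(\<Sum>i<n. fls_X_intpow (2 ^ (i * h)) :: int fls) + fls_X_intpow (2 ^ (n * h))
        = fls_X + (\<Sum>i<n. fls_X_intpow (2 ^ (Suc i * h)))"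
      using sum.lessThan_Suc_shift[of "\<lambda>i. fls_X_intpow (2 ^ (i * h)) :: int fls" n]
      by (simp add: fls_X_conv_shift_1)
    then have "s - fls_X = (\<Sum>i<n. fls_X_intpow (2 ^ (Suc i * h))) - fls_X_intpow (2 ^ (n * h))"
      by (simp add: s_def algebra_simps)
    then have "(s - fls_X) $$ k = (\<Sum>i<n. fls_X_intpow (2 ^ (Suc i * h))) $$ k"
      using kn by simp
    then have "(Phi h - (fls_X + Phi h ^ (2 ^ h))) $$ k
        = - ((Phi h ^ (2 ^ h) - (R n ^ (2 ^ h) + (\<Sum>i<n. fls_X_intpow (2 ^ (Suc i * h))))) $$ k)"
      using Rp R_nth[OF kn] by (simp add: Phi)
    with ev show ?thesis by (simp only: dvd_minus_iff)
  qed
  then show ?thesis using of_int_dvd_fls_iff[of 2] by simp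
qed

text \<open>The Euler operator multiplies t^(2^(ih)) by 2^(ih), which vanishes modulo
  \<open>2 ^ \<gamma>\<close> from i = \<gamma> on; what remains is a Laurent polynomial.\<close>

lemma euler_Phi_mod:
  assumes h: "h \<ge> 1"
  shows "fls_euler (Phi h) \<in> poly_in_mod (2 ^ \<gamma>) (Phi h)"
proof -
  define c where "c = (\<Sum>i<\<gamma>. of_int (2 ^ (i * h)) * fls_X_intpow (2 ^ (i * h)) :: int fls)"
  have inj: "(2 :: int) ^ (i * h) = 2 ^ (j * h) \<longleftrightarrow> i = j" for i j
    using h by (auto simp: power_inject_exp)
  have "2 ^ \<gamma> dvd (fls_euler (Phi h) - c) $$ k" for k
  proof -
    have c_nth: "c $$ k = (\<Sum>i<\<gamma>. if k = 2 ^ (i * h) then 2 ^ (i * h) else 0)"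
      unfolding c_def fls_nth_sum fls_of_int_mult_nth by (intro sum.cong) auto
    show ?thesis
    proof (cases "\<exists>j. k = 2 ^ (j * h)")
      case True
      then obtain j where j: "k = 2 ^ (j * h)" by blast
      then have c: "c $$ k = (if j < \<gamma> then 2 ^ (j * h) else 0)"
        unfolding c_nth by (simp add: inj)
      have "2 ^ \<gamma> dvd (2 :: int) ^ (j * h)" if "\<not> j < \<gamma>"
        using that h by (intro le_imp_power_dvd) (metis mult_le_mono nat_mult_1_right not_less)
      with c j show ?thesis by (auto simp: Phi_nth)
    next
      case False
      then show ?thesis by (auto simp: Phi_nth c_nth intro!: sum.neutral)
    qed
  qed
  then have "of_int (2 ^ \<gamma>) dvd fls_euler (Phi h) - c"
    using of_int_dvd_fls_iff by blast
  moreover have "is_laurent_poly c" unfolding c_def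
    by (intro is_laurent_poly_sum is_laurent_poly_mult is_laurent_poly_of_int is_laurent_poly_X_intpow)
  ultimately show ?thesis by (blast intro: poly_in_mod_cong)
qed

section \<open>The Riccati-type equation\<close>

text \<open>This is (D + u + c_(j-1)) ... (D + u + c_0) applied to 1. It arises from (D + c_(j-1))
  ... (D + c_0) by conjugation with a series G such that D G = u G.\<close>

primrec twisted_prod :: "('r \<Rightarrow> 'r) \<Rightarrow> (nat \<Rightarrow> 'r) \<Rightarrow> 'r :: comm_ring_1 \<Rightarrow> nat \<Rightarrow> 'r" where
  "twisted_prod D c u 0 = 1"
| "twisted_prod D c u (Suc j) = D (twisted_prod D c u j) + (u + c j) * twisted_prod D c u j"

lemma twisted_prod_shift:
  "twisted_prod D (\<lambda>j. c j + a) u j = twisted_prod D c (u + a) j"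
  by (induction j) (simp_all add: algebra_simps)

lemma twisted_prod_mod_2:
  fixes E :: "'r :: comm_ring_1 \<Rightarrow> 'r"
  shows "\<exists>R. twisted_prod (\<lambda>f. 2 * E f) (\<lambda>j. 2 * d j) F j = F ^ j + 2 * R"
proof (induction j)
  case 0
  then show ?case by (auto intro: exI[of _ 0])
next
  case (Suc j)
  then obtain R where R: "twisted_prod (\<lambda>f. 2 * E f) (\<lambda>j. 2 * d j) F j = F ^ j + 2 * R" ..
  show ?case unfolding twisted_prod.simps R
    by (rule exI[of _ "E (F ^ j + 2 * R) + F * R + d j * (F ^ j + 2 * R)"])
       (simp add: algebra_simps)
qed

text \<open>The variation is needed to first order only, but with its exact coefficient: it is that
  of the plain power F^j, and a later factor 2 comes from j being even. Terms with \<open>E\<close>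
  or \<open>d\<close> gain a factor 2, and terms quadratic in 2^k are absorbed since k >= 1.\<close>

lemma twisted_prod_contract:
  fixes E :: "'r :: comm_ring_1 \<Rightarrow> 'r"
  assumes add: "\<And>f g. E (f + g) = E f + E g" and scale: "\<And>f k. E (2 ^ k * f) = 2 ^ k * E f"
    and k: "k \<ge> 1"
  shows "\<exists>Q. twisted_prod (\<lambda>f. 2 * E f) (\<lambda>j. 2 * d j) (F + 2 ^ k * e) j
    = twisted_prod (\<lambda>f. 2 * E f) (\<lambda>j. 2 * d j) F j
      + 2 ^ k * (of_nat j * e * F ^ (j - 1)) + 2 ^ Suc k * Q"
proof (induction j)
  case 0
  then show ?case by (auto intro: exI[of _ 0])
next
  case (Suc j)
  let ?T = "twisted_prod (\<lambda>f. 2 * E f) (\<lambda>j. 2 * d j)"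
  obtain l where l: "k = Suc l" using k by (cases k) auto
  obtain R where R: "?T F j = F ^ j + 2 * R"
    using twisted_prod_mod_2 by blast
  define G where "G = of_nat j * e * F ^ (j - 1)"
  obtain Q where Q: "?T (F + 2 ^ k * e) j = ?T F j + 2 ^ k * G + 2 ^ Suc k * Q"
    using Suc unfolding G_def by blast
  \<comment> \<open>For j = 0 the truncated exponent j - 1 does no harm, as \<open>of_nat j\<close>
    is 0.\<close>
  have FG: "F * G = of_nat j * e * F ^ j"
    by (cases j) (simp_all add: G_def algebra_simps)
  have "E (?T (F + 2 ^ k * e) j) = E (?T F j) + 2 ^ k * E G + 2 ^ Suc k * E Q"
    unfolding Q by (simp only: add scale)
  then have "?T (F + 2 ^ k * e) (Suc j)
      = 2 * (E (?T F j) + 2 ^ k * E G + 2 ^ Suc k * E Q)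
        + (F + 2 ^ k * e + 2 * d j) * (?T F j + 2 ^ k * G + 2 ^ Suc k * Q)"
    using Q by simp
  also have "\<dots> = (2 * E (?T F j) + (F + 2 * d j) * ?T F j) + 2 ^ k * (e * F ^ j + F * G)
      + 2 ^ Suc k * (E G + 2 * E Q + e * R + 2 ^ l * e * G + d j * G + (F + 2 ^ k * e + 2 * d j) * Q)"
  proof -
    have "2 * (x + 2 ^ k * E G + 2 ^ Suc k * E Q)
        + (F + 2 ^ k * e + 2 * d j) * (F ^ j + 2 * R + 2 ^ k * G + 2 ^ Suc k * Q)
      = (2 * x + (F + 2 * d j) * (F ^ j + 2 * R)) + 2 ^ k * (e * F ^ j + F * G)
      + 2 ^ Suc k * (E G + 2 * E Q + e * R + 2 ^ l * e * G + d j * G + (F + 2 ^ k * e + 2 * d j) * Q)" for x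
      by (simp add: l algebra_simps)
    from this[of "E (F ^ j + 2 * R)"] show ?thesis by (simp only: R)
  qed
  also have "2 * E (?T F j) + (F + 2 * d j) * ?T F j = ?T F (Suc j)" by simp
  also have "e * F ^ j + F * G = of_nat (Suc j) * e * F ^ (Suc j - 1)"
    unfolding FG by (simp add: algebra_simps)
  finally show ?case by blast
qed

text \<open>Made for the substitution z = t^s: it is a ring homomorphism, but it intertwines the two
  differential operators only modulo \<open>M\<close>, because a division by s is involved.\<close>

lemma twisted_prod_cong_mod:
  fixes M :: "'r :: comm_ring_1"
  assumes add: "\<And>f g. D (f - g) = D f - D g" and scale: "\<And>f. M dvd f \<Longrightarrow> M dvd D f"
    and h: "\<And>f g. h (f + g) = h f + h g" "\<And>f g. h (f * g) = h f * h g" "h 1 = 1"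
    and D: "\<And>f. M dvd h (D' f) - D (h f)"
  shows "M dvd h (twisted_prod D' c u j) - twisted_prod D (\<lambda>j. h (c j)) (h u) j"
proof (induction j)
  case 0
  then show ?case by (simp add: h)
next
  case (Suc j)
  let ?x = "twisted_prod D' c u j" and ?y = "twisted_prod D (\<lambda>j. h (c j)) (h u) j"
  have "h (twisted_prod D' c u (Suc j)) - twisted_prod D (\<lambda>j. h (c j)) (h u) (Suc j)
      = (h (D' ?x) - D (h ?x)) + D (h ?x - ?y) + (h u + h (c j)) * (h ?x - ?y)"
    by (simp add: h add algebra_simps)
  also have "M dvd \<dots>" using Suc by (intro dvd_add D scale dvd_mult) simp_all
  finally show ?case .
qed

lemma twisted_prod_poly_in_mod:
  assumes "\<And>f. f \<in> poly_in_mod M w \<Longrightarrow> D f \<in> poly_in_mod M w" "\<And>j. c j \<in> poly_in_mod M w"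
    "u \<in> poly_in_mod M w"
  shows "twisted_prod D c u j \<in> poly_in_mod M w"
proof (induction j)
  case 0
  then show ?case by (auto intro: poly_in_mod_laurent)
next
  case (Suc j)
  then show ?case
    unfolding twisted_prod.simps by (intro poly_in_mod_add poly_in_mod_mult assms)
qed

text \<open>Purely arithmetic: of the groups only the even factor of the Euler operator and the
  parity of the constants are left. Inserting an approximation from the ring into the equation gives
  another one, correct to one more binary digit.\<close>

theorem riccati_mod_power_of_two:
  fixes u :: "int fps" and c :: "nat \<Rightarrow> int" and q h a m \<gamma> :: nat
  assumes h: "h \<ge> 1" and q: "q = 2 ^ h + 1" and \<gamma>: "\<gamma> \<ge> 1"
    and u0: "u $ 0 = 0" and c: "\<And>j. even (c j - int m)"
    and u: "u = fps_X * twisted_prod (\<lambda>f. of_nat (2 * a) * fps_XD f) (\<lambda>j. of_int (c j)) u (2 ^ h)"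
  shows "fls_compose_power (fps_to_fls u) (q - 2) \<in> poly_in_mod (2 ^ \<gamma>) (Phi h)"
proof -
  let ?P = "poly_in_mod (2 ^ \<gamma>) (Phi h)"
  let ?t = "twisted_prod (\<lambda>f. of_nat (2 * a) * fps_XD f) (\<lambda>j. of_int (c j)) u (2 ^ h)"
  define s where "s = q - 2"
  have h2: "even ((2 :: nat) ^ h)" "(2 :: nat) ^ h \<ge> 2" using h
    by (auto simp: self_le_power)
  have s: "s = 2 ^ h - 1" "s > 0" "s + 1 = 2 ^ h" "odd s"
    using h2 unfolding s_def q by auto
  \<comment> \<open>The inverse \<open>r\<close> of \<open>s\<close> compensates that t d/dt
    multiplies t^(sk) by sk, whereas z d/dz multiplies z^k by k.\<close>
  have "coprime (int s) (2 ^ \<gamma>)" using s(4) by simp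
  then obtain r where "[int s * r = 1] (mod 2 ^ \<gamma>)" using cong_solve_coprime_int by blast
  then have r: "2 ^ \<gamma> dvd int s * r - 1" by (simp add: cong_iff_dvd_diff)
  define \<kappa> where "\<kappa> p = fls_compose_power (fps_to_fls p) s" for p :: "int fps"
  have \<kappa>_hom: "\<kappa> (f + g) = \<kappa> f + \<kappa> g" "\<kappa> (f * g) = \<kappa> f * \<kappa> g" "\<kappa> 1 = 1" for f g
    using s(2) by (simp_all add: \<kappa>_def fls_times_fps_to_fls)
  have \<kappa>_X: "\<kappa> fps_X = fls_X_intpow (int s)" using s(2) by (simp add: \<kappa>_def)
  have \<kappa>_int: "\<kappa> (of_int k) = of_int k" for k
    using s(2) by (simp add: \<kappa>_def fps_to_fls_of_int fls_of_int)
  define E where "E f = of_int (r * int a) * fls_euler f" for f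
  have E_add: "E (f + g) = E f + E g" for f g
    by (simp add: E_def fls_euler_add algebra_simps)
  have E_scale: "E (of_int k * f) = of_int k * E f" for k f
    unfolding E_def fls_euler_of_int_mult by (simp add: ac_simps)
  have E_scale2: "E (2 ^ k * f) = 2 ^ k * E f" for k f
    using E_scale[of "2 ^ k" f] by simp
  have E_diff: "E (f - g) = E f - E g" for f g
    using E_add[of "f - g" g] by simp
  have D_\<kappa>: "of_int (2 ^ \<gamma>) dvd \<kappa> (of_nat (2 * a) * fps_XD f) - 2 * E (\<kappa> f)" for f
  proof -
    have "2 ^ \<gamma> dvd (\<kappa> (of_nat (2 * a) * fps_XD f) - 2 * E (\<kappa> f)) $$ n" for n
    proof -
      have nth: "\<kappa> g $$ n = (if int s dvd n then fps_to_fls g $$ (n div int s) else 0)" for g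
        using s(2) by (simp add: \<kappa>_def fls_nth_compose_power)
      have two: "(2 :: int fls) = of_int 2" by simp
      have A: "(2 * E (\<kappa> f)) $$ n = 2 * (r * int a * (n * \<kappa> f $$ n))"
        unfolding two E_def fls_of_int_mult_nth by simp
      have B: "(of_nat (2 * a) * fps_XD f) $ k = int (2 * a) * (int k * f $ k)" for k
        by (simp flip: fps_of_nat of_nat_mult)
      show ?thesis
      \<comment> \<open>Away from the nonnegative multiples of \<open>s\<close> both coefficients
        vanish; at n = s k the factors r n and k agree modulo \<open>2 ^ \<gamma>\<close>.\<close>
      proof (cases "int s dvd n \<and> n \<ge> 0")
        case True
        then obtain k where n: "n = int s * k" by (auto elim: dvdE)
        with True s(2) have k: "k \<ge> 0" by (simp add: zero_le_mult_iff)
        have nth': "\<kappa> g $$ n = g $ nat k" for g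
          unfolding nth using k s(2) by (simp add: n)
        have "(\<kappa> (of_nat (2 * a) * fps_XD f) - 2 * E (\<kappa> f)) $$ n
            = - ((int s * r - 1) * (2 * int a * k * f $ nat k))"
          unfolding fls_minus_nth A nth' B using k by (simp add: n algebra_simps)
        then show ?thesis using r by (simp add: dvd_mult2)
      next
        case False
        then have "\<kappa> g $$ n = 0" for g
          using s(2) unfolding nth by (auto simp: zero_le_mult_iff elim!: dvdE)
        then show ?thesis unfolding fls_minus_nth A by simp
      qed
    qed
    then show ?thesis using of_int_dvd_fls_iff by blast
  qed
  \<comment> \<open>All \<open>c j\<close> have the parity of \<open>m\<close>. Moving this parity
    into the unknown leaves even constants \<open>2 * d j\<close>, as the contraction
    requires.\<close>
  define \<epsilon> where "\<epsilon> = int m mod 2"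
  define d where "d j = (of_int ((c j - \<epsilon>) div 2) :: int fls)" for j
  have d: "of_int (c j) = 2 * d j + of_int \<epsilon>" for j
  proof -
    have "even (c j - \<epsilon>)" using c[of j] unfolding \<epsilon>_def by presburger
    then have "c j = 2 * ((c j - \<epsilon>) div 2) + \<epsilon>" by simp
    then show ?thesis unfolding d_def by (metis of_int_add of_int_mult of_int_numeral)
  qed
  let ?tw = "twisted_prod (\<lambda>f. 2 * E f) (\<lambda>j. 2 * d j)"
  define T where "T F = of_int \<epsilon> + fls_X_intpow (int s)
      * ?tw F (2 ^ h)" for F
  define F where "F = \<kappa> u + of_int \<epsilon>"
  have F: "of_int (2 ^ \<gamma>) dvd F - T F"
  proof -
    have "of_int (2 ^ \<gamma>) dvd
        \<kappa> (?t)
        - twisted_prod (\<lambda>f. 2 * E f) (\<lambda>j. \<kappa> (of_int (c j))) (\<kappa> u) (2 ^ h)"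
      using E_scale2[of \<gamma>]
      by (intro twisted_prod_cong_mod D_\<kappa> \<kappa>_hom) (auto simp: E_diff algebra_simps elim!: dvdE)
    then have "of_int (2 ^ \<gamma>) dvd fls_X_intpow (int s) *
        (\<kappa> (?t)
        - ?tw F (2 ^ h))"
      by (intro dvd_mult) (simp only: \<kappa>_int d F_def twisted_prod_shift)
    moreover have "\<kappa> u = fls_X_intpow (int s) *
        \<kappa> (?t)"
      by (subst u) (simp only: \<kappa>_hom \<kappa>_X)
    ultimately show ?thesis by (simp add: T_def F_def algebra_simps)
  qed
  have contract: "2 ^ Suc k dvd T (A + 2 ^ k * e) - T A" if k: "k \<ge> 1" for A e k
  proof -
    obtain Q where Q: "?tw (A + 2 ^ k * e) (2 ^ h)
        = ?tw A (2 ^ h)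
          + 2 ^ k * (of_nat (2 ^ h) * e * A ^ (2 ^ h - 1)) + 2 ^ Suc k * Q"
      using twisted_prod_contract[OF E_add E_scale2 k] by blast
    \<comment> \<open>One factor 2 of the number 2^h of operators; it lifts the linear term from 2^k
      to 2^(k+1).\<close>
    obtain l where l: "h = Suc l" using h by (cases h) auto
    have "T (A + 2 ^ k * e) - T A = 2 ^ Suc k *
        (fls_X_intpow (int s) * (2 ^ l * e * A ^ (2 ^ h - 1) + Q))"
      unfolding T_def Q by (simp add: l algebra_simps)
    then show ?thesis by (metis dvd_triv_left)
  qed
  text \<open>Modulo 2 the equation reads \<open>F = \<epsilon> + t\<^bsup>s\<^esup> F\<^bsup>s+1\<^esup>\<close>, so \<open>t F\<close> solves the equation
    \<open>W = \<epsilon> t + W\<^bsup>s+1\<^esup>\<close> of \<open>\<epsilon> \<Phi>\<close>.\<close>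
  have base: "2 dvd fls_X * F - of_int \<epsilon> * Phi h"
  proof (rule two_dvd_of_frobenius_fixed)
    obtain R where R: "?tw F (2 ^ h) = F ^ (2 ^ h) + 2 * R"
      using twisted_prod_mod_2 by blast
    have "(2 :: int fls) dvd 2 ^ \<gamma>" using \<gamma> by (simp add: dvd_power)
    with F have "2 dvd fls_X * (F - T F)" by (auto intro: dvd_mult dvd_trans)
    then have "2 dvd fls_X * (F - T F) + 2 * (fls_X * fls_X_intpow (int s) * R)" by simp
    moreover have "fls_X * (F - T F) + 2 * (fls_X * fls_X_intpow (int s) * R)
        = fls_X * F - of_int \<epsilon> * fls_X - (fls_X * fls_X_intpow (int s)) * F ^ (2 ^ h)"
      unfolding T_def R by (simp add: algebra_simps)
    moreover have "fls_X * fls_X_intpow (int s) = (fls_X :: int fls) ^ (2 ^ h)"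
      using s(3) by (metis fls_X_power_conv_shift_1 power_Suc Suc_eq_plus1)
    ultimately have 1: "2 dvd fls_X * F - of_int \<epsilon> * fls_X - (fls_X * F) ^ (2 ^ h)"
      by (simp only: power_mult_distrib)
    have 2: "2 dvd of_int \<epsilon> * (Phi h - (fls_X + Phi h ^ (2 ^ h)))"
      by (intro dvd_mult Phi_frobenius h)
    \<comment> \<open>The parity is idempotent, so it can be moved inside the power; odd and even
      \<open>m\<close> are thereby treated together.\<close>
    have "\<epsilon> = 0 \<or> \<epsilon> = 1" unfolding \<epsilon>_def by presburger
    then have \<epsilon>: "of_int \<epsilon> * Phi h ^ (2 ^ h) = (of_int \<epsilon> * Phi h) ^ (2 ^ h)"
      by (auto simp: power_0_left)
    let ?V = "fls_X * F - of_int \<epsilon> * Phi h"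
    have "2 dvd ((fls_X * F - of_int \<epsilon> * fls_X - (fls_X * F) ^ (2 ^ h))
        - of_int \<epsilon> * (Phi h - (fls_X + Phi h ^ (2 ^ h))))
        - (?V ^ (2 ^ h) - ((fls_X * F) ^ (2 ^ h) - (of_int \<epsilon> * Phi h) ^ (2 ^ h)))"
      by (intro dvd_diff 1 2 two_dvd_power_diff)
    then show "2 dvd ?V - ?V ^ (2 ^ h)"
      unfolding \<epsilon>[symmetric] by (simp add: algebra_simps)
  next
    \<comment> \<open>\<open>F\<close> is a power series, so t F starts at t, and so does
      \<open>Phi h\<close>.\<close>
    fix n :: int assume n: "n \<le> 0"
    have "\<not> (\<exists>j. n = 2 ^ (j * h))" using n by (metis not_less zero_less_numeral zero_less_power)
    then have "Phi h $$ n = 0" by (simp add: Phi_nth)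
    moreover have "F $$ (n - 1) = 0"
    proof -
      have "\<kappa> u $$ (n - 1) = 0"
        using n s(2) u0 unfolding \<kappa>_def
        by (auto simp: fls_nth_compose_power pos_imp_zdiv_neg_iff)
      then show ?thesis using n by (simp add: F_def fls_of_int)
    qed
    ultimately show "(fls_X * F - of_int \<epsilon> * Phi h) $$ n = 0"
      by (simp add: fls_X_times_conv_shift)
  qed (rule h)
  \<comment> \<open>The induction starts at precision 2^1, given by \<open>base\<close>, because the
    contraction is available only from k = 1 on.\<close>
  have "\<exists>A\<in>?P. 2 ^ Suc k dvd F - A" if "Suc k \<le> \<gamma>" for k
    using that
  proof (induction k)
    case 0
    \<comment> \<open>Solving \<open>base\<close> for \<open>F\<close> divides by t; this is where a
      negative power enters.\<close>
    let ?A = "fls_X_intpow (-1) * (of_int \<epsilon> * Phi h)"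
    have "fls_X_intpow (-1) * fls_X = (1 :: int fls)"
      by (simp add: fls_X_intpow_times_conv_shift fls_X_conv_shift_1)
    then have "F - ?A = fls_X_intpow (-1) * (fls_X * F - of_int \<epsilon> * Phi h)"
      unfolding right_diff_distrib mult.assoc[symmetric] by simp
    also have "2 dvd \<dots>" by (intro dvd_mult base)
    finally have "2 ^ Suc 0 dvd F - ?A" by simp
    moreover have "?A \<in> ?P"
      by (intro poly_in_mod_mult poly_in_mod_laurent is_laurent_poly_X_intpow is_laurent_poly_of_int
          poly_in_mod_self)
    ultimately show ?case by blast
  next
    case (Suc k)
    then obtain A where A: "A \<in> ?P" "2 ^ Suc k dvd F - A" by auto
    then obtain e where e: "F = A + 2 ^ Suc k * e" by (auto elim!: dvdE simp: algebra_simps)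
    have "(2 :: int fls) ^ Suc (Suc k) dvd of_int (2 ^ \<gamma>)"
      using Suc.prems by (simp only: of_int_power of_int_numeral le_imp_power_dvd)
    then have "2 ^ Suc (Suc k) dvd (F - T F) + (T F - T A)"
      using F contract[of "Suc k" A e] unfolding e[symmetric] by (intro dvd_add) (auto intro: dvd_trans)
    then have "2 ^ Suc (Suc k) dvd F - T A" by simp
    moreover have "T A \<in> ?P"
    proof -
      have "2 * E f \<in> ?P" if "f \<in> ?P" for f
      proof -
        have "2 * E f = of_int (2 * (r * int a)) * fls_euler f" by (simp add: E_def)
        moreover have "of_int (2 * (r * int a)) * fls_euler f \<in> ?P"
          by (intro poly_in_mod_mult poly_in_mod_euler[OF euler_Phi_mod[OF h] that]
              poly_in_mod_laurent is_laurent_poly_of_int)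
        ultimately show ?thesis by (simp only:)
      qed
      moreover have "2 * d j \<in> ?P" for j
      proof -
        have "2 * d j = of_int (2 * ((c j - \<epsilon>) div 2))" by (simp add: d_def)
        then show ?thesis by (metis is_laurent_poly_of_int poly_in_mod_laurent)
      qed
      ultimately have "?tw A (2 ^ h) \<in> ?P"
        using A(1) by (rule twisted_prod_poly_in_mod)
      then show ?thesis unfolding T_def
        by (intro poly_in_mod_add[OF poly_in_mod_laurent] poly_in_mod_mult[OF poly_in_mod_laurent]
            is_laurent_poly_of_int is_laurent_poly_X_intpow)
    qed
    ultimately show ?case by blast
  qed
  from this[of "\<gamma> - 1"] \<gamma> obtain A where A: "A \<in> ?P" "2 ^ \<gamma> dvd F - A"
    by auto
  then have "F \<in> ?P" by (intro poly_in_mod_cong[OF A(1)]) simp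
  then have "F + of_int (- \<epsilon>) \<in> ?P"
    by (rule poly_in_mod_add) (intro poly_in_mod_laurent is_laurent_poly_of_int)
  then show ?thesis by (simp add: F_def \<kappa>_def s_def)
qed

lemma poly_in_mod_Phi_degree:
  assumes h: "h \<ge> 1" and \<gamma>: "\<gamma> \<ge> 1" and A: "A \<in> poly_in_mod (2 ^ \<gamma>) (Phi h)"
  obtains P where "laurent_coeffs P" "degree P \<le> 2 ^ h * \<gamma> - 1"
    "of_int (2 ^ \<gamma>) dvd A - poly P (Phi h)"
proof -
  \<comment> \<open>\<open>S\<close> is Y^(2^h) - Y + t, which is even at Y = \<open>Phi h\<close>,
    so its power is divisible by \<open>2 ^ \<gamma>\<close> there. As that power is monic,
    \<open>R\<close> expresses the top power of \<open>Phi h\<close> by lower ones.\<close>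
  define S :: "int fls poly" where "S = monom 1 (2 ^ h) - [:- fls_X, 1:]"
  define R where "R = monom 1 (2 ^ h * \<gamma>) - S ^ \<gamma>"
  have h2: "(2 :: nat) ^ h \<ge> 2" using h by (auto simp: self_le_power)
  have lX: "is_laurent_poly fls_X"
    using is_laurent_poly_X_intpow[of 1] by (simp add: fls_X_conv_shift_1)
  have "laurent_coeffs (monom 1 n)" for n by (simp add: laurent_coeffs_def)
  moreover from this have "laurent_coeffs S" unfolding S_def using lX
    by (intro laurent_coeffs_add[of _ "- _", simplified]) auto
  ultimately have "laurent_coeffs R" unfolding R_def
    by (intro laurent_coeffs_add[of _ "- _", simplified]) auto
  have dS: "degree S = 2 ^ h" "lead_coeff S = 1"
  proof -
    have "S = monom 1 (2 ^ h) + (- [:- fls_X, 1:])" by (simp add: S_def)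
    moreover have "degree (- [:- fls_X, 1:] :: int fls poly) < degree (monom (1 :: int fls) (2 ^ h))"
      using h2 by (simp add: degree_monom_eq)
    ultimately show dS: "degree S = 2 ^ h"
      by (simp only: degree_add_eq_left) (simp add: degree_monom_eq)
    have "coeff [:- fls_X :: int fls, 1:] (2 ^ h) = 0" using h2 by (intro coeff_eq_0) simp
    then show "lead_coeff S = 1" unfolding dS by (simp add: S_def)
  qed
  have dP: "degree (S ^ \<gamma>) = 2 ^ h * \<gamma>" "lead_coeff (S ^ \<gamma>) = 1"
  proof -
    have "S \<noteq> 0" using dS(2) by auto
    then show "degree (S ^ \<gamma>) = 2 ^ h * \<gamma>" using dS(1) by (simp add: degree_power_eq mult.commute)
    show "lead_coeff (S ^ \<gamma>) = 1" using dS(2) by (simp add: lead_coeff_power)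
  qed
  have dR: "degree R < 2 ^ h * \<gamma>"
  proof -
    have "degree R \<le> 2 ^ h * \<gamma>" unfolding R_def
      using dP(1) by (intro degree_diff_le) (simp_all add: degree_monom_eq)
    moreover have "coeff R (2 ^ h * \<gamma>) = 0" using dP unfolding R_def by simp
    ultimately show ?thesis
      using \<gamma> by (metis degree_0 leading_coeff_0_iff le_neq_implies_less less_le_trans mult_pos_pos
          zero_less_numeral zero_less_one zero_less_power)
  qed
  have "2 dvd poly S (Phi h)"
    using Phi_frobenius[OF h] dvd_minus_iff[of 2 "poly S (Phi h)"]
    by (simp add: S_def poly_monom algebra_simps)
  then have "2 ^ \<gamma> dvd poly S (Phi h) ^ \<gamma>" by (rule dvd_power_same)
  then have "of_int (2 ^ \<gamma>) dvd Phi h ^ (2 ^ h * \<gamma>) - poly R (Phi h)"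
    by (simp add: R_def poly_monom poly_power)
  from poly_in_mod_reduce_degree[OF A \<open>laurent_coeffs R\<close> this dR]
  obtain P where "laurent_coeffs P" "degree P < 2 ^ h * \<gamma>" "of_int (2 ^ \<gamma>) dvd A - poly P (Phi h)" .
  with that show thesis by simp
qed

section \<open>Permutation representations\<close>

abbreviation fun_inv :: "('a \<Rightarrow> 'b) \<Rightarrow> 'b \<Rightarrow> 'a" where
  "fun_inv \<equiv> inv_into UNIV"

definition letter_act :: "('g \<Rightarrow> 'p \<Rightarrow> 'p) \<Rightarrow> 'g \<times> bool \<Rightarrow> 'p \<Rightarrow> 'p" where
  "letter_act a l = (if snd l then a (fst l) else fun_inv (a (fst l)))"

text \<open>\<open>fold\<close> applies the first letter first, so words act from the right; this
  fits right multiplication on right cosets.\<close>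

definition word_act :: "('g \<Rightarrow> 'p \<Rightarrow> 'p) \<Rightarrow> 'g word \<Rightarrow> 'p \<Rightarrow> 'p" where
  "word_act a w = fold (letter_act a) w"

definition word_inv :: "'g word \<Rightarrow> 'g word" where
  "word_inv w = rev (map (\<lambda>(g, b). (g, \<not> b)) w)"

text \<open>Taken inside the set of words, before any relation is imposed. Relations and cycle
  lengths thus become membership conditions of one kind, and one count serves cyclic groups and
  \<open>Gamma m q\<close> alike.\<close>

definition stab :: "('g \<Rightarrow> 'p \<Rightarrow> 'p) \<Rightarrow> 'p \<Rightarrow> 'g word set" where
  "stab a p = {w. word_act a w p = p}"

definition orb :: "('g \<Rightarrow> 'p \<Rightarrow> 'p) \<Rightarrow> 'p \<Rightarrow> 'p set" where
  "orb a p = range (\<lambda>w. word_act a w p)"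

definition bijective :: "('g \<Rightarrow> 'p \<Rightarrow> 'p) \<Rightarrow> bool" where
  "bijective a \<longleftrightarrow> (\<forall>g. bij (a g))"

definition perm_rep :: "('g \<Rightarrow> 'p \<Rightarrow> 'p) \<Rightarrow> 'p set \<Rightarrow> bool" where
  "perm_rep a A \<longleftrightarrow> (\<forall>g. a g permutes A)"

lemma bijectiveD: "bijective a \<Longrightarrow> bij (a g)"
  by (simp add: bijective_def)

lemma perm_repD: "perm_rep a A \<Longrightarrow> a g permutes A"
  by (simp add: perm_rep_def)

lemma perm_rep_bijective: "perm_rep a A \<Longrightarrow> bijective a"
  by (auto simp: perm_rep_def bijective_def intro: permutes_bij)

lemma word_act_Nil [simp]: "word_act a [] p = p"
  by (simp add: word_act_def)

lemma word_act_Cons [simp]: "word_act a (l # w) p = word_act a w (letter_act a l p)"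
  by (simp add: word_act_def)

lemma word_act_append [simp]: "word_act a (u @ v) p = word_act a v (word_act a u p)"
  by (simp add: word_act_def)

lemma letter_act_simps [simp]:
  "letter_act a (g, True) = a g" "letter_act a (g, False) = fun_inv (a g)"
  by (simp_all add: letter_act_def)

lemma word_act_replicate: "word_act a (replicate i (g, True)) p = (a g ^^ i) p"
  by (induction i arbitrary: p) (simp_all add: funpow_swap1)

lemma word_inv_simps [simp]:
  "word_inv [] = []" "word_inv (u @ v) = word_inv v @ word_inv u"
  "word_inv ((g, b) # w) = word_inv w @ [(g, \<not> b)]"
  by (simp_all add: word_inv_def)

lemma letter_act_cancel:
  assumes "bij (a g)"
  shows "letter_act a (g, \<not> b) (letter_act a (g, b) p) = p"
  using assms by (cases b) (simp_all add: bij_is_inj bij_is_surj surj_f_inv_f)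

lemma word_act_inv_cancel:
  assumes "bijective a"
  shows "word_act a (word_inv w) (word_act a w p) = p"
proof (induction w arbitrary: p)
  case (Cons l w)
  obtain g b where "l = (g, b)" by (cases l)
  with Cons letter_act_cancel[of a g b, OF bijectiveD[OF assms]] show ?case by simp
qed simp

lemma word_inv_inv [simp]: "word_inv (word_inv w) = w"
  by (induction w) auto

lemma word_act_inv_cancel':
  assumes "bijective a"
  shows "word_act a w (word_act a (word_inv w) p) = p"
  using word_act_inv_cancel[of a "word_inv w" p] assms by simp

lemma word_act_word_cong:
  assumes "bijective a" and "\<And>l r. (l, r) \<in> R \<Longrightarrow> word_act a l = word_act a r"
    and "(u, v) \<in> word_cong S R"
  shows "word_act a u = word_act a v"
  using assms(3)
proof (induction rule: word_cong.induct)
  case (cancel u v g b)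
  then show ?case using letter_act_cancel[of a g b, OF bijectiveD[OF assms(1)]] by auto
next
  case (relation u v l r)
  then show ?case using assms(2) by fastforce
qed auto

lemma stab_word_eq:
  assumes "bijective a"
  shows "word_act a u p = word_act a v p \<longleftrightarrow> u @ word_inv v \<in> stab a p"
proof
  assume "word_act a u p = word_act a v p"
  then show "u @ word_inv v \<in> stab a p"
    by (simp add: stab_def word_act_inv_cancel assms)
next
  assume "u @ word_inv v \<in> stab a p"
  then have "word_act a v (word_act a (word_inv v) (word_act a u p)) = word_act a v p"
    by (simp add: stab_def)
  then show "word_act a u p = word_act a v p"
    by (simp add: word_act_inv_cancel' assms)
qed

lemma orbI [intro]: "word_act a w p \<in> orb a p"
  by (simp add: orb_def)

lemma orbE:
  assumes "x \<in> orb a p"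
  obtains w where "x = word_act a w p"
  using assms by (auto simp: orb_def)

lemma orb_self [simp]: "p \<in> orb a p"
  using orbI[of a "[]" p] by simp

lemma orb_word: "x \<in> orb a p \<Longrightarrow> word_act a w x \<in> orb a p"
  by (elim orbE) (simp flip: word_act_append add: orbI)

lemma orb_step: "x \<in> orb a p \<Longrightarrow> a g x \<in> orb a p"
  using orb_word[of x a p "[(g, True)]"] by simp

lemma orb_sym:
  assumes "bijective a" "x \<in> orb a p"
  shows "p \<in> orb a x"
proof -
  obtain w where "x = word_act a w p" using assms(2) by (rule orbE)
  then have "p = word_act a (word_inv w) x" by (simp add: word_act_inv_cancel assms(1))
  then show ?thesis by (simp add: orbI)
qed

lemma permutes_iff_bij: "f permutes A \<longleftrightarrow> bij f \<and> (\<forall>x. x \<notin> A \<longrightarrow> f x = x)"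
  by (auto simp: permutes_def bij_iff)

text \<open>The inverse letters are the point: the preimage under \<open>b g\<close> stays in
  \<open>B\<close>, where both actions agree, and injectivity of \<open>a g\<close> makes it the
  preimage under \<open>a g\<close> too.\<close>

lemma word_act_agree:
  assumes b: "perm_rep b B" and a: "bijective a"
    and agree: "\<And>g x. x \<in> B \<Longrightarrow> a g x = b g x" and p: "p \<in> B"
  shows "word_act a w p = word_act b w p \<and> word_act b w p \<in> B"
  using p
proof (induction w arbitrary: p)
  case (Cons l w)
  obtain g e where l: "l = (g, e)" by (cases l)
  have "letter_act b l p \<in> B \<and> letter_act a l p = letter_act b l p"
  proof (cases e)
    case True
    then show ?thesis using Cons.prems perm_repD[OF b] agree l by (simp add: permutes_in_image)
  next
    case False
    have "fun_inv (b g) p \<in> B"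
      using Cons.prems permutes_inv[OF perm_repD[OF b]] by (metis permutes_in_image)
    moreover from this have "a g (fun_inv (b g) p) = p"
      using agree permutes_inverses(1)[OF perm_repD[OF b]] by metis
    then have "fun_inv (a g) p = fun_inv (b g) p" using bijectiveD[OF a] by (metis bij_inv_eq_iff)
    ultimately show ?thesis using False l by simp
  qed
  then show ?case using Cons.IH by auto
qed simp

lemma word_act_in:
  assumes "perm_rep b B" "p \<in> B"
  shows "word_act b w p \<in> B"
  using word_act_agree[OF assms(1) perm_rep_bijective[OF assms(1)] _ assms(2)] by blast

lemma orb_subset: "perm_rep b B \<Longrightarrow> p \<in> B \<Longrightarrow> orb b p \<subseteq> B"
  by (auto elim!: orbE intro: word_act_in)

text \<open>Two words agree at p iff u v^(-1) fixes p; hence the stabiliser of one point determines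
  the orbit together with its action.\<close>

lemma stab_transport:
  assumes a: "bijective a" and b: "bijective b" and st: "stab a p = stab b q"
  obtains \<rho> where "bij_betw \<rho> (orb a p) (orb b q)" "\<rho> p = q"
    "\<And>g x. x \<in> orb a p \<Longrightarrow> \<rho> (a g x) = b g (\<rho> x)"
proof -
  have eq: "word_act a u p = word_act a v p \<longleftrightarrow> word_act b u q = word_act b v q" for u v
    by (simp only: stab_word_eq[of a, OF a] stab_word_eq[of b, OF b] st)
  define \<rho> where "\<rho> x = word_act b (SOME w. word_act a w p = x) q" for x
  have \<rho>: "\<rho> (word_act a w p) = word_act b w q" for w
    unfolding \<rho>_def using someI[of "\<lambda>v. word_act a v p = word_act a w p" w] by (simp add: eq)
  have "inj_on \<rho> (orb a p)"
    by (rule inj_onI) (auto simp: orb_def \<rho> eq)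
  moreover have "\<rho> ` orb a p = orb b q"
    by (auto simp: orb_def \<rho> image_image)
  ultimately have "bij_betw \<rho> (orb a p) (orb b q)" by (simp add: bij_betw_def)
  moreover have "\<rho> p = q" using \<rho>[of "[]"] by simp
  moreover have "\<rho> (a g x) = b g (\<rho> x)" if "x \<in> orb a p" for g x
  proof -
    obtain w where "x = word_act a w p" using \<open>x \<in> orb a p\<close> by (rule orbE)
    then show ?thesis using \<rho>[of "w @ [(g, True)]"] \<rho>[of w] by simp
  qed
  ultimately show thesis by (rule that)
qed

section \<open>Relabelling and decomposition into orbits\<close>

definition relabel :: "('p \<Rightarrow> 'p) \<Rightarrow> ('g \<Rightarrow> 'p \<Rightarrow> 'p) \<Rightarrow> 'g \<Rightarrow> 'p \<Rightarrow> 'p" where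
  "relabel \<pi> a g = \<pi> \<circ> a g \<circ> fun_inv \<pi>"

lemma relabel_apply: "bij \<pi> \<Longrightarrow> relabel \<pi> a g (\<pi> x) = \<pi> (a g x)"
  by (simp add: relabel_def bij_is_inj)

lemma relabel_eqI:
  assumes "bij \<pi>" "\<And>g x. \<pi> (a g x) = b g (\<pi> x)"
  shows "relabel \<pi> a = b"
  using assms by (auto simp: relabel_def fun_eq_iff bij_is_surj surj_f_inv_f)

lemma bijective_relabel: "bij \<pi> \<Longrightarrow> bijective a \<Longrightarrow> bijective (relabel \<pi> a)"
  unfolding relabel_def bijective_def by (intro allI bij_comp bij_imp_bij_inv) auto

lemma word_act_relabel:
  assumes \<pi>: "bij \<pi>" and a: "bijective a"
  shows "word_act (relabel \<pi> a) w (\<pi> p) = \<pi> (word_act a w p)"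
proof (induction w arbitrary: p)
  case (Cons l w)
  obtain g e where l: "l = (g, e)" by (cases l)
  have "fun_inv (relabel \<pi> a g) (\<pi> p) = \<pi> (fun_inv (a g) p)"
  proof -
    have "relabel \<pi> a g (\<pi> (fun_inv (a g) p)) = \<pi> p"
      using relabel_apply[OF \<pi>, of a g "fun_inv (a g) p"] bijectiveD[OF a]
      by (simp add: bij_is_surj surj_f_inv_f)
    then show ?thesis using bijectiveD[OF bijective_relabel[OF \<pi> a]] bij_inv_eq_iff by metis
  qed
  then have "letter_act (relabel \<pi> a) l (\<pi> p) = \<pi> (letter_act a l p)"
    using relabel_apply[OF \<pi>] l by (cases e) simp_all
  then show ?case using Cons by simp
qed simp

lemma stab_relabel: "bij \<pi> \<Longrightarrow> bijective a \<Longrightarrow> stab (relabel \<pi> a) (\<pi> p) = stab a p"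
  by (auto simp: stab_def word_act_relabel bij_is_inj inj_eq)

lemma orb_relabel: "bij \<pi> \<Longrightarrow> bijective a \<Longrightarrow> orb (relabel \<pi> a) (\<pi> p) = \<pi> ` orb a p"
  by (auto simp: orb_def word_act_relabel)

lemma relabel_permutes:
  assumes \<pi>: "bij \<pi>" and a: "perm_rep a A"
  shows "perm_rep (relabel \<pi> a) (\<pi> ` A)"
  unfolding perm_rep_def permutes_iff_bij
proof safe
  fix g
  show "bij (relabel \<pi> a g)"
    using bijectiveD[OF bijective_relabel[OF \<pi> perm_rep_bijective[OF a]]] .
  fix x assume x: "x \<notin> \<pi> ` A"
  obtain y where y: "x = \<pi> y" using \<pi> by (metis bij_pointE)
  with x have "y \<notin> A" by blast
  then show "relabel \<pi> a g x = x" using permutes_not_in[OF perm_repD[OF a]] \<pi> y by (simp add: relabel_apply)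
qed

lemma relabel_inv:
  "bij \<pi> \<Longrightarrow> relabel (fun_inv \<pi>) (relabel \<pi> a) = a"
  by (intro relabel_eqI bij_imp_bij_inv) (auto simp: relabel_def bij_is_inj)

text \<open>The structures counted below are constrained only through the stabilisers of their points,
  which makes the constraint invariant under relabelling and local to each orbit.\<close>
definition structs :: "'g word set set \<Rightarrow> 'p set \<Rightarrow> ('g \<Rightarrow> 'p \<Rightarrow> 'p) set" where
  "structs \<L> A = {a. perm_rep a A \<and> (\<forall>p\<in>A. stab a p \<in> \<L>)}"

definition trans_structs :: "'g word set set \<Rightarrow> 'p set \<Rightarrow> ('g \<Rightarrow> 'p \<Rightarrow> 'p) set" where
  "trans_structs \<L> A = {a \<in> structs \<L> A. \<forall>p\<in>A. orb a p = A}"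

lemma structsD:
  "a \<in> structs \<L> A \<Longrightarrow> perm_rep a A" "a \<in> structs \<L> A \<Longrightarrow> bijective a"
  "a \<in> structs \<L> A \<Longrightarrow> p \<in> A \<Longrightarrow> stab a p \<in> \<L>"
  by (auto simp: structs_def intro: perm_rep_bijective)

lemma structs_permutes: "a \<in> structs \<L> A \<Longrightarrow> a g permutes A"
  by (simp add: structs_def perm_repD)

lemma trans_structsD:
  "a \<in> trans_structs \<L> A \<Longrightarrow> a \<in> structs \<L> A"
  "a \<in> trans_structs \<L> A \<Longrightarrow> p \<in> A \<Longrightarrow> orb a p = A"
  by (auto simp: trans_structs_def)

lemma relabel_structs:
  assumes "bij \<pi>" "a \<in> structs \<L> A"
  shows "relabel \<pi> a \<in> structs \<L> (\<pi> ` A)"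
  using assms structsD[OF assms(2)] unfolding structs_def
  by (auto simp: stab_relabel relabel_permutes)

lemma relabel_trans_structs:
  assumes "bij \<pi>" "a \<in> trans_structs \<L> A"
  shows "relabel \<pi> a \<in> trans_structs \<L> (\<pi> ` A)"
  using assms relabel_structs[of \<pi> a \<L> A] trans_structsD[OF assms(2)] structsD(2)[of a \<L> A]
  unfolding trans_structs_def by (auto simp: orb_relabel)

lemma bij_betw_relabel:
  assumes \<pi>: "bij \<pi>"
    and "\<And>a. a \<in> S \<Longrightarrow> relabel \<pi> a \<in> T" "\<And>b. b \<in> T \<Longrightarrow> relabel (fun_inv \<pi>) b \<in> S"
  shows "bij_betw (relabel \<pi>) S T"
proof (rule bij_betw_byWitness[where f' = "relabel (fun_inv \<pi>)"])
  show "\<forall>b\<in>T. relabel \<pi> (relabel (fun_inv \<pi>) b) = b"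
  proof
    fix b
    show "relabel \<pi> (relabel (fun_inv \<pi>) b) = b"
      using relabel_inv[OF bij_imp_bij_inv[OF \<pi>], of b] \<pi> by (simp add: inv_inv_eq)
  qed
qed (use assms relabel_inv[OF \<pi>] in auto)

text \<open>Relabelling uses a bijection of the whole type, so f is completed by a bijection of B -
  A onto A - B and by the identity elsewhere.\<close>

lemma bij_betw_extend:
  fixes A B :: "'a set"
  assumes f: "bij_betw f A B" and fin: "finite A" "finite B"
  obtains \<pi> where "bij \<pi>" "\<And>x. x \<in> A \<Longrightarrow> \<pi> x = f x"
proof -
  have "card A = card B" using f by (rule bij_betw_same_card)
  then have "card (B - A) = card (A - B)"
    using fin card_Un_disjoint[of "A \<inter> B" "A - B"] card_Un_disjoint[of "A \<inter> B" "B - A"]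
    by (simp add: card_Diff_subset_Int Int_commute)
  then obtain g where g: "bij_betw g (B - A) (A - B)"
    using fin finite_same_card_bij[of "B - A" "A - B"] by blast
  define \<pi> where "\<pi> x = (if x \<in> A then f x else if x \<in> B - A then g x else x)" for x
  have 1: "bij_betw \<pi> A B" using f by (rule bij_betw_cong[THEN iffD1, rotated]) (simp add: \<pi>_def)
  have 2: "bij_betw \<pi> (B - A) (A - B)"
    using g by (rule bij_betw_cong[THEN iffD1, rotated]) (simp add: \<pi>_def)
  have 3: "bij_betw \<pi> (- (A \<union> B)) (- (A \<union> B))"
    using bij_betw_id by (rule bij_betw_cong[THEN iffD1, rotated]) (simp add: \<pi>_def)
  have "bij_betw \<pi> (A \<union> (B - A) \<union> - (A \<union> B)) (B \<union> (A - B) \<union> - (A \<union> B))"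
    by (intro bij_betw_combine 1 2 3) auto
  moreover have "A \<union> (B - A) \<union> - (A \<union> B) = UNIV" "B \<union> (A - B) \<union> - (A \<union> B) = UNIV" by auto
  ultimately have "bij \<pi>" by simp
  then show thesis by (rule that) (simp add: \<pi>_def)
qed

lemma card_structs_eq:
  fixes A B :: "'p set"
  assumes "finite A" "finite B" "card A = card B"
  shows "card (structs \<L> A) = card (structs \<L> B)"
    "card (trans_structs \<L> A) = card (trans_structs \<L> B)"
proof -
  obtain f where f: "bij_betw f A B" using assms finite_same_card_bij by blast
  obtain \<pi> where \<pi>: "bij \<pi>" "\<And>x. x \<in> A \<Longrightarrow> \<pi> x = f x"
    using bij_betw_extend[OF f assms(1,2)] by blast
  have B: "\<pi> ` A = B" using \<pi>(2) f by (simp add: bij_betw_def)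
  have A: "fun_inv \<pi> ` B = A" using \<pi>(1) B by (metis bij_is_inj image_inv_f_f)
  note A' = relabel_structs[OF \<pi>(1), of _ \<L> A, unfolded B]
    relabel_trans_structs[OF \<pi>(1), of _ \<L> A, unfolded B]
  note B' = relabel_structs[OF bij_imp_bij_inv[OF \<pi>(1)], of _ \<L> B, unfolded A]
    relabel_trans_structs[OF bij_imp_bij_inv[OF \<pi>(1)], of _ \<L> B, unfolded A]
  have "bij_betw (relabel \<pi>) (structs \<L> A) (structs \<L> B)"
    using \<pi>(1) by (rule bij_betw_relabel) (fact A' B')+
  then show "card (structs \<L> A) = card (structs \<L> B)" by (rule bij_betw_same_card)
  have "bij_betw (relabel \<pi>) (trans_structs \<L> A) (trans_structs \<L> B)"
    using \<pi>(1) by (rule bij_betw_relabel) (fact A' B')+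
  then show "card (trans_structs \<L> A) = card (trans_structs \<L> B)" by (rule bij_betw_same_card)
qed

lemma finite_structs:
  fixes \<L> :: "'g :: finite word set set"
  assumes "finite A"
  shows "finite (structs \<L> A)"
proof (rule finite_subset)
  show "structs \<L> A \<subseteq> (UNIV :: 'g set) \<rightarrow>\<^sub>E {p. p permutes A}"
    by (auto simp: structs_def perm_rep_def PiE_def)
  show "finite ((UNIV :: 'g set) \<rightarrow>\<^sub>E {p. p permutes A})"
    using assms by (intro finite_PiE finite_permutations) auto
qed

definition restrict_perm :: "'p set \<Rightarrow> ('g \<Rightarrow> 'p \<Rightarrow> 'p) \<Rightarrow> 'g \<Rightarrow> 'p \<Rightarrow> 'p" where
  "restrict_perm B a g x = (if x \<in> B then a g x else x)"

definition glue :: "'p set \<Rightarrow> ('g \<Rightarrow> 'p \<Rightarrow> 'p) \<Rightarrow> ('g \<Rightarrow> 'p \<Rightarrow> 'p) \<Rightarrow> 'g \<Rightarrow> 'p \<Rightarrow> 'p" where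
  "glue B b c g x = (if x \<in> B then b g x else c g x)"

lemma structs_mono_agree:
  assumes a: "bijective a" and b: "perm_rep b B"
    and agree: "\<And>g x. x \<in> B \<Longrightarrow> a g x = b g x" and p: "p \<in> B"
  shows "stab a p = stab b p" "orb a p = orb b p"
proof -
  have "word_act a w p = word_act b w p" for w
    using word_act_agree[OF b a agree p] by blast
  then show "stab a p = stab b p" "orb a p = orb b p" by (simp_all add: stab_def orb_def)
qed

lemma restrict_perm_permutes:
  assumes a: "bij (a g)" and B: "a g ` B = B"
  shows "restrict_perm B a g permutes B"
proof (rule bij_imp_permutes)
  have "bij_betw (a g) B B"
    using a B by (metis bij_betw_def bij_betw_subset subset_UNIV)
  then show "bij_betw (restrict_perm B a g) B B"
    by (rule bij_betw_cong[THEN iffD1, rotated]) (simp add: restrict_perm_def)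
qed (simp add: restrict_perm_def)

lemma restrict_perm_structs:
  assumes a: "a \<in> structs \<L> A" and B: "B \<subseteq> A" "\<And>g. a g ` B = B"
  shows "restrict_perm B a \<in> structs \<L> B"
proof -
  have p: "perm_rep (restrict_perm B a) B"
    unfolding perm_rep_def using bijectiveD[OF structsD(2)[OF a]] B(2)
    by (intro allI restrict_perm_permutes)
  have "stab a x = stab (restrict_perm B a) x" if "x \<in> B" for x
    using structsD(2)[OF a] p by (rule structs_mono_agree) (simp_all add: restrict_perm_def that)
  then have "stab (restrict_perm B a) x \<in> \<L>" if "x \<in> B" for x
    using structsD(3)[OF a] B(1) that by fastforce
  then show ?thesis using p unfolding structs_def by auto
qed

lemma structs_image_orb:
  assumes fin: "finite A" and a: "a \<in> structs \<L> A" and p: "p \<in> A"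
  shows "a g ` orb a p = orb a p" "a g ` (A - orb a p) = A - orb a p"
proof -
  have inj: "inj (a g)" using bijectiveD[OF structsD(2)[OF a]] by (rule bij_is_inj)
  have "finite (orb a p)" using orb_subset[OF structsD(1)[OF a] p] fin by (rule finite_subset)
  then show 1: "a g ` orb a p = orb a p"
    using inj orb_step[of _ a p g] by (intro endo_inj_surj) (auto intro: inj_on_subset)
  have "a g ` A = A" using structs_permutes[OF a] by (rule permutes_image)
  with 1 inj show "a g ` (A - orb a p) = A - orb a p" by (simp add: image_set_diff)
qed

text \<open>The stabiliser of a point sees only the orbit of that point, so the condition on
  stabilisers splits into independent conditions on \<open>B\<close> and on its complement; that
  \<open>B\<close> is the orbit of p says that the first part is transitive.\<close>

lemma bij_betw_glue:
  assumes fin: "finite A" and B: "B \<subseteq> A" "p \<in> B"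
  shows "bij_betw (\<lambda>x. glue B (fst x) (snd x)) (trans_structs \<L> B \<times> structs \<L> (A - B))
    {a \<in> structs \<L> A. orb a p = B}"
proof (rule bij_betw_byWitness[where f' = "\<lambda>a. (restrict_perm B a, restrict_perm (A - B) a)"])
  have perm: "glue B b c g permutes A" if "b g permutes B" "c g permutes (A - B)" for b c g
  proof -
    have "b g \<circ> c g permutes A"
      using that B(1) by (metis Diff_subset permutes_compose permutes_subset)
    moreover have "b g (c g x) = glue B b c g x" for x
    proof (cases "x \<in> B")
      case True
      then show ?thesis using that(2) by (simp add: glue_def permutes_not_in)
    next
      case False
      then have "c g x \<notin> B" using that(2) by (metis Diff_iff permutes_in_image permutes_not_in)
      then show ?thesis using that(1) False by (simp add: glue_def permutes_not_in)
    qed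
    ultimately show ?thesis by (simp add: comp_def)
  qed
  show "\<forall>x\<in>trans_structs \<L> B \<times> structs \<L> (A - B).
      (restrict_perm B (glue B (fst x) (snd x)), restrict_perm (A - B) (glue B (fst x) (snd x))) = x"
  proof
    fix x assume "x \<in> trans_structs \<L> B \<times> structs \<L> (A - B)"
    then obtain b c where x: "x = (b, c)" and b: "b \<in> trans_structs \<L> B"
      and c: "c \<in> structs \<L> (A - B)" by blast
    have "restrict_perm B (glue B b c) = b"
      using permutes_not_in[OF structs_permutes[OF trans_structsD(1)[OF b]]]
      by (auto simp: restrict_perm_def glue_def fun_eq_iff)
    moreover have "restrict_perm (A - B) (glue B b c) = c"
      using permutes_not_in[OF structs_permutes[OF c]] B(1)
      by (auto simp: restrict_perm_def glue_def fun_eq_iff)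
    ultimately show "(restrict_perm B (glue B (fst x) (snd x)),
        restrict_perm (A - B) (glue B (fst x) (snd x))) = x"
      by (simp add: x)
  qed
  show "(\<lambda>x. glue B (fst x) (snd x)) ` (trans_structs \<L> B \<times> structs \<L> (A - B))
      \<subseteq> {a \<in> structs \<L> A. orb a p = B}"
  proof (rule image_subsetI)
    fix x assume "x \<in> trans_structs \<L> B \<times> structs \<L> (A - B)"
    then obtain b c where x: "x = (b, c)" and b: "b \<in> trans_structs \<L> B"
      and c: "c \<in> structs \<L> (A - B)" by blast
    note b' = structsD[OF trans_structsD(1)[OF b]] and c' = structsD[OF c]
    have pg: "perm_rep (glue B b c) A"
      unfolding perm_rep_def by (intro allI perm perm_repD[OF b'(1)] perm_repD[OF c'(1)])
    have "stab (glue B b c) x = stab b x" and orb: "orb (glue B b c) x = orb b x" if "x \<in> B" for x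
      by (rule structs_mono_agree[OF perm_rep_bijective[OF pg] b'(1) _ that]; simp add: glue_def)+
    moreover have "stab (glue B b c) x = stab c x" if "x \<in> A - B" for x
      by (rule structs_mono_agree[OF perm_rep_bijective[OF pg] c'(1) _ that]) (simp add: glue_def)
    ultimately have "stab (glue B b c) x \<in> \<L>" if "x \<in> A" for x
      using b'(3) c'(3) that by (cases "x \<in> B") auto
    moreover have "orb (glue B b c) p = B"
      using orb trans_structsD(2)[OF b] B(2) by simp
    ultimately show "glue B (fst x) (snd x) \<in> {a \<in> structs \<L> A. orb a p = B}"
      using pg by (simp add: structs_def x)
  qed
  show "(\<lambda>a. (restrict_perm B a, restrict_perm (A - B) a)) ` {a \<in> structs \<L> A. orb a p = B}
      \<subseteq> trans_structs \<L> B \<times> structs \<L> (A - B)"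
  proof (rule image_subsetI)
    fix a assume "a \<in> {a \<in> structs \<L> A. orb a p = B}"
    then have a: "a \<in> structs \<L> A" "B = orb a p" by auto
    have p: "p \<in> A" using B by blast
    note r = structs_image_orb[OF fin a(1) p, folded a(2)]
    have s: "restrict_perm B a \<in> structs \<L> B"
      using a(1) B(1) r by (intro restrict_perm_structs) auto
    have "orb (restrict_perm B a) x = B" if "x \<in> B" for x
    proof -
      have "orb a x = orb (restrict_perm B a) x"
        by (rule structs_mono_agree[OF structsD(2)[OF a(1)] structsD(1)[OF s] _ that])
           (simp add: restrict_perm_def)
      moreover have "orb a x \<subseteq> B"
        using that orb_word[of x a p] unfolding a(2) by (auto elim!: orbE[of _ a x])
      moreover have "B \<subseteq> orb a x"
        using orb_sym[OF structsD(2)[OF a(1)], of x p] that orb_word[of p a x]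
        unfolding a(2) by (auto elim!: orbE[of _ a p])
      ultimately show ?thesis by simp
    qed
    with s have "restrict_perm B a \<in> trans_structs \<L> B" by (simp add: trans_structs_def)
    moreover have "restrict_perm (A - B) a \<in> structs \<L> (A - B)"
      using a(1) r by (intro restrict_perm_structs) auto
    ultimately show "(restrict_perm B a, restrict_perm (A - B) a)
        \<in> trans_structs \<L> B \<times> structs \<L> (A - B)" by simp
  qed
  show "\<forall>a\<in>{a \<in> structs \<L> A. orb a p = B}.
      glue B (fst (restrict_perm B a, restrict_perm (A - B) a))
        (snd (restrict_perm B a, restrict_perm (A - B) a)) = a"
    using B(1) by (auto simp: restrict_perm_def glue_def fun_eq_iff permutes_not_in[OF structs_permutes])
qed

lemma card_fibres:
  assumes "finite S" "finite T" "f ` S \<subseteq> T"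
  shows "card S = (\<Sum>y\<in>T. card {x \<in> S. f x = y})"
  using sum.group[OF assms, of "\<lambda>_. 1 :: nat"] by simp

lemma card_structs_decompose:
  fixes \<L> :: "'g :: finite word set set"
  assumes fin: "finite A" and p: "p \<in> A"
  shows "card (structs \<L> A) =
    (\<Sum>B\<in>{B. p \<in> B \<and> B \<subseteq> A}. card (trans_structs \<L> B) * card (structs \<L> (A - B)))"
proof -
  have "card (structs \<L> A) = (\<Sum>B\<in>{B. p \<in> B \<and> B \<subseteq> A}. card {a \<in> structs \<L> A. orb a p = B})"
  proof (rule card_fibres[OF finite_structs[OF fin]])
    show "finite {B. p \<in> B \<and> B \<subseteq> A}" using fin by (auto intro: finite_subset[of _ "Pow A"])
    show "(\<lambda>a. orb a p) ` structs \<L> A \<subseteq> {B. p \<in> B \<and> B \<subseteq> A}"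
      using orb_subset[OF structsD(1) p] by fastforce
  qed
  also have "\<dots> = (\<Sum>B\<in>{B. p \<in> B \<and> B \<subseteq> A}. card (trans_structs \<L> B) * card (structs \<L> (A - B)))"
  proof (rule sum.cong)
    fix B assume "B \<in> {B. p \<in> B \<and> B \<subseteq> A}"
    then have "card (trans_structs \<L> B \<times> structs \<L> (A - B)) = card {a \<in> structs \<L> A. orb a p = B}"
      by (intro bij_betw_same_card[OF bij_betw_glue[OF fin]]) auto
    then show "card {a \<in> structs \<L> A. orb a p = B} = card (trans_structs \<L> B) * card (structs \<L> (A - B))"
      by (simp add: card_cartesian_product)
  qed simp
  finally show ?thesis .
qed

text \<open>Relabellings fixing p act simply transitively on the transitive structures with a given
  stabiliser at p: freely, since the relabelled action and the image of p determine the relabelling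
  on the orbit, and transitively by \<open>stab_transport\<close>.\<close>

lemma card_trans_structs:
  fixes \<L> :: "'g :: finite word set set"
  assumes fin: "finite B" and p: "p \<in> B"
  shows "card (trans_structs \<L> B) = fact (card B - 1) * card ((\<lambda>a. stab a p) ` trans_structs \<L> B)"
proof -
  let ?T = "trans_structs \<L> B"
  have finT: "finite (?T)"
    using finite_structs[OF fin, of \<L>] by (rule finite_subset[rotated]) (auto simp: trans_structs_def)
  have "card {b \<in> ?T. stab b p = stab a p} = fact (card B - 1)"
    if a: "a \<in> ?T" for a
  proof -
    note a' = structsD[OF trans_structsD(1)[OF a]] and oa = trans_structsD(2)[OF a p]
    have "bij_betw (\<lambda>\<pi>. relabel \<pi> a) {\<pi>. \<pi> permutes (B - {p})}
        {b \<in> ?T. stab b p = stab a p}"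
    proof (rule bij_betw_imageI)
      show "inj_on (\<lambda>\<pi>. relabel \<pi> a) {\<pi>. \<pi> permutes (B - {p})}"
      proof (rule inj_onI, clarify)
        fix \<pi> \<sigma> assume \<pi>: "\<pi> permutes (B - {p})" and \<sigma>: "\<sigma> permutes (B - {p})"
          and eq: "relabel \<pi> a = relabel \<sigma> a"
        show "\<pi> = \<sigma>"
        proof
          fix x
          have fixp: "\<pi> p = p" "\<sigma> p = p" using \<pi> \<sigma> by (auto simp: permutes_not_in)
          show "\<pi> x = \<sigma> x"
          proof (cases "x \<in> B")
            case True
            then have "x \<in> orb a p" using oa by simp
            then obtain w where w: "x = word_act a w p" by (rule orbE)
            show ?thesis
              using word_act_relabel[OF permutes_bij[OF \<pi>] a'(2), of w p]
                word_act_relabel[OF permutes_bij[OF \<sigma>] a'(2), of w p] fixp eq w by simp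
          next
            case False
            then show ?thesis using \<pi> \<sigma> by (simp add: permutes_not_in)
          qed
        qed
      qed
      show "(\<lambda>\<pi>. relabel \<pi> a) ` {\<pi>. \<pi> permutes (B - {p})}
          = {b \<in> ?T. stab b p = stab a p}"
      proof (intro equalityI subsetI)
        fix b assume "b \<in> (\<lambda>\<pi>. relabel \<pi> a) ` {\<pi>. \<pi> permutes (B - {p})}"
        then obtain \<pi> where \<pi>: "\<pi> permutes (B - {p})" "b = relabel \<pi> a" by blast
        have "\<pi> ` B = B" using \<pi>(1) by (metis Diff_subset permutes_image permutes_subset)
        moreover have "\<pi> p = p" using \<pi>(1) by (auto simp: permutes_not_in)
        ultimately show "b \<in> {b \<in> ?T. stab b p = stab a p}"
          using relabel_trans_structs[OF permutes_bij[OF \<pi>(1)] a]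
            stab_relabel[OF permutes_bij[OF \<pi>(1)] a'(2), of p] \<pi>(2) by simp
      next
        fix b assume "b \<in> {b \<in> ?T. stab b p = stab a p}"
        then have b: "b \<in> ?T" "stab a p = stab b p" by auto
        note b' = structsD[OF trans_structsD(1)[OF b(1)]] and ob = trans_structsD(2)[OF b(1) p]
        obtain \<rho> where \<rho>: "bij_betw \<rho> B B" "\<rho> p = p" "\<And>g x. x \<in> B \<Longrightarrow> \<rho> (a g x) = b g (\<rho> x)"
          using stab_transport[OF a'(2) b'(2) b(2)] unfolding oa ob by blast
        define \<pi> where "\<pi> x = (if x \<in> B then \<rho> x else x)" for x
        have "bij_betw \<pi> B B" using \<rho>(1) by (rule bij_betw_cong[THEN iffD1, rotated]) (simp add: \<pi>_def)
        then have \<pi>B: "\<pi> permutes B" by (rule bij_imp_permutes) (simp add: \<pi>_def)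
        have "\<pi> permutes (B - {p})"
          using \<pi>B \<rho>(2) p unfolding permutes_def by (auto simp: \<pi>_def)
        moreover have "relabel \<pi> a = b"
        proof (rule relabel_eqI[OF permutes_bij[OF \<pi>B]])
          fix g x
          show "\<pi> (a g x) = b g (\<pi> x)"
            using \<rho>(3)[of x g] permutes_in_image[OF perm_repD[OF a'(1)], of g x]
              permutes_not_in[OF perm_repD[OF a'(1)], of x g]
              permutes_not_in[OF perm_repD[OF b'(1)], of x g]
            by (auto simp: \<pi>_def)
        qed
        ultimately show "b \<in> (\<lambda>\<pi>. relabel \<pi> a) ` {\<pi>. \<pi> permutes (B - {p})}" by blast
      qed
    qed
    then have "card {\<pi>. \<pi> permutes (B - {p})} = card {b \<in> ?T. stab b p = stab a p}"
      by (rule bij_betw_same_card)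
    then show ?thesis using fin p by (simp add: card_permutations)
  qed
  then have "(\<Sum>y\<in>(\<lambda>a. stab a p) ` ?T. card {b \<in> ?T. stab b p = y})
      = (\<Sum>y\<in>(\<lambda>a. stab a p) ` ?T. fact (card B - 1))"
    by (intro sum.cong) auto
  then show ?thesis
    using card_fibres[OF finT finite_imageI[OF finT] subset_refl, of "\<lambda>a. stab a p"] by simp
qed

section \<open>The exponential formula\<close>

definition struct_number :: "'g word set set \<Rightarrow> nat \<Rightarrow> nat" where
  "struct_number \<L> n = card (structs \<L> {..<n})"

text \<open>Transitive structures up to relabelling of the points other than 0; for
  \<open>Gamma_stabs\<close> this becomes the number of free subgroups of a given index.\<close>

definition stab_number :: "'g word set set \<Rightarrow> nat \<Rightarrow> nat" where
  "stab_number \<L> n = card ((\<lambda>a. stab a 0) ` trans_structs \<L> {..<n})"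

lemma sum_Pow_card:
  assumes "finite D"
  shows "(\<Sum>C\<in>Pow D. f (card C)) = (\<Sum>k\<le>card D. of_nat (card D choose k) * f k :: 'a :: comm_semiring_1)"
proof -
  have "(\<Sum>C\<in>Pow D. f (card C)) = (\<Sum>k\<le>card D. \<Sum>C\<in>{C \<in> Pow D. card C = k}. f (card C))"
    using assms by (intro sum.group[symmetric]) (auto intro: card_mono)
  also have "\<dots> = (\<Sum>k\<le>card D. of_nat (card D choose k) * f k)"
    using n_subsets[OF assms] by (intro sum.cong) simp_all
  finally show ?thesis .
qed

lemma struct_number_rec:
  fixes \<L> :: "'g :: finite word set set"
  shows "struct_number \<L> (Suc n) =
    (\<Sum>k\<le>n. (n choose k) * (fact k * stab_number \<L> (Suc k) * struct_number \<L> (n - k)))"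
proof -
  let ?A = "{..<Suc n}" and ?D = "{1..<Suc n}"
  have D: "finite ?D" "card ?D = n" by simp_all
  let ?F = "\<lambda>k. fact k * stab_number \<L> (Suc k) * struct_number \<L> (n - k)"
  have "card (structs \<L> ?A) =
      (\<Sum>B\<in>{B. 0 \<in> B \<and> B \<subseteq> ?A}. card (trans_structs \<L> B) * card (structs \<L> (?A - B)))"
    by (rule card_structs_decompose) simp_all
  \<comment> \<open>\<open>C\<close> is the orbit of 0 without 0, an arbitrary subset of the other
    points; this produces the binomial coefficients and the shift by one in
    \<open>stab_number\<close>.\<close>
  also have "\<dots> = (\<Sum>C\<in>Pow ?D. card (trans_structs \<L> (insert 0 C)) * card (structs \<L> (?A - insert 0 C)))"
  proof (rule sum.reindex_bij_witness[where i = "insert 0" and j = "\<lambda>B. B - {0}"])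
    fix B assume "B \<in> {B. 0 \<in> B \<and> B \<subseteq> ?A}"
    then show "B - {0} \<in> Pow ?D" using atLeast0LessThan by force
  qed (auto simp: insert_absorb)
  also have "\<dots> = (\<Sum>C\<in>Pow ?D. ?F (card C))"
  proof (rule sum.cong)
    fix C assume "C \<in> Pow ?D"
    then have C: "C \<subseteq> ?D" "finite C" "0 \<notin> C" by (auto intro: finite_subset)
    have "card (trans_structs \<L> (insert 0 C)) = card (trans_structs \<L> {..<Suc (card C)})"
      using C by (intro card_structs_eq) simp_all
    also have "\<dots> = fact (card C) * stab_number \<L> (Suc (card C))"
      by (subst card_trans_structs[of _ 0]) (simp_all add: stab_number_def)
    finally have 1: "card (trans_structs \<L> (insert 0 C)) = fact (card C) * stab_number \<L> (Suc (card C))" .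
    have "insert 0 C \<subseteq> ?A" using C(1) by auto
    then have "card (?A - insert 0 C) = n - card C" using C by (subst card_Diff_subset) auto
    then have "card (structs \<L> (?A - insert 0 C)) = struct_number \<L> (n - card C)"
      unfolding struct_number_def by (intro card_structs_eq) simp_all
    with 1 show "card (trans_structs \<L> (insert 0 C)) * card (structs \<L> (?A - insert 0 C)) = ?F (card C)"
      by simp
  qed simp
  also have "\<dots> = (\<Sum>k\<le>n. (n choose k) * ?F k)"
    using sum_Pow_card[OF D(1), of ?F] D(2) by simp
  finally show ?thesis by (simp add: struct_number_def)
qed

definition struct_weight :: "'g word set set \<Rightarrow> nat \<Rightarrow> rat" where
  "struct_weight \<L> n = of_nat (struct_number \<L> n) / fact n"

text \<open>The exponential formula in the form z W' = S W, where W has the weights and S the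
  stabiliser numbers as coefficients. The factorials of the transitive part cancel against the
  binomial coefficient.\<close>

lemma struct_weight_rec:
  fixes \<L> :: "'g :: finite word set set"
  shows "of_nat n * struct_weight \<L> n =
    (\<Sum>k=1..n. of_nat (stab_number \<L> k) * struct_weight \<L> (n - k))"
proof (cases n)
  case (Suc N)
  have "of_nat n * struct_weight \<L> n = of_nat (struct_number \<L> (Suc N)) / fact N"
    by (simp add: Suc struct_weight_def field_simps del: of_nat_Suc)
  also have "\<dots> = (\<Sum>k\<le>N. of_nat (stab_number \<L> (Suc k)) * struct_weight \<L> (N - k))"
    unfolding struct_number_rec of_nat_sum sum_divide_distrib
    by (intro sum.cong) (simp_all add: binomial_fact struct_weight_def field_simps)
  also have "\<dots> = (\<Sum>k=1..n. of_nat (stab_number \<L> k) * struct_weight \<L> (n - k))"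
    by (rule sum.reindex_bij_witness[where i = "\<lambda>k. k - 1" and j = Suc]) (auto simp: Suc)
  finally show ?thesis .
qed simp

lemma struct_weight_0: "struct_weight \<L> 0 = 1"
proof -
  have "structs \<L> ({} :: nat set) = {\<lambda>_. id}"
    by (auto simp: structs_def perm_rep_def fun_eq_iff permutes_def)
  then show ?thesis by (simp add: struct_weight_def struct_number_def)
qed

section \<open>Semiregular permutations\<close>

text \<open>For d > 0: all cycles on \<open>A\<close> have length d. Stated through powers, it
  passes directly to powers and conjugates.\<close>

definition semireg :: "nat \<Rightarrow> 'p set \<Rightarrow> ('p \<Rightarrow> 'p) set" where
  "semireg d A = {f. f permutes A \<and> (\<forall>p\<in>A. \<forall>i. (f ^^ i) p = p \<longleftrightarrow> d dvd i)}"

lemma semiregD: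
  "f \<in> semireg d A \<Longrightarrow> f permutes A" "f \<in> semireg d A \<Longrightarrow> p \<in> A \<Longrightarrow> (f ^^ i) p = p \<longleftrightarrow> d dvd i"
  by (auto simp: semireg_def)

lemma semireg_eq_iff:
  assumes f: "f \<in> semireg d A" and p: "p \<in> A"
  shows "(f ^^ i) p = (f ^^ j) p \<longleftrightarrow> i mod d = j mod d"
proof -
  have *: "(f ^^ i) p = (f ^^ j) p \<longleftrightarrow> i mod d = j mod d" if "i \<le> j" for i j
  proof -
    have inj: "inj (f ^^ i)"
      using semiregD(1)[OF f] by (intro inj_fn) (rule permutes_inj)
    have "(f ^^ j) p = (f ^^ i) ((f ^^ (j - i)) p)"
      using that by (metis comp_apply funpow_add le_add_diff_inverse)
    then have "(f ^^ i) p = (f ^^ j) p \<longleftrightarrow> p = (f ^^ (j - i)) p"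
      by (simp only: inj_eq[OF inj])
    also have "\<dots> \<longleftrightarrow> (f ^^ (j - i)) p = p" by (rule eq_commute)
    also have "\<dots> \<longleftrightarrow> d dvd (j - i)" using semiregD(2)[OF f p] .
    also have "\<dots> \<longleftrightarrow> i mod d = j mod d"
      using mod_eq_dvd_iff_nat[OF that] by (simp only: eq_commute)
    finally show ?thesis .
  qed
  show ?thesis using *[of i j] *[of j i] by (metis nat_le_linear)
qed

lemma funpow_permutes: "f permutes A \<Longrightarrow> f ^^ k permutes A"
  by (induction k) (simp_all add: permutes_id permutes_compose del: funpow.simps(2) add: funpow_Suc_right)

lemma semireg_power:
  assumes f: "f \<in> semireg (k * d) A" and k: "k > 0"
  shows "f ^^ k \<in> semireg d A"
  unfolding semireg_def
proof (intro CollectI conjI ballI allI)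
  show "f ^^ k permutes A" using semiregD(1)[OF f] by (rule funpow_permutes)
  fix p i assume "p \<in> A"
  then show "((f ^^ k) ^^ i) p = p \<longleftrightarrow> d dvd i"
    using semiregD(2)[OF f, of p "k * i"] k by (simp add: funpow_mult mult.commute)
qed

definition exp_sum :: "'g word \<Rightarrow> int" where
  "exp_sum w = (\<Sum>l\<leftarrow>w. if snd l then 1 else -1)"

lemma exp_sum_simps [simp]:
  "exp_sum [] = 0" "exp_sum (u @ v) = exp_sum u + exp_sum v"
  "exp_sum (l # w) = (if snd l then 1 else -1) + exp_sum w"
  by (simp_all add: exp_sum_def)

lemma exp_sum_replicate [simp]: "exp_sum (replicate i (g, True)) = int i"
  by (induction i) auto

text \<open>The subgroup dZ of the free group on one generator, in terms of words. With it as the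
  only admissible stabiliser, the general orbit count applies to semiregular permutations.\<close>

definition cyclic_stab :: "nat \<Rightarrow> unit word set" where
  "cyclic_stab d = {w. int d dvd exp_sum w}"

lemma word_act_semireg:
  assumes f: "f \<in> semireg d A" and d: "d > 0" and p: "p \<in> A"
  shows "word_act (\<lambda>_ :: unit. f) w p = (f ^^ nat (exp_sum w mod int d)) p"
proof (induction w rule: rev_induct)
  case (snoc l w)
  let ?e = "nat (exp_sum w mod int d)" and ?e' = "nat (exp_sum (w @ [l]) mod int d)"
  have e: "int ?e = exp_sum w mod int d" "int ?e' = exp_sum (w @ [l]) mod int d"
    using d by simp_all
  show ?case
  proof (cases "snd l")
    case True
    have "int (Suc ?e mod d) = int (?e' mod d)"
      unfolding zmod_int int_Suc e using True by (simp add: mod_simps add.commute)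
    then have "(f ^^ Suc ?e) p = (f ^^ ?e') p"
      by (simp only: of_nat_eq_iff semireg_eq_iff[OF f p])
    then show ?thesis using True snoc unfolding word_act_append by (simp add: letter_act_def)
  next
    case False
    have "int (Suc ?e' mod d) = int (?e mod d)"
      unfolding zmod_int int_Suc e using False by (simp add: mod_simps add.commute)
    then have "(f ^^ Suc ?e') p = (f ^^ ?e) p"
      by (simp only: of_nat_eq_iff semireg_eq_iff[OF f p])
    then have "fun_inv f ((f ^^ ?e) p) = (f ^^ ?e') p"
      using permutes_bij[OF semiregD(1)[OF f]] by (metis bij_inv_eq_iff funpow.simps(2) o_apply)
    then show ?thesis using False snoc by (simp add: letter_act_def)
  qed
qed simp

lemma stab_semireg:
  assumes f: "f \<in> semireg d A" and d: "d > 0" and p: "p \<in> A"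
  shows "stab (\<lambda>_ :: unit. f) p = cyclic_stab d"
proof -
  have "word_act (\<lambda>_ :: unit. f) w p = p \<longleftrightarrow> int d dvd exp_sum w" for w
  proof -
    have "word_act (\<lambda>_ :: unit. f) w p = p \<longleftrightarrow> d dvd nat (exp_sum w mod int d)"
      unfolding word_act_semireg[OF assms] by (rule semiregD(2)[OF f p])
    also have "\<dots> \<longleftrightarrow> int d dvd exp_sum w mod int d"
      using d by (subst int_dvd_int_iff[symmetric]) simp
    also have "\<dots> \<longleftrightarrow> int d dvd exp_sum w" by (simp add: dvd_mod_iff)
    finally show ?thesis .
  qed
  then show ?thesis by (simp add: stab_def cyclic_stab_def)
qed

lemma structs_cyclic_stab:
  assumes d: "d > 0"
  shows "structs {cyclic_stab d} A = (\<lambda>f _. f) ` semireg d A"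
proof (intro equalityI subsetI)
  fix a assume a: "a \<in> structs {cyclic_stab d} A"
  have "(a () ^^ i) p = p \<longleftrightarrow> d dvd i" if "p \<in> A" for p i
  proof -
    have "replicate i ((), True) \<in> stab a p \<longleftrightarrow> d dvd i"
      using structsD(3)[OF a that] by (simp add: cyclic_stab_def)
    then show ?thesis by (simp add: stab_def word_act_replicate)
  qed
  then have "a () \<in> semireg d A"
    using structs_permutes[OF a] by (simp add: semireg_def)
  moreover have "a = (\<lambda>_. a ())" by (rule ext) simp
  ultimately show "a \<in> (\<lambda>f _. f) ` semireg d A" by blast
next
  fix a assume "a \<in> (\<lambda>f (_ :: unit). f) ` semireg d A"
  then obtain f where f: "a = (\<lambda>_. f)" "f \<in> semireg d A" by blast
  then show "a \<in> structs {cyclic_stab d} A"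
    using stab_semireg[OF f(2) d] semiregD(1)[OF f(2)] by (simp add: structs_def perm_rep_def)
qed

lemma card_semireg:
  assumes "d > 0"
  shows "card (semireg d {..<n}) = struct_number {cyclic_stab d} n"
proof -
  have "inj_on (\<lambda>f (_ :: unit). f) (semireg d {..<n})" by (auto simp: inj_on_def fun_eq_iff)
  then show ?thesis
    unfolding struct_number_def structs_cyclic_stab[OF assms] by (simp add: card_image)
qed

lemma card_orb_cyclic:
  assumes d: "d > 0" and a: "a \<in> structs {cyclic_stab d} A" and p: "p \<in> A"
  shows "card (orb a p) = d"
proof -
  obtain f where f: "a = (\<lambda>_. f)" "f \<in> semireg d A"
    using a unfolding structs_cyclic_stab[OF d] by blast
  have "orb a p = (\<lambda>i. (f ^^ i) p) ` {..<d}"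
  proof (intro equalityI subsetI)
    fix x assume "x \<in> orb a p"
    then obtain w where "x = word_act a w p" by (rule orbE)
    then show "x \<in> (\<lambda>i. (f ^^ i) p) ` {..<d}"
      using d by (auto simp: f(1) word_act_semireg[OF f(2) d p] nat_less_iff)
  next
    fix x assume "x \<in> (\<lambda>i. (f ^^ i) p) ` {..<d}"
    then obtain i where "x = (f ^^ i) p" by blast
    then have "x = word_act a (replicate i ((), True)) p" by (simp add: word_act_replicate f(1))
    then show "x \<in> orb a p" by (simp add: orbI)
  qed
  moreover have "inj_on (\<lambda>i. (f ^^ i) p) {..<d}"
    by (rule inj_onI) (simp add: semireg_eq_iff[OF f(2) p])
  ultimately show ?thesis by (simp add: card_image)
qed

lemma shift_semireg:
  assumes d: "d > 0"
  shows "(\<lambda>i. if i < d then (i + 1) mod d else i) \<in> semireg d {..<d}" (is "?f \<in> _")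
proof -
  have pow: "(?f ^^ j) i = (i + j) mod d" if "i < d" for i j
    using d that by (induction j) (simp_all add: mod_simps)
  have "inj_on ?f {..<d}"
  proof (rule inj_onI)
    fix i j assume "i \<in> {..<d}" "j \<in> {..<d}" "?f i = ?f j"
    then have ij: "i < d" "j < d" "Suc i mod d = Suc j mod d" by simp_all
    then show "i = j" by (metis Suc_inject Suc_leI le_neq_implies_less mod_less mod_self nat.distinct(1))
  qed
  then have "bij_betw ?f {..<d} {..<d}"
    using d by (intro bij_betw_imageI endo_inj_surj) auto
  then have "?f permutes {..<d}" by (rule bij_imp_permutes) simp
  moreover have "(?f ^^ j) i = i \<longleftrightarrow> d dvd j" if "i < d" for i j
  proof -
    have "(i + j) mod d = i \<longleftrightarrow> (i + j) mod d = (i + 0) mod d" using that by simp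
    also have "\<dots> \<longleftrightarrow> d dvd j"
      using mod_eq_dvd_iff_nat[of "i + 0" "i + j" d] by auto
    finally show ?thesis using pow[OF that] by simp
  qed
  ultimately show ?thesis by (simp add: semireg_def)
qed

text \<open>A transitive structure is a single d-cycle and its stabiliser is forced; the cyclic
  shift shows that one exists.\<close>

lemma stab_number_cyclic:
  assumes d: "d > 0" and k: "k > 0"
  shows "stab_number {cyclic_stab d} k = (if k = d then 1 else 0)"
proof (cases "k = d")
  case True
  define a where "a = (\<lambda>_ :: unit. \<lambda>i. if i < d then (i + 1) mod d else i)"
  have a: "a \<in> structs {cyclic_stab d} {..<d}"
    unfolding structs_cyclic_stab[OF d] a_def using shift_semireg[OF d] by blast
  have "orb a p = {..<d}" if "p < d" for p
    using card_orb_cyclic[OF d a, of p] orb_subset[OF structsD(1)[OF a], of p] that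
    by (intro card_subset_eq) simp_all
  with a have "a \<in> trans_structs {cyclic_stab d} {..<d}" by (simp add: trans_structs_def)
  moreover have "stab b 0 = cyclic_stab d" if "b \<in> trans_structs {cyclic_stab d} {..<d}" for b
    using structsD(3)[OF trans_structsD(1)[OF that], of 0] d by simp
  ultimately have "(\<lambda>a. stab a 0) ` trans_structs {cyclic_stab d} {..<d} = {cyclic_stab d}"
    by blast
  then show ?thesis using True by (simp add: stab_number_def)
next
  case False
  have "a \<notin> trans_structs {cyclic_stab d} {..<k}" for a
    using card_orb_cyclic[OF d trans_structsD(1), of a "{..<k}" 0] trans_structsD(2)[of a _ "{..<k}" 0]
      k False by auto
  then have "trans_structs {cyclic_stab d} {..<k} = {}" by blast
  then show ?thesis using False by (simp add: stab_number_def)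
qed

text \<open>The recursion of the coefficients of exp(z^d / d).\<close>

lemma struct_weight_cyclic_rec:
  assumes d: "d > 0"
  shows "of_nat n * struct_weight {cyclic_stab d} n = (if d \<le> n then struct_weight {cyclic_stab d} (n - d) else 0)"
proof -
  have "of_nat n * struct_weight {cyclic_stab d} n
      = (\<Sum>k=1..n. if k = d then struct_weight {cyclic_stab d} (n - d) else 0)"
    unfolding struct_weight_rec using d
    by (intro sum.cong) (simp_all add: stab_number_cyclic)
  then show ?thesis using d by simp
qed

lemma struct_weight_cyclic_zero:
  assumes d: "d > 0" and n: "\<not> d dvd n"
  shows "struct_weight {cyclic_stab d} n = 0"
  using n
proof (induction n rule: less_induct)
  case (less n)
  have "n > 0" using less.prems by (cases n) auto
  moreover have "\<not> d dvd n - d" if "d \<le> n" using that less.prems by (simp add: less_eq_dvd_minus)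
  ultimately have "of_nat n * struct_weight {cyclic_stab d} n = 0"
    unfolding struct_weight_cyclic_rec[OF d] using less.IH[of "n - d"] d by auto
  then show ?case using \<open>n > 0\<close> by simp
qed

lemma struct_weight_cyclic:
  assumes d: "d > 0"
  shows "struct_weight {cyclic_stab d} (d * k) = 1 / (of_nat d ^ k * fact k)"
proof (induction k)
  case 0
  then show ?case by (simp add: struct_weight_0)
next
  case (Suc k)
  have "of_nat (d * Suc k) * struct_weight {cyclic_stab d} (d * Suc k) = 1 / (of_nat d ^ k * fact k)"
    unfolding struct_weight_cyclic_rec[OF d] using Suc by simp
  moreover have "(of_nat (d * Suc k) :: rat) \<noteq> 0"
    using d unfolding of_nat_eq_0_iff by simp
  ultimately have "struct_weight {cyclic_stab d} (d * Suc k)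
      = 1 / (of_nat d ^ k * fact k) / of_nat (d * Suc k)"
    by (metis nonzero_mult_div_cancel_left)
  then show ?case by (simp add: algebra_simps)
qed

text \<open>With one admissible stabiliser all orbits are isomorphic, so the two structures can be
  matched orbit by orbit. For semiregular permutations this is conjugacy of permutations of equal
  cycle type.\<close>

lemma singleton_structs_isomorphic:
  fixes A B :: "'p set"
  assumes "finite A" "finite B" "card A = card B" "a \<in> structs {L} A" "b \<in> structs {L} B"
  shows "\<exists>\<rho>. bij_betw \<rho> A B \<and> (\<forall>g. \<forall>x\<in>A. \<rho> (a g x) = b g (\<rho> x))"
  using assms
proof (induction "card A" arbitrary: A B a b rule: less_induct)
  case less
  note a = less.prems(4) and b = less.prems(5) and fin = less.prems(1,2)
  show ?case
  proof (cases "A = {}")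
    case True
    then show ?thesis using less.prems by auto
  next
    case False
    then obtain p q where p: "p \<in> A" and q: "q \<in> B"
      using less.prems(3) fin by (metis card_gt_0_iff ex_in_conv)
  let ?P = "orb a p"
  let ?Q = "orb b q"
    have "stab a p = stab b q" using structsD(3)[OF a p] structsD(3)[OF b q] by simp
    then obtain \<rho> where \<rho>: "bij_betw \<rho> (?P) (?Q)"
      "\<And>g x. x \<in> ?P \<Longrightarrow> \<rho> (a g x) = b g (\<rho> x)"
      using stab_transport[OF structsD(2)[OF a] structsD(2)[OF b]] by blast
    have sub: "?P \<subseteq> A" "?Q \<subseteq> B"
      using orb_subset[OF structsD(1)[OF a] p] orb_subset[OF structsD(1)[OF b] q] .
    have card: "card (?P) = card (?Q)" using \<rho>(1) by (rule bij_betw_same_card)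
    note inv = structs_image_orb(2)[OF fin(1) a p] structs_image_orb(2)[OF fin(2) b q]
    have lt: "card (A - ?P) < card A"
      using fin p by (intro psubset_card_mono) (auto intro: orb_self)
    have ceq: "card (A - ?P) = card (B - ?Q)"
      using sub fin less.prems(3) card by (simp add: card_Diff_subset finite_subset)
    have ra: "restrict_perm (A - ?P) a \<in> structs {L} (A - ?P)"
      using a by (rule restrict_perm_structs) (use inv in auto)
    have rb: "restrict_perm (B - ?Q) b \<in> structs {L} (B - ?Q)"
      using b by (rule restrict_perm_structs) (use inv in auto)
    obtain \<sigma> where \<sigma>: "bij_betw \<sigma> (A - ?P) (B - ?Q)"
      "\<And>g x. x \<in> A - ?P \<Longrightarrow> \<sigma> (restrict_perm (A - ?P) a g x) = restrict_perm (B - ?Q) b g (\<sigma> x)"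
      using less.hyps[OF lt _ _ ceq ra rb] fin by auto
    define \<tau> where "\<tau> x = (if x \<in> ?P then \<rho> x else \<sigma> x)" for x
    have "bij_betw \<tau> (?P) (?Q)"
      using \<rho>(1) by (rule bij_betw_cong[THEN iffD1, rotated]) (simp add: \<tau>_def)
    moreover have "bij_betw \<tau> (A - ?P) (B - ?Q)"
      using \<sigma>(1) by (rule bij_betw_cong[THEN iffD1, rotated]) (simp add: \<tau>_def)
    ultimately have "bij_betw \<tau> (?P \<union> (A - ?P)) (?Q \<union> (B - ?Q))"
      by (rule bij_betw_combine) auto
    then have "bij_betw \<tau> A B" using sub by (simp add: Un_absorb1 Un_Diff_cancel)
    moreover have "\<tau> (a g x) = b g (\<tau> x)" if "x \<in> A" for g x
    proof (cases "x \<in> ?P")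
      case True
      then show ?thesis using \<rho>(2)[OF True] orb_step[OF True] by (simp add: \<tau>_def)
    next
      case False
      then have x: "x \<in> A - ?P" using that by simp
      then have "a g x \<in> A - ?P" using inv(1)[of g] by blast
      moreover have "\<sigma> x \<in> B - ?Q" using \<sigma>(1) x by (rule bij_betwE[THEN bspec])
      ultimately show ?thesis using \<sigma>(2)[OF x, of g] x by (simp add: \<tau>_def restrict_perm_def)
    qed
    ultimately show ?thesis by blast
  qed
qed

lemma semireg_conjugate:
  fixes A :: "'p set"
  assumes d: "d > 0" and fin: "finite A" and f: "f \<in> semireg d A" and g: "g \<in> semireg d A"
  obtains \<pi> where "\<pi> permutes A" "\<And>x. \<pi> (f x) = g (\<pi> x)"
proof -
  obtain \<rho> where \<rho>: "bij_betw \<rho> A A" "\<And>x. x \<in> A \<Longrightarrow> \<rho> (f x) = g (\<rho> x)"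
    using singleton_structs_isomorphic[of A A "\<lambda>_. f" "cyclic_stab d" "\<lambda>_. g"] fin f g
    unfolding structs_cyclic_stab[OF d] by auto
  define \<pi> where "\<pi> x = (if x \<in> A then \<rho> x else x)" for x
  have "bij_betw \<pi> A A"
    using \<rho>(1) by (rule bij_betw_cong[THEN iffD1, rotated]) (simp add: \<pi>_def)
  then have "\<pi> permutes A" by (rule bij_imp_permutes) (simp add: \<pi>_def)
  moreover have "\<pi> (f x) = g (\<pi> x)" for x
    using \<rho>(2)[of x] permutes_in_image[OF semiregD(1)[OF f], of x]
      permutes_not_in[OF semiregD(1)[OF f], of x] permutes_not_in[OF semiregD(1)[OF g], of x]
    by (auto simp: \<pi>_def)
  ultimately show thesis by (rule that)
qed

lemma funpow_conj:
  assumes "\<pi> permutes A"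
  shows "(\<pi> \<circ> f \<circ> fun_inv \<pi>) ^^ i = \<pi> \<circ> (f ^^ i) \<circ> fun_inv \<pi>"
  using permutes_inverses[OF assms] by (induction i) (simp_all add: fun_eq_iff)

lemma conj_semireg:
  assumes \<pi>: "\<pi> permutes A" and f: "f \<in> semireg d A"
  shows "\<pi> \<circ> f \<circ> fun_inv \<pi> \<in> semireg d A"
proof -
  have "\<pi> \<circ> f \<circ> fun_inv \<pi> permutes A"
    using \<pi> semiregD(1)[OF f] by (intro permutes_compose permutes_inv)
  moreover have "((\<pi> \<circ> f \<circ> fun_inv \<pi>) ^^ i) p = p \<longleftrightarrow> d dvd i" if p: "p \<in> A" for p i
  proof -
    have "fun_inv \<pi> p \<in> A" using p permutes_in_image[OF permutes_inv[OF \<pi>]] by simp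
    then have "(f ^^ i) (fun_inv \<pi> p) = fun_inv \<pi> p \<longleftrightarrow> d dvd i" by (rule semiregD(2)[OF f])
    then show ?thesis unfolding funpow_conj[OF \<pi>] using permutes_inverses[OF \<pi>] by (simp, metis)
  qed
  ultimately show ?thesis by (simp add: semireg_def)
qed

lemma finite_semireg: "finite A \<Longrightarrow> finite (semireg d A)"
  by (rule finite_subset[of _ "{f. f permutes A}"]) (auto simp: semireg_def finite_permutations)

text \<open>The set of roots of \<open>c\<close> has the same size for all \<open>c\<close>, since all of them are conjugate.\<close>
lemma card_roots:
  fixes A :: "'p set"
  assumes d: "d > 0" and k: "k > 0" and fin: "finite A" and c: "c \<in> semireg d A"
  shows "card (semireg (k * d) A) = card (semireg d A) * card {f \<in> semireg (k * d) A. f ^^ k = c}"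
proof -
  let ?R = "\<lambda>c. {f \<in> semireg (k * d) A. f ^^ k = c}"
  have le: "card (?R c) \<le> card (?R c')" if "c \<in> semireg d A" "c' \<in> semireg d A" for c c'
  proof -
    obtain \<pi> where \<pi>: "\<pi> permutes A" "\<And>x. \<pi> (c x) = c' (\<pi> x)"
      using semireg_conjugate[OF d fin \<open>c \<in> semireg d A\<close> \<open>c' \<in> semireg d A\<close>] by blast
    show ?thesis
    proof (rule card_inj_on_le[where f = "\<lambda>f. \<pi> \<circ> f \<circ> fun_inv \<pi>"])
      show "inj_on (\<lambda>f. \<pi> \<circ> f \<circ> fun_inv \<pi>) (?R c)"
      proof (rule inj_onI)
        fix f g assume "\<pi> \<circ> f \<circ> fun_inv \<pi> = \<pi> \<circ> g \<circ> fun_inv \<pi>"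
        then have "\<pi> (f x) = \<pi> (g x)" for x
          using permutes_inverses(2)[OF \<pi>(1)] by (metis comp_apply)
        then show "f = g" using permutes_inj[OF \<pi>(1)] by (auto simp: fun_eq_iff inj_eq)
      qed
      show "(\<lambda>f. \<pi> \<circ> f \<circ> fun_inv \<pi>) ` ?R c \<subseteq> ?R c'"
      proof (rule image_subsetI)
        fix f assume f: "f \<in> ?R c"
        have "(\<pi> \<circ> f \<circ> fun_inv \<pi>) ^^ k = c'"
          unfolding funpow_conj[OF \<pi>(1)]
          using f \<pi>(2) permutes_inverses(1)[OF \<pi>(1)] by (simp add: fun_eq_iff)
        then show "\<pi> \<circ> f \<circ> fun_inv \<pi> \<in> ?R c'" using f conj_semireg[OF \<pi>(1)] by simp
      qed
      show "finite (?R c')" using finite_semireg[OF fin] by simp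
    qed
  qed
  have "card (semireg (k * d) A) = (\<Sum>c'\<in>semireg d A. card (?R c'))"
    using semireg_power[OF _ k] finite_semireg[OF fin]
    by (intro card_fibres) auto
  also have "\<dots> = (\<Sum>c'\<in>semireg d A. card (?R c))"
    using le c by (intro sum.cong) (auto intro: antisym)
  finally show ?thesis by simp
qed

section \<open>Torsion-free permutation representations of \<open>\<Gamma>\<^sub>m(q)\<close>\<close>

abbreviation pow_word :: "'g \<Rightarrow> nat \<Rightarrow> 'g word" where
  "pow_word g i \<equiv> replicate i (g, True)"

text \<open>The first two conditions fix the exact cycle lengths and contain the two power
  relations; the last word is x^2 y^(-q), so it expresses x^2 = y^q at the point.\<close>

definition Gamma_stabs :: "nat \<Rightarrow> nat \<Rightarrow> gen word set set" where
  "Gamma_stabs m q = {L. (\<forall>i. pow_word X i \<in> L \<longleftrightarrow> 2 * m dvd i) \<and> (\<forall>i. pow_word Y i \<in> L \<longleftrightarrow> q * m dvd i)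
    \<and> pow_word X 2 @ word_inv (pow_word Y q) \<in> L}"

lemma UNIV_gen: "UNIV = {X, Y}"
proof -
  have "g \<in> {X, Y}" for g by (cases g) simp_all
  then show ?thesis by blast
qed

instance gen :: finite
  by intro_classes (simp add: UNIV_gen)

lemma all_gen: "(\<forall>g. P g) \<longleftrightarrow> P X \<and> P Y"
  by (metis gen.exhaust)

lemma Gamma_structs_iff:
  "a \<in> structs (Gamma_stabs m q) A \<longleftrightarrow>
    a X \<in> semireg (2 * m) A \<and> a Y \<in> semireg (q * m) A \<and> a X ^^ 2 = a Y ^^ q"
proof -
  have rel: "pow_word X 2 @ word_inv (pow_word Y q) \<in> stab a p \<longleftrightarrow> (a X ^^ 2) p = (a Y ^^ q) p"
    if "perm_rep a A" for p
    using stab_word_eq[OF perm_rep_bijective[OF that], of "pow_word X 2" p "pow_word Y q"]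
    by (simp only: word_act_replicate)
  have "a X ^^ 2 = a Y ^^ q \<longleftrightarrow> (\<forall>p\<in>A. (a X ^^ 2) p = (a Y ^^ q) p)" if "perm_rep a A"
    using permutes_not_in[OF funpow_permutes[OF perm_repD[OF that]]] by (metis ext)
  then show ?thesis
    unfolding structs_def Gamma_stabs_def semireg_def mem_Collect_eq
    using rel by (auto simp: perm_rep_def all_gen stab_def word_act_replicate)
qed

text \<open>Choose x first, then y among the q-th roots of x^2, whose number does not depend on x by
  \<open>card_roots\<close>. The product form avoids a division by the number of semiregular
  permutations, which may be 0.\<close>

lemma card_Gamma_structs:
  assumes m: "m > 0" and q: "q > 0" and fin: "finite A"
  shows "card (structs (Gamma_stabs m q) A) * card (semireg m A)
    = card (semireg (2 * m) A) * card (semireg (q * m) A)"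
proof (cases "semireg m A = {}")
  case True
  then have "semireg (2 * m) A = {}" using semireg_power[of _ 2 m A] by auto
  then show ?thesis using True by simp
next
  case False
  then obtain c where c: "c \<in> semireg m A" by blast
  let ?R = "\<lambda>k c. {f \<in> semireg (k * m) A. f ^^ k = c}"
  have R: "card (?R k c') * card (semireg m A) = card (semireg (k * m) A)"
    if "k > 0" "c' \<in> semireg m A" for k c'
    using card_roots[OF m that(1) fin that(2)] by simp
  have N: "card (semireg m A) > 0" using finite_semireg[OF fin] c by (auto simp: card_gt_0_iff)
  have "bij_betw (\<lambda>a. (a X, a Y)) (structs (Gamma_stabs m q) A)
      (SIGMA x:semireg (2 * m) A. ?R q (x ^^ 2))"
    by (rule bij_betw_byWitness[where f' = "\<lambda>(x, y) g. case g of X \<Rightarrow> x | Y \<Rightarrow> y"])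
       (auto simp: Gamma_structs_iff fun_eq_iff split: gen.splits)
  then have "card (structs (Gamma_stabs m q) A) = (\<Sum>x\<in>semireg (2 * m) A. card (?R q (x ^^ 2)))"
    using finite_semireg[OF fin] by (subst bij_betw_same_card) (auto intro!: card_SigmaI)
  also have "\<dots> = (\<Sum>x\<in>semireg (2 * m) A. card (?R q c))"
  proof (rule sum.cong)
    fix x assume "x \<in> semireg (2 * m) A"
    then have "x ^^ 2 \<in> semireg m A" by (rule semireg_power) simp
    then have "card (?R q (x ^^ 2)) * card (semireg m A) = card (?R q c) * card (semireg m A)"
      using R[OF q] c by simp
    then show "card (?R q (x ^^ 2)) = card (?R q c)" using N by simp
  qed simp
  finally show ?thesis using R[OF q c] by simp
qed

definition Gamma_weight :: "nat \<Rightarrow> nat \<Rightarrow> nat \<Rightarrow> rat" where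
  "Gamma_weight m q k = struct_weight (Gamma_stabs m q) (2 * q * m * k)"

lemma Gamma_struct_weight_mult:
  assumes m: "m > 0" and q: "q > 0"
  shows "struct_weight (Gamma_stabs m q) n * struct_weight {cyclic_stab m} n
    = struct_weight {cyclic_stab (2 * m)} n * struct_weight {cyclic_stab (q * m)} n"
proof -
  have "struct_number (Gamma_stabs m q) n * struct_number {cyclic_stab m} n
    = struct_number {cyclic_stab (2 * m)} n * struct_number {cyclic_stab (q * m)} n"
    using card_Gamma_structs[OF m q, of "{..<n}"] m q
    by (simp add: card_semireg) (simp add: struct_number_def)
  then show ?thesis
    unfolding struct_weight_def by (simp add: field_simps) (metis of_nat_mult)
qed

lemma Gamma_weight_eq:
  assumes m: "m > 0" and q: "q > 0"
  shows "Gamma_weight m q k = of_nat m ^ (2 * q * k) * fact (2 * q * k)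
    / (of_nat (2 * m) ^ (q * k) * fact (q * k) * (of_nat (q * m) ^ (2 * k) * fact (2 * k)))"
proof -
  have 1: "struct_weight {cyclic_stab m} (2 * q * m * k) = 1 / (of_nat m ^ (2 * q * k) * fact (2 * q * k))"
    using struct_weight_cyclic[OF m, of "2 * q * k"] by (simp add: ac_simps)
  have 2: "struct_weight {cyclic_stab (2 * m)} (2 * q * m * k) = 1 / (of_nat (2 * m) ^ (q * k) * fact (q * k))"
    using struct_weight_cyclic[of "2 * m" "q * k"] m by (simp add: ac_simps)
  have 3: "struct_weight {cyclic_stab (q * m)} (2 * q * m * k) = 1 / (of_nat (q * m) ^ (2 * k) * fact (2 * k))"
    using struct_weight_cyclic[of "q * m" "2 * k"] m q by (simp add: ac_simps)
  show ?thesis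
    using Gamma_struct_weight_mult[OF m q, of "2 * q * m * k"] m q
    unfolding 1 2 3 Gamma_weight_def by (simp add: field_simps)
qed

text \<open>The degree is a multiple of 2m and of qm, and for odd q their least common multiple is
  2qm. Hence one power of z may stand for 2qm points.\<close>

lemma Gamma_struct_weight_zero:
  assumes m: "m > 0" and q: "odd q" and n: "\<not> 2 * q * m dvd n"
  shows "struct_weight (Gamma_stabs m q) n = 0"
proof (cases "structs (Gamma_stabs m q) {..<n} = {}")
  case True
  then show ?thesis by (simp add: struct_weight_def struct_number_def)
next
  case False
  have q0: "q > 0" using q by (rule odd_pos)
  from False obtain a where a: "a X \<in> semireg (2 * m) {..<n}" "a Y \<in> semireg (q * m) {..<n}"
    by (auto simp: Gamma_structs_iff)
  have dvd: "d dvd n" if "f \<in> semireg d {..<n}" "d > 0" for d f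
  proof (rule ccontr)
    assume "\<not> d dvd n"
    then have "card (semireg d {..<n}) = 0"
      using struct_weight_cyclic_zero[OF that(2)] by (simp add: card_semireg[OF that(2)] struct_weight_def)
    then show False using that(1) finite_semireg[of "{..<n}" d] by auto
  qed
  have "2 * m dvd n" "q * m dvd n" using dvd a m q0 by auto
  then obtain u v where n': "n = 2 * m * u" "n = q * m * v" by (elim dvdE)
  have "m * (2 * u) = n" unfolding n'(1) by simp
  also have "n = m * (q * v)" using n'(2) by (simp add: ac_simps)
  finally have "m * (2 * u) = m * (q * v)" .
  then have "2 * u = q * v" using m by simp
  then have "even (q * v)" by (metis dvd_triv_left)
  then have "even v" using q by simp
  then have "2 * q * m dvd n" unfolding n'(2) by (auto elim!: dvdE simp: ac_simps)
  with n show ?thesis by simp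
qed

lemma Gamma_weight_rec:
  assumes m: "m > 0" and q: "odd q"
  shows "of_nat (2 * q * m * n) * Gamma_weight m q n =
    (\<Sum>k=1..n. of_nat (stab_number (Gamma_stabs m q) (2 * q * m * k)) * Gamma_weight m q (n - k))"
proof -
  define d where "d = 2 * q * m"
  have d: "d > 0" using m odd_pos[OF q] by (simp add: d_def)
  let ?s = "\<lambda>k. of_nat (stab_number (Gamma_stabs m q) k) * struct_weight (Gamma_stabs m q) (d * n - k)"
  have "of_nat (d * n) * Gamma_weight m q n = (\<Sum>k=1..d * n. ?s k)"
    unfolding Gamma_weight_def d_def[symmetric] by (rule struct_weight_rec)
  also have "\<dots> = (\<Sum>k\<in>(*) d ` {1..n}. ?s k)"
  proof (rule sum.mono_neutral_right)
    show "\<forall>k\<in>{1..d * n} - (*) d ` {1..n}. ?s k = 0"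
    proof
      fix k assume k: "k \<in> {1..d * n} - (*) d ` {1..n}"
      have "\<not> d dvd d * n - k"
      proof
        assume "d dvd d * n - k"
        then have "d dvd k" using k by (metis DiffD1 atLeastAtMost_iff dvd_diffD1 dvd_triv_left)
        then obtain j where "k = d * j" ..
        then show False using k d by auto
      qed
      then show "?s k = 0" using Gamma_struct_weight_zero[OF m q] by (simp add: d_def)
    qed
  qed (use d in auto)
  also have "\<dots> = (\<Sum>k=1..n. ?s (d * k))"
    using d by (subst sum.reindex) (auto simp: inj_on_def)
  also have "\<dots> = (\<Sum>k=1..n. of_nat (stab_number (Gamma_stabs m q) (d * k)) * Gamma_weight m q (n - k))"
    by (intro sum.cong) (simp_all add: Gamma_weight_def d_def diff_mult_distrib2)
  finally show ?thesis unfolding d_def .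
qed

section \<open>Free groups are torsion-free\<close>

abbreviation wcls :: "'a set \<Rightarrow> ('a word \<times> 'a word) set \<Rightarrow> 'a word \<Rightarrow> 'a word set" where
  "wcls S R w \<equiv> word_cong S R `` {w}"

lemma carrier_presented_group: "carrier (presented_group S R) = wcls S R ` words_over S"
  by (auto simp: presented_group_def quotient_def)

lemma one_presented_group: "\<one>\<^bsub>presented_group S R\<^esub> = wcls S R []"
  by (simp add: presented_group_def)

lemma wcls_eq_iff:
  "u \<in> words_over S \<Longrightarrow> v \<in> words_over S \<Longrightarrow> wcls S R u = wcls S R v \<longleftrightarrow> (u, v) \<in> word_cong S R"
  by (rule eq_equiv_class_iff[OF equiv_word_cong])

lemma wcls_pow:
  assumes "w \<in> words_over S"
  shows "wcls S R w [^]\<^bsub>presented_group S R\<^esub> (k :: nat) = wcls S R (concat (replicate k w))"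
proof (induction k)
  case 0
  interpret group "presented_group S R" by (rule group_presented_group)
  show ?case by (simp add: one_presented_group)
next
  case (Suc k)
  interpret group "presented_group S R" by (rule group_presented_group)
  have "wcls S R w \<in> carrier (presented_group S R)"
    using assms by (simp add: carrier_presented_group)
  moreover have "concat (replicate k w) \<in> words_over S" using assms by (induction k) auto
  moreover from calculation have "wcls S R w [^]\<^bsub>presented_group S R\<^esub> Suc k
      = wcls S R w \<otimes>\<^bsub>presented_group S R\<^esub> (wcls S R w [^]\<^bsub>presented_group S R\<^esub> k)"
    by (intro nat_pow_Suc2)
  ultimately show ?case using Suc assms by (simp only: presented_group_mult) simp
qed

section \<open>Reduced words as normal forms\<close>

definition letter_inv :: "'a \<times> bool \<Rightarrow> 'a \<times> bool" where
  "letter_inv l = (fst l, \<not> snd l)"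

lemma letter_inv_simps [simp]:
  "letter_inv (letter_inv l) = l" "letter_inv l \<noteq> l" "letter_inv (a, b) = (a, \<not> b)"
  "l \<noteq> letter_inv l" "fst (letter_inv l) = fst l"
  by (auto simp: letter_inv_def prod_eq_iff)

definition reduced :: "'a word \<Rightarrow> bool" where
  "reduced w \<longleftrightarrow> successively (\<lambda>l l'. l' \<noteq> letter_inv l) w"

text \<open>Left multiplication by a letter, carried out on reduced words. Since it respects
  cancellation, applying a word to the empty word yields a normal form without a confluence
  argument.\<close>

definition push :: "'a \<times> bool \<Rightarrow> 'a word \<Rightarrow> 'a word" where
  "push l w = (case w of [] \<Rightarrow> [l] | l' # v \<Rightarrow> if l' = letter_inv l then v else l # w)"

lemma reduced_push: "reduced w \<Longrightarrow> reduced (push l w)"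
  by (cases w) (auto simp: reduced_def push_def successively_Cons)

lemma push_cancel: "reduced w \<Longrightarrow> push (letter_inv l) (push l w) = w"
  by (cases w; cases "tl w") (auto simp: reduced_def push_def split: list.splits)

lemma reduced_foldr_push: "reduced r \<Longrightarrow> reduced (foldr push w r)"
  by (induction w) (simp_all add: reduced_push)

lemma foldr_push_word_cong:
  "(u, v) \<in> word_cong S {} \<Longrightarrow> reduced r \<Longrightarrow> foldr push u r = foldr push v r"
proof (induction arbitrary: r rule: word_cong.induct)
  case (cancel u v a b)
  then show ?case
    using push_cancel[of "foldr push v r" "(a, \<not> b)"] by (simp add: reduced_foldr_push)
qed auto

lemma foldr_push_reduced: "reduced w \<Longrightarrow> foldr push w [] = w"
proof (induction w)
  case (Cons l w)
  then have "reduced w" by (auto simp: reduced_def successively_Cons)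
  then show ?case using Cons by (cases w) (auto simp: reduced_def push_def)
qed simp

lemma reduced_word_cong_unique:
  assumes "(u, v) \<in> word_cong S {}" "reduced u" "reduced v"
  shows "u = v"
  using foldr_push_word_cong[OF assms(1), of "[]"] assms(2,3)
  by (simp add: foldr_push_reduced) (simp add: reduced_def)

lemma word_cong_power:
  assumes "(u, v) \<in> word_cong S R"
  shows "(concat (replicate k u), concat (replicate k v)) \<in> word_cong S R"
proof (induction k)
  case 0
  then show ?case by (simp add: word_cong.refl)
next
  case (Suc k)
  then show ?case using word_cong_append[OF assms Suc] by simp
qed

lemma not_reducedE:
  assumes "\<not> reduced w"
  obtains u l v where "w = u @ [l, letter_inv l] @ v"
proof -
  obtain i where i: "Suc i < length w" "w ! Suc i = letter_inv (w ! i)"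
    using assms by (auto simp: reduced_def successively_conv_nth)
  then have "w = take i w @ [w ! i, letter_inv (w ! i)] @ drop (Suc (Suc i)) w"
    using id_take_nth_drop[of i w] Cons_nth_drop_Suc[of "Suc i" w] by simp
  then show thesis by (rule that)
qed

lemma reduced_power:
  assumes "reduced w" "w \<noteq> []" "hd w \<noteq> letter_inv (last w)"
  shows "reduced (concat (replicate k w))"
proof (induction k)
  case (Suc k)
  have "hd (concat (replicate k w)) = hd w" if "concat (replicate k w) \<noteq> []"
    using that assms(2) by (cases k) auto
  then show ?case
    using Suc assms by (auto simp: reduced_def successively_append_iff)
qed (simp add: reduced_def)

lemma cancel_letter:
  assumes "fst l \<in> S" "u \<in> words_over S" "v \<in> words_over S"
  shows "(u @ [l, letter_inv l] @ v, u @ v) \<in> word_cong S R"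
  using word_cong.cancel[OF assms(2,3,1), of "snd l" R] by (simp add: letter_inv_def)

text \<open>A word of minimal length in its conjugacy class is cyclically reduced, so none of its powers
  cancel.\<close>
lemma word_cong_torsion_free:
  assumes "w \<in> words_over S" "(concat (replicate k w), []) \<in> word_cong S {}" "k > 0"
  shows "(w, []) \<in> word_cong S {}"
  using assms
proof (induction "length w" arbitrary: w rule: less_induct)
  case less
  note w = less.prems(1) and wk = less.prems(2)
  consider "\<not> reduced w" | "w = []" | "reduced w" "w \<noteq> []" "hd w = letter_inv (last w)"
    | "reduced w" "w \<noteq> []" "hd w \<noteq> letter_inv (last w)" by blast
  then show ?case
  proof cases
    case 1
    then obtain u l v where uv: "w = u @ [l, letter_inv l] @ v" by (rule not_reducedE)
    have S: "fst l \<in> S" "u \<in> words_over S" "v \<in> words_over S" using w by (auto simp: uv)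
    have c: "(w, u @ v) \<in> word_cong S {}" unfolding uv by (rule cancel_letter[OF S])
    have "(concat (replicate k (u @ v)), []) \<in> word_cong S {}"
      using word_cong.trans[OF word_cong.sym[OF word_cong_power[OF c]] wk] .
    moreover have "length (u @ v) < length w" "u @ v \<in> words_over S" using S by (simp_all add: uv)
    ultimately have "(u @ v, []) \<in> word_cong S {}"
      using less.hyps less.prems(3) by blast
    with c show ?thesis by (rule word_cong.trans)
  next
    case 2
    then show ?thesis by (simp add: word_cong.refl)
  next
    \<comment> \<open>Here w is l u l^(-1), so its powers are conjugate to the powers of the shorter
      word u.\<close>
    case 3
    then obtain l w' where lw: "w = l # w'" by (cases w) auto
    have "w' \<noteq> []" using 3 lw by auto
    then obtain u l' where u: "w' = u @ [l']" by (cases w' rule: rev_cases) auto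
    have l': "l' = letter_inv l" using 3 lw u by auto
    have S: "fst l \<in> S" "u \<in> words_over S" "[l] \<in> words_over S" "[l'] \<in> words_over S"
      using w by (auto simp: lw u)
    have Sk: "concat (replicate k u) \<in> words_over S" for k using S(2) by (induction k) auto
    have cl: "(p @ [l, l'] @ s, p @ s) \<in> word_cong S {}" "(p @ [l', l] @ s, p @ s) \<in> word_cong S {}"
      if "p \<in> words_over S" "s \<in> words_over S" for p s
      using cancel_letter[of l S p s "{}"] cancel_letter[of l' S p s "{}"] S(1) that
      by (simp_all add: l')
    have conj: "(concat (replicate k w), [l] @ concat (replicate k u) @ [l']) \<in> word_cong S {}" for k
    proof (induction k)
      case 0
      then show ?case using word_cong.sym[OF cl(1)[of "[]" "[]"]] by simp
    next
      case (Suc k)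
      have "(w @ concat (replicate k w), w @ [l] @ concat (replicate k u) @ [l']) \<in> word_cong S {}"
        using Suc w by (intro word_cong_append word_cong.refl)
      moreover have "(([l] @ u) @ [l', l] @ (concat (replicate k u) @ [l']),
          ([l] @ u) @ (concat (replicate k u) @ [l'])) \<in> word_cong S {}"
        using S Sk by (intro cl) auto
      ultimately show ?case unfolding lw u by (auto intro: word_cong.trans)
    qed
    have "([l'] @ ([l] @ concat (replicate k u) @ [l']) @ [l], [l'] @ [] @ [l]) \<in> word_cong S {}"
      using S by (intro word_cong_context word_cong.trans[OF word_cong.sym[OF conj] wk])
    moreover have "([] @ [l', l] @ (concat (replicate k u) @ [l', l]), [] @ (concat (replicate k u) @ [l', l]))
        \<in> word_cong S {}"
      using S Sk by (intro cl) auto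
    moreover have "(concat (replicate k u) @ [l', l] @ [], concat (replicate k u) @ []) \<in> word_cong S {}"
      using Sk by (intro cl) auto
    moreover have "([] @ [l', l] @ [], [] @ []) \<in> word_cong S {}" by (intro cl) auto
    ultimately have "(concat (replicate k u), []) \<in> word_cong S {}"
      unfolding append_Nil append_Nil2 append_assoc append_Cons
      by (meson word_cong.sym word_cong.trans)
    moreover have "length u < length w" by (simp add: lw u)
    ultimately have "(u, []) \<in> word_cong S {}"
      using less.hyps S(2) less.prems(3) by blast
    then have "([l] @ u @ [l'], [l] @ [] @ [l']) \<in> word_cong S {}"
      using S by (intro word_cong_context)
    moreover have "([] @ [l, l'] @ [], [] @ []) \<in> word_cong S {}" by (intro cl) auto
    ultimately show ?thesis unfolding lw u by (auto intro: word_cong.trans)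
  next
    \<comment> \<open>The power is reduced and equal to the empty word in the free group, hence
      empty by uniqueness of reduced words, although w is not.\<close>
    case 4
    then have "reduced (concat (replicate k w))" by (rule reduced_power)
    then have "concat (replicate k w) = []"
      using reduced_word_cong_unique[OF wk] by (simp add: reduced_def)
    then show ?thesis using 4(2) less.prems(3) by auto
  qed
qed

lemma group_free_group: "group (free_group S)"
  unfolding free_group_def by (rule group_presented_group)

lemma free_group_torsion_free:
  assumes "g \<in> carrier (free_group S)" "g [^]\<^bsub>free_group S\<^esub> k = \<one>\<^bsub>free_group S\<^esub>" "k > (0 :: nat)"
  shows "g = \<one>\<^bsub>free_group S\<^esub>"
proof -
  obtain w where w: "w \<in> words_over S" "g = wcls S {} w"
    using assms(1) by (auto simp: free_group_def carrier_presented_group)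
  have "concat (replicate k w) \<in> words_over S" for k using w(1) by (induction k) auto
  then have "(concat (replicate k w), []) \<in> word_cong S {}"
    using assms(2) w wcls_pow[OF w(1), of "{}" k]
    by (simp add: free_group_def one_presented_group wcls_eq_iff[symmetric])
  then have "(w, []) \<in> word_cong S {}" using word_cong_torsion_free w(1) assms(3) by blast
  then show ?thesis using w by (simp add: free_group_def one_presented_group wcls_eq_iff)
qed

lemma is_free_group_torsion_free:
  fixes G :: "('a, 'b) monoid_scheme"
  assumes free: "is_free_group G" and G: "group G"
    and g: "g \<in> carrier G" "g [^]\<^bsub>G\<^esub> k = \<one>\<^bsub>G\<^esub>" "k > (0 :: nat)"
  shows "g = \<one>\<^bsub>G\<^esub>"
proof -
  obtain S :: "'a set" where "free_group S \<cong> G"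
    using free unfolding is_free_group_def by blast
  then obtain \<phi> where \<phi>: "\<phi> \<in> iso (free_group S) G"
    unfolding is_iso_def by blast
  interpret F: group "free_group S" by (rule group_free_group)
  interpret G: group G by (rule G)
  interpret hom: group_hom "free_group S" G \<phi>
    using \<phi> by unfold_locales (simp add: iso_def)
  obtain h where h: "h \<in> carrier (free_group S)" "g = \<phi> h"
    using \<phi> g(1) by (auto simp: iso_def bij_betw_def)
  have "\<phi> (h [^]\<^bsub>free_group S\<^esub> k) = \<phi> \<one>\<^bsub>free_group S\<^esub>"
    using g(2) h by (simp add: hom.hom_nat_pow)
  moreover have "inj_on \<phi> (carrier (free_group S))"
    using \<phi> unfolding iso_def bij_betw_def by blast
  ultimately have "h [^]\<^bsub>free_group S\<^esub> k = \<one>\<^bsub>free_group S\<^esub>"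
    using h(1) by (simp only: inj_on_eq_iff F.nat_pow_closed F.one_closed)
  then have "h = \<one>\<^bsub>free_group S\<^esub>" using free_group_torsion_free h(1) g(3) by blast
  then show ?thesis using h(2) by simp
qed

section \<open>Homomorphisms on free groups\<close>

definition eval_word :: "('b, 'c) monoid_scheme \<Rightarrow> ('a \<Rightarrow> 'b) \<Rightarrow> 'a word \<Rightarrow> 'b" where
  "eval_word G f w = foldr (\<lambda>l g. (if snd l then f (fst l) else inv\<^bsub>G\<^esub> f (fst l)) \<otimes>\<^bsub>G\<^esub> g) w \<one>\<^bsub>G\<^esub>"

definition free_lift :: "('b, 'c) monoid_scheme \<Rightarrow> ('a \<Rightarrow> 'b) \<Rightarrow> 'a word set \<Rightarrow> 'b" where
  "free_lift G f C = eval_word G f (SOME w. w \<in> C)"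

context group
begin

lemma eval_word_simps [simp]:
  "eval_word G f [] = \<one>"
  "eval_word G f (l # w) = (if snd l then f (fst l) else inv f (fst l)) \<otimes> eval_word G f w"
  by (simp_all add: eval_word_def)

lemma eval_word_closed:
  assumes f: "f \<in> S \<rightarrow> carrier G" and w: "w \<in> words_over S"
  shows "eval_word G f w \<in> carrier G"
  using w
proof (induction w)
  case (Cons l w)
  then have "f (fst l) \<in> carrier G" using f by auto
  then show ?case using Cons.IH by simp
qed simp

lemma eval_word_append:
  assumes f: "f \<in> S \<rightarrow> carrier G" and u: "u \<in> words_over S" and v: "v \<in> words_over S"
  shows "eval_word G f (u @ v) = eval_word G f u \<otimes> eval_word G f v"
  using u
proof (induction u)
  case Nil
  then show ?case using eval_word_closed[OF f v] by simp
next
  case (Cons l u)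
  then have "f (fst l) \<in> carrier G" using f by auto
  moreover have "eval_word G f u \<in> carrier G" using Cons.hyps f by (intro eval_word_closed)
  ultimately show ?case
    using Cons.IH eval_word_closed[OF f v] by (simp add: m_assoc)
qed

lemma eval_word_cong:
  assumes f: "f \<in> S \<rightarrow> carrier G" and "(u, v) \<in> word_cong S {}"
  shows "eval_word G f u = eval_word G f v"
  using assms(2)
proof (induction rule: word_cong.induct)
  case (cancel u v a b)
  have fa: "f a \<in> carrier G" using f cancel(3) by auto
  have ev: "eval_word G f v \<in> carrier G" using f cancel(2) by (rule eval_word_closed)
  have "eval_word G f ([(a, b), (a, \<not> b)] @ v) = eval_word G f v"
    using fa ev by (cases b) (simp_all flip: m_assoc)
  moreover have "[(a, b), (a, \<not> b)] @ v \<in> words_over S"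
    using cancel by simp
  ultimately show ?case
    using cancel(1,2) by (simp only: eval_word_append[OF f])
qed simp_all

lemma free_lift_wcls:
  assumes f: "f \<in> S \<rightarrow> carrier G" and w: "w \<in> words_over S"
  shows "free_lift G f (wcls S {} w) = eval_word G f w"
proof -
  have "w \<in> wcls S {} w" using w by (simp add: word_cong.refl)
  then have "(SOME v. v \<in> wcls S {} w) \<in> wcls S {} w" by (rule someI)
  then show ?thesis using eval_word_cong[OF f] by (simp add: free_lift_def)
qed

lemma free_lift_hom:
  assumes f: "f \<in> S \<rightarrow> carrier G"
  shows "free_lift G f \<in> hom (free_group S) G"
  unfolding free_group_def
proof (rule homI)
  fix x assume "x \<in> carrier (presented_group S {})"
  then obtain u where u: "x = wcls S {} u" "u \<in> words_over S" unfolding carrier_presented_group ..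
  then show "free_lift G f x \<in> carrier G"
    by (simp only: free_lift_wcls[OF f] eval_word_closed[OF f])
  fix y assume "y \<in> carrier (presented_group S {})"
  then obtain v where v: "y = wcls S {} v" "v \<in> words_over S" unfolding carrier_presented_group ..
  have "u @ v \<in> words_over S" using u v by simp
  then show "free_lift G f (x \<otimes>\<^bsub>presented_group S {}\<^esub> y) = free_lift G f x \<otimes> free_lift G f y"
    using u(2) v(2) unfolding u(1) v(1)
    by (simp only: free_lift_wcls[OF f] presented_group_mult eval_word_append[OF f])
qed

end

section \<open>Actions of \<open>\<Gamma>\<^sub>m(q)\<close>\<close>

abbreviation Gamma_rels :: "nat \<Rightarrow> nat \<Rightarrow> (gen word \<times> gen word) set" where
  "Gamma_rels m q \<equiv> {(pow_word X (2 * m), []), (pow_word Y (q * m), []), (pow_word X 2, pow_word Y q)}"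

lemma group_Gamma: "group (Gamma m q)"
  unfolding Gamma_def by (rule group_presented_group)

definition gcls :: "nat \<Rightarrow> nat \<Rightarrow> gen word \<Rightarrow> gen word set" where
  "gcls m q w = wcls UNIV (Gamma_rels m q) w"

lemma words_over_UNIV [simp]: "words_over UNIV = UNIV"
  by auto

lemma carrier_Gamma: "carrier (Gamma m q) = range (gcls m q)"
  unfolding Gamma_def carrier_presented_group gcls_def words_over_UNIV ..

lemma gcls_closed [simp]: "gcls m q w \<in> carrier (Gamma m q)"
  by (simp add: carrier_Gamma)

lemma gcls_append: "gcls m q (u @ v) = gcls m q u \<otimes>\<^bsub>Gamma m q\<^esub> gcls m q v"
  unfolding gcls_def Gamma_def by (simp only: presented_group_mult words_over_UNIV UNIV_I)

lemma gcls_Nil: "gcls m q [] = \<one>\<^bsub>Gamma m q\<^esub>"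
  unfolding gcls_def Gamma_def by (simp only: one_presented_group)

lemma gcls_eq_iff: "gcls m q u = gcls m q v \<longleftrightarrow> (u, v) \<in> word_cong UNIV (Gamma_rels m q)"
  unfolding gcls_def by (rule wcls_eq_iff) (simp_all only: words_over_UNIV UNIV_I)

lemma gcls_inv: "gcls m q (word_inv w) = inv\<^bsub>Gamma m q\<^esub> gcls m q w"
proof -
  interpret group "Gamma m q" by (rule group_Gamma)
  have "(word_inv w @ w, []) \<in> word_cong UNIV (Gamma_rels m q)"
    unfolding word_inv_def by (rule inverse_word_cong) (simp only: words_over_UNIV UNIV_I)
  then have "gcls m q (word_inv w) \<otimes>\<^bsub>Gamma m q\<^esub> gcls m q w = \<one>\<^bsub>Gamma m q\<^esub>"
    unfolding gcls_append[symmetric] gcls_Nil[symmetric] gcls_eq_iff .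
  then show ?thesis by (rule inv_equality[symmetric]) simp_all
qed

lemma gcls_rels:
  "gcls m q (pow_word X (2 * m)) = \<one>\<^bsub>Gamma m q\<^esub>"
  "gcls m q (pow_word Y (q * m)) = \<one>\<^bsub>Gamma m q\<^esub>"
  "gcls m q (pow_word X 2) = gcls m q (pow_word Y q)"
proof -
  have "(l, r) \<in> word_cong UNIV (Gamma_rels m q)" if "(l, r) \<in> Gamma_rels m q" for l r
    using word_cong.relation[of "[]" UNIV "[]" l r "Gamma_rels m q"] that by simp
  then show "gcls m q (pow_word X (2 * m)) = \<one>\<^bsub>Gamma m q\<^esub>"
    "gcls m q (pow_word Y (q * m)) = \<one>\<^bsub>Gamma m q\<^esub>"
    "gcls m q (pow_word X 2) = gcls m q (pow_word Y q)"
    unfolding gcls_Nil[symmetric] gcls_eq_iff by blast+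
qed

lemma gcls_pow:
  "gcls m q (pow_word g i) = gcls m q [(g, True)] [^]\<^bsub>Gamma m q\<^esub> i"
proof -
  interpret group "Gamma m q" by (rule group_Gamma)
  show ?thesis
  proof (induction i)
    case (Suc i)
    have "gcls m q (pow_word g (Suc i)) = gcls m q (pow_word g i @ [(g, True)])"
      by (simp add: replicate_append_same)
    then show ?case unfolding gcls_append Suc by simp
  qed (simp add: gcls_Nil)
qed

definition Gamma_action :: "nat \<Rightarrow> nat \<Rightarrow> (gen \<Rightarrow> 'p \<Rightarrow> 'p) \<Rightarrow> bool" where
  "Gamma_action m q a \<longleftrightarrow> bijective a \<and> a X ^^ (2 * m) = id \<and> a Y ^^ (q * m) = id \<and> a X ^^ 2 = a Y ^^ q"

lemma Gamma_action_gcls: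
  assumes a: "Gamma_action m q a" and uv: "gcls m q u = gcls m q v"
  shows "word_act a u = word_act a v"
proof (rule word_act_word_cong[where R = "Gamma_rels m q"])
  show "bijective a" using a by (simp add: Gamma_action_def)
  have pw: "word_act a (pow_word g i) = a g ^^ i" for g i by (rule ext) (rule word_act_replicate)
  have nil: "word_act a [] = id" by (rule ext) simp
  show "word_act a l = word_act a r" if "(l, r) \<in> Gamma_rels m q" for l r
    using that a unfolding Gamma_action_def
    by (elim insertE emptyE) (simp_all only: prod.inject pw nil)
  show "(u, v) \<in> word_cong UNIV (Gamma_rels m q)" using uv by (simp only: gcls_eq_iff)
qed

lemma funpow_id_imp_bij:
  assumes "f ^^ k = id" "k > 0"
  shows "bij f"
proof (rule o_bij)
  show "f ^^ (k - 1) \<circ> f = id" using assms by (metis Suc_pred' funpow_Suc_right)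
  show "f \<circ> f ^^ (k - 1) = id" using assms by (metis Suc_pred' funpow.simps(2))
qed

lemma semireg_funpow_id:
  assumes "f \<in> semireg d A"
  shows "f ^^ d = id"
proof
  fix x
  show "(f ^^ d) x = id x"
    using semiregD(2)[OF assms, of x d] permutes_not_in[OF funpow_permutes[OF semiregD(1)[OF assms]], of x d]
    by (cases "x \<in> A") auto
qed

lemma Gamma_structs_action:
  assumes "a \<in> structs (Gamma_stabs m q) A"
  shows "Gamma_action m q a"
  using assms structsD(2)[OF assms] semireg_funpow_id
  unfolding Gamma_action_def Gamma_structs_iff by blast

section \<open>Point stabilisers of torsion-free representations are free\<close>

locale free_Gamma_set =
  fixes m q n :: nat and a :: "gen \<Rightarrow> nat \<Rightarrow> nat"
  assumes m: "m > 0" and q: "q > 0" and n: "n > 0"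
    and a: "a \<in> trans_structs (Gamma_stabs m q) {..<n}"
begin

abbreviation "\<Gamma> \<equiv> Gamma m q"
abbreviation "A \<equiv> {..<n}"
abbreviation "c \<equiv> gcls m q"
abbreviation gmult (infixl "\<cdot>" 70) where "g \<cdot> h \<equiv> g \<otimes>\<^bsub>\<Gamma>\<^esub> h"
abbreviation gone ("\<^bold>1") where "\<^bold>1 \<equiv> \<one>\<^bsub>\<Gamma>\<^esub>"
abbreviation "x \<equiv> c [(X, True)]"
abbreviation "y \<equiv> c [(Y, True)]"

sublocale group \<Gamma> by (rule group_Gamma)

lemma structs_a: "a \<in> structs (Gamma_stabs m q) A"
  using a by (rule trans_structsD(1))

lemma semireg_X: "a X \<in> semireg (2 * m) A" and semireg_Y: "a Y \<in> semireg (q * m) A"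
  and X2: "a X ^^ 2 = a Y ^^ q"
  using structs_a by (simp_all add: Gamma_structs_iff)

lemma act_in: "p \<in> A \<Longrightarrow> a g p \<in> A" "p \<in> A \<Longrightarrow> (a g ^^ i) p \<in> A"
  using permutes_in_image[OF structs_permutes[OF structs_a]]
    permutes_in_image[OF funpow_permutes[OF structs_permutes[OF structs_a]]] by blast+

lemma act_lt [simp]: "p < n \<Longrightarrow> a g p < n" "p < n \<Longrightarrow> (a g ^^ i) p < n"
  using act_in by simp_all

lemma zero_in: "0 \<in> A"
  using n by simp

lemma x2: "x \<cdot> x = y [^]\<^bsub>\<Gamma>\<^esub> q"
  using gcls_rels(3)[of m q] unfolding gcls_pow by (simp add: numeral_2_eq_2)

lemma y_order: "y [^]\<^bsub>\<Gamma>\<^esub> (q * m) = \<^bold>1"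
  using gcls_rels(2)[of m q] unfolding gcls_pow .

lemma y_pow_eq:
  assumes "i mod (q * m) = j mod (q * m)"
  shows "y [^]\<^bsub>\<Gamma>\<^esub> i = y [^]\<^bsub>\<Gamma>\<^esub> j"
proof -
  have *: "y [^]\<^bsub>\<Gamma>\<^esub> i = y [^]\<^bsub>\<Gamma>\<^esub> (i mod (q * m))" for i :: nat
  proof -
    have "y [^]\<^bsub>\<Gamma>\<^esub> (q * m * (i div (q * m)) + i mod (q * m))
        = (y [^]\<^bsub>\<Gamma>\<^esub> (q * m)) [^]\<^bsub>\<Gamma>\<^esub> (i div (q * m)) \<cdot> y [^]\<^bsub>\<Gamma>\<^esub> (i mod (q * m))"
      by (simp add: nat_pow_mult nat_pow_pow)
    then show ?thesis by (simp add: y_order)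
  qed
  show ?thesis using *[of i] *[of j] assms by simp
qed

section \<open>A section of the action along a spanning tree\<close>

inductive_set tree_reach :: "(nat \<Rightarrow> gen word set) \<Rightarrow> nat set \<Rightarrow> nat set"
  for \<tau> :: "nat \<Rightarrow> gen word set" and U :: "nat set" where
  base: "0 \<in> tree_reach \<tau> U"
| Y: "p \<in> tree_reach \<tau> U \<Longrightarrow> a Y p \<in> tree_reach \<tau> U"
| X: "p \<in> tree_reach \<tau> U \<Longrightarrow> a X p \<in> U \<Longrightarrow> \<tau> (a X p) = \<tau> p \<cdot> x \<Longrightarrow> a X p \<in> tree_reach \<tau> U"

text \<open>\<tau> selects group elements leading from 0 to the points of \<open>U\<close>,
  compatible with y everywhere and with x along tree edges. \<open>U\<close> consists of whole
  y-orbits, so the tree grows by one vertex of the graph at a time.\<close>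

definition partial_section :: "nat set \<Rightarrow> (nat \<Rightarrow> gen word set) \<Rightarrow> bool" where
  "partial_section U \<tau> \<longleftrightarrow> 0 \<in> U \<and> U \<subseteq> A \<and> \<tau> 0 = \<^bold>1 \<and> U \<subseteq> tree_reach \<tau> U \<and>
    (\<forall>p\<in>U. a Y p \<in> U \<and> \<tau> p \<in> carrier \<Gamma> \<and> \<tau> (a Y p) = \<tau> p \<cdot> y)"

lemma Y_orbit_section:
  assumes z: "z \<in> A" and g: "g \<in> carrier \<Gamma>"
  obtains \<sigma> where "\<sigma> z = g" "\<And>i. \<sigma> ((a Y ^^ i) z) \<in> carrier \<Gamma>"
    "\<And>i. \<sigma> (a Y ((a Y ^^ i) z)) = \<sigma> ((a Y ^^ i) z) \<cdot> y"
proof -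
  define e where "e p = (LEAST i. (a Y ^^ i) z = p)" for p
  define \<sigma> where "\<sigma> p = g \<cdot> y [^]\<^bsub>\<Gamma>\<^esub> e p" for p
  have \<sigma>: "\<sigma> ((a Y ^^ i) z) = g \<cdot> y [^]\<^bsub>\<Gamma>\<^esub> i" for i
  proof -
    have "(a Y ^^ e ((a Y ^^ i) z)) z = (a Y ^^ i) z"
      unfolding e_def by (rule LeastI[of _ i]) (rule HOL.refl)
    then have "y [^]\<^bsub>\<Gamma>\<^esub> e ((a Y ^^ i) z) = y [^]\<^bsub>\<Gamma>\<^esub> i"
      by (intro y_pow_eq) (simp only: semireg_eq_iff[OF semireg_Y z])
    then show ?thesis by (simp add: \<sigma>_def)
  qed
  show thesis
  proof (rule that[of \<sigma>])
    show "\<sigma> z = g" using \<sigma>[of 0] g by simp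
    show "\<sigma> ((a Y ^^ i) z) \<in> carrier \<Gamma>" for i using g by (simp add: \<sigma>)
    show "\<sigma> (a Y ((a Y ^^ i) z)) = \<sigma> ((a Y ^^ i) z) \<cdot> y" for i
      using \<sigma>[of i] \<sigma>[of "Suc i"] g by (simp add: m_assoc)
  qed
qed

lemma Y_orbit_reach: "p \<in> tree_reach \<tau> U \<Longrightarrow> (a Y ^^ i) p \<in> tree_reach \<tau> U"
  by (induction i) (simp_all add: tree_reach.Y)

lemma ex_partial_section: "\<exists>U \<tau>. partial_section U \<tau>"
proof -
  obtain \<sigma> where \<sigma>: "\<sigma> 0 = \<^bold>1" "\<And>i. \<sigma> ((a Y ^^ i) 0) \<in> carrier \<Gamma>"
    "\<And>i. \<sigma> (a Y ((a Y ^^ i) 0)) = \<sigma> ((a Y ^^ i) 0) \<cdot> y"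
    using Y_orbit_section[OF zero_in one_closed] by blast
  let ?U = "range (\<lambda>i. (a Y ^^ i) 0)"
  have "0 \<in> ?U" by (rule image_eqI[of _ _ 0]) simp_all
  moreover have "?U \<subseteq> A" using n by auto
  moreover have "?U \<subseteq> tree_reach \<sigma> ?U" using Y_orbit_reach[OF tree_reach.base] by blast
  moreover have "a Y ((a Y ^^ i) 0) \<in> ?U" for i by (rule image_eqI[of _ _ "Suc i"]) simp_all
  ultimately have "partial_section ?U \<sigma>" unfolding partial_section_def using \<sigma> by auto
  then show ?thesis by blast
qed

text \<open>The y-orbit of z = x p is a new vertex of the graph. Giving z the value \<tau> p x makes
  the edge at p a tree edge, and the rest of the orbit is then determined by y.\<close>

lemma extend_partial_section:
  assumes U: "partial_section U \<tau>" and p: "p \<in> U" "a X p \<notin> U"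
  shows "\<exists>U' \<tau>'. partial_section U' \<tau>' \<and> U \<subset> U'"
proof -
  have U0: "0 \<in> U" and UA: "U \<subseteq> A" and \<tau>0: "\<tau> 0 = \<^bold>1" and UR: "U \<subseteq> tree_reach \<tau> U"
    and UY: "\<And>p. p \<in> U \<Longrightarrow> a Y p \<in> U" and Uc: "\<And>p. p \<in> U \<Longrightarrow> \<tau> p \<in> carrier \<Gamma>"
    and Ue: "\<And>p. p \<in> U \<Longrightarrow> \<tau> (a Y p) = \<tau> p \<cdot> y"
    using U unfolding partial_section_def by auto
  define z where "z = a X p"
  have z: "z \<in> A" "z \<notin> U"
    using act_in(1)[OF subsetD[OF UA p(1)]] p(2) unfolding z_def by simp_all
  have \<tau>p: "\<tau> p \<in> carrier \<Gamma>" using Uc p(1) .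
  obtain \<sigma> where \<sigma>: "\<sigma> z = \<tau> p \<cdot> x" "\<And>i. \<sigma> ((a Y ^^ i) z) \<in> carrier \<Gamma>"
    "\<And>i. \<sigma> (a Y ((a Y ^^ i) z)) = \<sigma> ((a Y ^^ i) z) \<cdot> y"
    using Y_orbit_section[OF z(1) m_closed[OF \<tau>p gcls_closed]] by blast
  let ?O = "range (\<lambda>i. (a Y ^^ i) z)"
  have powU: "(a Y ^^ i) u \<in> U" if "u \<in> U" for u i using that UY by (induction i) auto
  have disj: "(a Y ^^ i) z \<notin> U" for i
  proof
    assume "(a Y ^^ i) z \<in> U"
    \<comment> \<open>These additional steps complete i full turns, so z itself would lie in
      \<open>U\<close>.\<close>
    then have "(a Y ^^ (i * (q * m - 1))) ((a Y ^^ i) z) \<in> U" by (rule powU)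
    also have "(a Y ^^ (i * (q * m - 1))) ((a Y ^^ i) z) = (a Y ^^ (i * (q * m - 1) + i)) z"
      by (simp add: funpow_add)
    also have "i * (q * m - 1) + i = q * m * i"
      using m q by (cases "q * m") (auto simp: algebra_simps)
    also have "(a Y ^^ (q * m * i)) z = z" using semiregD(2)[OF semireg_Y z(1)] by simp
    finally show False using z(2) by simp
  qed
  define \<tau>' where "\<tau>' u = (if u \<in> U then \<tau> u else \<sigma> u)" for u
  have \<tau>'O: "\<tau>' ((a Y ^^ i) z) = \<sigma> ((a Y ^^ i) z)" for i using disj by (simp add: \<tau>'_def)
  have zO: "z \<in> ?O" by (rule image_eqI[of _ _ 0]) simp_all
  have reach: "u \<in> tree_reach \<tau>' (U \<union> ?O)" if "u \<in> U" for u
  proof -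
    have "u \<in> tree_reach \<tau> U" using that UR by blast
    then have "u \<in> U \<and> u \<in> tree_reach \<tau>' (U \<union> ?O)"
    proof induction
      case base
      then show ?case using U0 by (simp add: tree_reach.base)
    next
      case (Y p)
      then show ?case using UY by (simp add: tree_reach.Y)
    next
      case (X p)
      then have "\<tau>' (a X p) = \<tau>' p \<cdot> x" by (simp add: \<tau>'_def)
      then show ?case using X by (simp add: tree_reach.X)
    qed
    then show ?thesis by simp
  qed
  have "\<tau>' (a X p) = \<tau>' p \<cdot> x" using p \<sigma>(1) z(2) by (simp add: \<tau>'_def z_def)
  then have "z \<in> tree_reach \<tau>' (U \<union> ?O)"
    using tree_reach.X[OF reach[OF p(1)]] zO unfolding z_def by blast
  then have "?O \<subseteq> tree_reach \<tau>' (U \<union> ?O)" using Y_orbit_reach by blast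
  moreover have "a Y ((a Y ^^ i) z) = (a Y ^^ Suc i) z" for i by simp
  then have "a Y ((a Y ^^ i) z) \<in> ?O" for i by (metis rangeI)
  moreover have "\<tau>' (a Y ((a Y ^^ i) z)) = \<tau>' ((a Y ^^ i) z) \<cdot> y" for i
    using \<tau>'O[of i] \<tau>'O[of "Suc i"] \<sigma>(3)[of i] by simp
  moreover have "\<tau>' ((a Y ^^ i) z) \<in> carrier \<Gamma>" for i using \<tau>'O \<sigma>(2) by simp
  moreover have "?O \<subseteq> A" using act_in(2)[OF z(1)] by blast
  moreover have "\<tau>' u = \<tau> u" if "u \<in> U" for u using that by (simp add: \<tau>'_def)
  ultimately have "partial_section (U \<union> ?O) \<tau>'"
    unfolding partial_section_def using U0 UA \<tau>0 reach UY Uc Ue by auto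
  moreover have "U \<subset> U \<union> ?O" using zO z(2) by blast
  ultimately show ?thesis by blast
qed

text \<open>Transitivity also uses inverse letters, but on a finite set an injective self-map is
  surjective, so closure under the generators suffices.\<close>

lemma closed_imp_full:
  assumes U: "0 \<in> U" "U \<subseteq> A" "\<And>g p. p \<in> U \<Longrightarrow> a g p \<in> U"
  shows "U = A"
proof -
  have bij: "bijective a" using structsD(2)[OF structs_a] .
  have "finite U" using U(2) by (rule finite_subset) simp
  then have "a g ` U = U" for g
    using U(3) bij_is_inj[OF bijectiveD[OF bij]]
    by (intro endo_inj_surj) (auto intro: inj_on_subset)
  then have perm: "perm_rep (restrict_perm U a) U"
    unfolding perm_rep_def by (intro allI restrict_perm_permutes bijectiveD[OF bij])
  have "word_act a w 0 \<in> U" for w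
    using word_act_agree[OF perm bij _ U(1), of w] by (auto simp: restrict_perm_def)
  moreover have "A = orb a 0" using trans_structsD(2)[OF a zero_in] by simp
  ultimately have "A \<subseteq> U" by (auto elim!: orbE)
  with U(2) show ?thesis by blast
qed

lemma ex_section: "\<exists>\<tau>. partial_section A \<tau>"
proof -
  let ?P = "{U. \<exists>\<tau>. partial_section U \<tau>}"
  have "finite ?P" by (rule finite_subset[of _ "Pow A"]) (auto simp: partial_section_def)
  moreover have "?P \<noteq> {}" using ex_partial_section by blast
  ultimately obtain U where U: "U \<in> ?P" "\<And>V. V \<in> ?P \<Longrightarrow> U \<subseteq> V \<Longrightarrow> U = V"
    using finite_has_maximal by (metis (no_types, lifting))
  from U(1) obtain \<tau> where \<tau>: "partial_section U \<tau>" by blast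
  have "a X p \<in> U" if "p \<in> U" for p
    using extend_partial_section[OF \<tau> that] U(2) by blast
  moreover have "a Y p \<in> U" if "p \<in> U" for p using \<tau> that by (simp add: partial_section_def)
  ultimately have "a g p \<in> U" if "p \<in> U" for g p using that by (cases g) auto
  then have "U = A" using \<tau> by (intro closed_imp_full) (auto simp: partial_section_def)
  with \<tau> show ?thesis by blast
qed

end

context free_Gamma_set
begin

section \<open>Edges outside the tree, their orientation and their labels\<close>

definition \<tau> :: "nat \<Rightarrow> gen word set" where
  "\<tau> = (SOME \<tau>. partial_section A \<tau>)"

lemma section_\<tau>: "partial_section A \<tau>"
  unfolding \<tau>_def using ex_section by (rule someI_ex)

lemma \<tau>_0: "\<tau> 0 = \<^bold>1"
  and \<tau>_closed [simp]: "p < n \<Longrightarrow> \<tau> p \<in> carrier \<Gamma>"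
  and \<tau>_Y: "p < n \<Longrightarrow> \<tau> (a Y p) = \<tau> p \<cdot> y"
  and reach_\<tau>: "p < n \<Longrightarrow> p \<in> tree_reach \<tau> A"
  using section_\<tau> unfolding partial_section_def by auto

lemma \<tau>_Y_pow: "p < n \<Longrightarrow> \<tau> ((a Y ^^ i) p) = \<tau> p \<cdot> y [^]\<^bsub>\<Gamma>\<^esub> i"
  by (induction i) (simp_all add: \<tau>_Y m_assoc)

lemma \<tau>_XX:
  assumes "p < n"
  shows "\<tau> (a X (a X p)) = \<tau> p \<cdot> (x \<cdot> x)"
proof -
  have "a X (a X p) = (a X ^^ 2) p" by (simp add: numeral_2_eq_2)
  then show ?thesis using \<tau>_Y_pow[OF assms, of q] by (simp add: X2 x2)
qed

definition tree :: "nat \<Rightarrow> bool" where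
  "tree p \<longleftrightarrow> \<tau> (a X p) = \<tau> p \<cdot> x"

text \<open>Membership in the tree is a property of the whole x-orbit, that is, of the edge: x^2
  equals y^q, and \<tau> is compatible with y.\<close>

lemma tree_X: "p < n \<Longrightarrow> tree (a X p) \<longleftrightarrow> tree p"
  by (auto simp: tree_def \<tau>_XX simp flip: m_assoc)

lemma tree_X_pow: "p < n \<Longrightarrow> tree ((a X ^^ i) p) \<longleftrightarrow> tree p"
  by (induction i) (simp_all add: tree_X)

text \<open>The complement of the tree consists of \<open>x\<close>-orbits, each of which gives one basis element. It
  is named by the value of \<open>\<tau>\<close> at the least point of the orbit, and the parity of the distance to
  this point orients the orbit.\<close>
definition rep :: "nat \<Rightarrow> nat" where
  "rep p = (LEAST z. \<exists>i. (a X ^^ i) p = z)"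

definition pos :: "nat \<Rightarrow> bool" where
  "pos p \<longleftrightarrow> (\<exists>i. even i \<and> (a X ^^ i) p = rep p)"

lemma rep_ex: "\<exists>i. (a X ^^ i) p = rep p"
  unfolding rep_def by (rule LeastI_ex) blast

lemma rep_lt: "p < n \<Longrightarrow> rep p < n"
  using rep_ex[of p] act_lt(2) by metis

text \<open>The x-cycles have the even length 2m, so parity along them is well defined; even steps
  are powers of y^q and stay at one end of the edge.\<close>

lemma X_pow_eq_parity:
  assumes "p < n" "(a X ^^ i) p = (a X ^^ j) p"
  shows "even i \<longleftrightarrow> even j"
proof -
  have "i mod (2 * m) = j mod (2 * m)"
    using assms semireg_eq_iff[OF semireg_X] by simp
  moreover have "even k \<longleftrightarrow> even (k mod (2 * m))" for k :: nat
    by (simp add: dvd_mod_iff)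
  ultimately show ?thesis by metis
qed

lemma rep_X:
  assumes p: "p < n"
  shows "rep (a X p) = rep p"
proof -
  have "(\<exists>i. (a X ^^ i) (a X p) = z) \<longleftrightarrow> (\<exists>i. (a X ^^ i) p = z)" for z
  proof
    assume "\<exists>i. (a X ^^ i) (a X p) = z"
    then obtain i where "(a X ^^ i) (a X p) = z" ..
    then have "(a X ^^ Suc i) p = z" by (simp only: funpow_Suc_right o_apply)
    then show "\<exists>i. (a X ^^ i) p = z" ..
  next
    assume "\<exists>i. (a X ^^ i) p = z"
    then obtain i where i: "(a X ^^ i) p = z" ..
    have "(a X ^^ (i + (2 * m - 1))) (a X p) = (a X ^^ (i + 2 * m)) p"
      using m by (simp flip: funpow_Suc_right[THEN fun_cong, unfolded o_apply] del: funpow.simps(2))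
    also have "\<dots> = (a X ^^ i) p"
      using semireg_eq_iff[OF semireg_X, of p "i + 2 * m" i] p by simp
    finally show "\<exists>i. (a X ^^ i) (a X p) = z" using i by blast
  qed
  then show ?thesis by (simp add: rep_def)
qed

lemma rep_X_pow: "p < n \<Longrightarrow> rep ((a X ^^ i) p) = rep p"
  by (induction i) (simp_all add: rep_X)

lemma rep_rep: "p < n \<Longrightarrow> rep (rep p) = rep p"
  using rep_ex[of p] rep_X_pow by metis

lemma pos_rep: "p < n \<Longrightarrow> pos (rep p)"
  unfolding pos_def using rep_rep by (intro exI[of _ 0]) simp

lemma pos_X:
  assumes p: "p < n"
  shows "pos (a X p) \<longleftrightarrow> \<not> pos p"
proof
  assume "pos (a X p)"
  then obtain i where i: "even i" "(a X ^^ Suc i) p = rep p"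
    unfolding pos_def rep_X[OF p] by (auto simp: funpow_swap1)
  show "\<not> pos p"
  proof
    assume "pos p"
    then obtain j where "even j" "(a X ^^ j) p = rep p" unfolding pos_def by blast
    then show False using i X_pow_eq_parity[OF p, of "Suc i" j] by auto
  qed
next
  assume np: "\<not> pos p"
  obtain i where i: "(a X ^^ i) p = rep p" using rep_ex by blast
  then have "odd i" using np unfolding pos_def by blast
  then obtain k where k: "i = Suc k" "even k" by (cases i) auto
  then have "(a X ^^ k) (a X p) = rep p" using i by (simp add: funpow_swap1)
  then show "pos (a X p)" using k unfolding pos_def rep_X[OF p] by blast
qed

text \<open>A set of names only. They lie in the element type of \<open>\<Gamma>\<close> because
  \<open>is_free_group\<close> takes its generators from there; the elements that they stand for are
  given by \<open>basis_val\<close>.\<close>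

definition basis :: "gen word set set" where
  "basis = {\<tau> (rep p) | p. p < n \<and> \<not> tree p}"

abbreviation "F \<equiv> free_group basis"
abbreviation "fc \<equiv> wcls basis {}"
abbreviation fmult (infixl "\<bullet>" 70) where "g \<bullet> h \<equiv> g \<otimes>\<^bsub>F\<^esub> h"
abbreviation fone ("\<^bold>1\<^sub>F") where "\<^bold>1\<^sub>F \<equiv> \<one>\<^bsub>F\<^esub>"

lemma group_F: "group F" by (rule group_free_group)

lemma carrier_F: "carrier F = fc ` words_over basis"
  unfolding free_group_def by (rule carrier_presented_group)

lemma one_F: "\<^bold>1\<^sub>F = fc []"
  unfolding free_group_def by (rule one_presented_group)

lemma mult_F: "u \<in> words_over basis \<Longrightarrow> v \<in> words_over basis \<Longrightarrow> fc u \<bullet> fc v = fc (u @ v)"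
  unfolding free_group_def by (rule presented_group_mult)

definition edge_word :: "nat \<Rightarrow> gen word set word" where
  "edge_word p = (if tree p then [] else [(\<tau> (rep p), pos p)])"

definition edge :: "nat \<Rightarrow> gen word set word set" where
  "edge p = fc (edge_word p)"

lemma edge_word_closed: "p < n \<Longrightarrow> edge_word p \<in> words_over basis"
  by (auto simp: edge_word_def basis_def)

lemma edge_closed: "p < n \<Longrightarrow> edge p \<in> carrier F"
  unfolding edge_def carrier_F by (intro imageI edge_word_closed)

text \<open>Two x-steps run along an edge and back, so their labels cancel. This is what makes the
  relation x^2 = y^q survive in the lifted action.\<close>

lemma edge_X:
  assumes p: "p < n"
  shows "edge p \<bullet> edge (a X p) = \<^bold>1\<^sub>F"
proof -
  have "edge p \<bullet> edge (a X p) = fc (edge_word p @ edge_word (a X p))"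
    unfolding edge_def using p by (intro mult_F edge_word_closed) simp_all
  also have "\<dots> = \<^bold>1\<^sub>F"
  proof (cases "tree p")
    case True
    then show ?thesis using p by (simp add: edge_word_def tree_X one_F)
  next
    case False
    then have s: "\<tau> (rep p) \<in> basis" using p by (auto simp: basis_def)
    then have "([] @ [(\<tau> (rep p), pos p), (\<tau> (rep p), \<not> pos p)] @ [], [] @ []) \<in> word_cong basis {}"
      by (intro word_cong.cancel) auto
    then have "fc [(\<tau> (rep p), pos p), (\<tau> (rep p), \<not> pos p)] = fc []"
      by (intro equiv_class_eq[OF equiv_word_cong]) simp
    then show ?thesis using False p by (simp add: edge_word_def tree_X rep_X pos_X one_F)
  qed
  finally show ?thesis .
qed

text \<open>The action on the universal covering of the graph, built to show that
  \<open>\<psi>\<close> is injective: the second coordinate reads the free element off a word.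
  Outside the covering it is the identity, so that it permutes the whole type.\<close>

definition ext :: "gen \<Rightarrow> nat \<times> gen word set word set \<Rightarrow> nat \<times> gen word set word set" where
  "ext g pt = (if fst pt < n \<and> snd pt \<in> carrier F
    then (a g (fst pt), case g of X \<Rightarrow> snd pt \<bullet> edge (fst pt) | Y \<Rightarrow> snd pt) else pt)"

lemma ext_X: "p < n \<Longrightarrow> h \<in> carrier F \<Longrightarrow> ext X (p, h) = (a X p, h \<bullet> edge p)"
  and ext_Y: "p < n \<Longrightarrow> h \<in> carrier F \<Longrightarrow> ext Y (p, h) = (a Y p, h)"
  by (simp_all add: ext_def)

lemma ext_outside: "\<not> (fst pt < n \<and> snd pt \<in> carrier F) \<Longrightarrow> (ext g ^^ i) pt = pt"
  by (induction i) (auto simp: ext_def)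

lemma ext_XX:
  assumes "p < n" "h \<in> carrier F"
  shows "ext X (ext X (p, h)) = (a X (a X p), h)"
proof -
  interpret F: group F by (rule group_F)
  show ?thesis
    using assms edge_closed by (simp add: ext_X F.m_assoc edge_X)
qed

lemma ext_X_pow:
  assumes "p < n" "h \<in> carrier F"
  shows "(ext X ^^ (2 * i)) (p, h) = ((a X ^^ (2 * i)) p, h)"
  using assms by (induction i) (simp_all add: ext_XX)

lemma ext_Y_pow:
  assumes "p < n" "h \<in> carrier F"
  shows "(ext Y ^^ i) (p, h) = ((a Y ^^ i) p, h)"
  using assms by (induction i) (simp_all add: ext_Y)

text \<open>Neither y nor x^2 changes the second coordinate, so the relations are inherited from
  \<open>a\<close>. Bijectivity follows from the finite orders of both generators.\<close>

lemma ext_action: "Gamma_action m q ext"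
proof -
  have eqI: "ext g ^^ i = ext g' ^^ j"
    if "\<And>p h. p < n \<Longrightarrow> h \<in> carrier F \<Longrightarrow> (ext g ^^ i) (p, h) = (ext g' ^^ j) (p, h)" for g g' i j
  proof
    fix pt :: "nat \<times> gen word set word set"
    show "(ext g ^^ i) pt = (ext g' ^^ j) pt"
      using that[of "fst pt" "snd pt"] ext_outside[of pt]
      by (cases "fst pt < n \<and> snd pt \<in> carrier F") auto
  qed
  have X: "ext X ^^ (2 * m) = ext X ^^ 0"
    using ext_X_pow[of _ _ m] semiregD(2)[OF semireg_X] by (intro eqI) simp
  have Y: "ext Y ^^ (q * m) = ext Y ^^ 0"
    using ext_Y_pow[of _ _ "q * m"] semiregD(2)[OF semireg_Y] by (intro eqI) simp
  have XY: "ext X ^^ 2 = ext Y ^^ q"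
    using ext_X_pow[of _ _ 1] ext_Y_pow[of _ _ q] by (intro eqI) (simp add: X2)
  have "bij (ext X)" by (rule funpow_id_imp_bij[where k = "2 * m"]) (use X m in \<open>simp_all add: id_def\<close>)
  moreover have "bij (ext Y)"
    by (rule funpow_id_imp_bij[where k = "q * m"]) (use Y m q in \<open>simp_all add: id_def\<close>)
  ultimately have "bijective ext" by (simp add: bijective_def all_gen)
  then show ?thesis unfolding Gamma_action_def using X Y XY by simp
qed

lemma ext_bijective: "bijective ext"
  using ext_action by (simp add: Gamma_action_def)

lemma a_bijective: "bijective a"
  using structsD(2)[OF structs_a] .

lemma ext_in: "p < n \<Longrightarrow> h \<in> carrier F \<Longrightarrow> fst (ext g (p, h)) < n \<and> snd (ext g (p, h)) \<in> carrier F"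
proof -
  assume "p < n" "h \<in> carrier F"
  interpret F: group F by (rule group_F)
  show ?thesis using \<open>p < n\<close> \<open>h \<in> carrier F\<close> edge_closed by (cases g) (simp_all add: ext_X ext_Y)
qed

lemma ext_letter_backwards:
  assumes "p < n" "h \<in> carrier F"
  shows "\<exists>p' h'. letter_act ext (g, False) (p, h) = (p', h') \<and> p' < n \<and> h' \<in> carrier F
    \<and> ext g (p', h') = (p, h)"
proof -
  define pt where "pt = letter_act ext (g, False) (p, h)"
  have pt: "ext g pt = (p, h)"
    using letter_act_cancel[of ext g False "(p, h)"] bijectiveD[OF ext_bijective]
    by (simp add: pt_def)
  have "fst pt < n \<and> snd pt \<in> carrier F"
  proof (rule ccontr)
    assume *: "\<not> (fst pt < n \<and> snd pt \<in> carrier F)"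
    then have "ext g pt = pt" using ext_outside[of pt 1 g] by simp
    with pt * assms show False by simp
  qed
  with pt show ?thesis unfolding pt_def[symmetric] by (metis prod.collapse)
qed

text \<open>Tree edges have trivial labels, so a path inside the tree lifts to every sheet without
  changing the second coordinate.\<close>

lemma tree_path:
  assumes "p < n"
  obtains w where "c w = \<tau> p" "\<forall>h\<in>carrier F. word_act ext w (0, h) = (p, h)"
    "word_act a w 0 = p"
proof -
  interpret F: group F by (rule group_F)
  have "p < n \<and> (\<exists>w. c w = \<tau> p \<and> (\<forall>h\<in>carrier F. word_act ext w (0, h) = (p, h)) \<and> word_act a w 0 = p)"
    using reach_\<tau>[OF assms]
  proof induction
    case base
    then show ?case using n by (auto intro!: exI[of _ "[]"] simp: gcls_Nil \<tau>_0)
  next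
    case (Y p)
    then obtain w where w: "p < n" "c w = \<tau> p" "\<forall>h\<in>carrier F. word_act ext w (0, h) = (p, h)"
      "word_act a w 0 = p" by blast
    then have "c (w @ [(Y, True)]) = \<tau> (a Y p)" by (simp add: gcls_append \<tau>_Y)
    moreover have "\<forall>h\<in>carrier F. word_act ext (w @ [(Y, True)]) (0, h) = (a Y p, h)"
      using w by (simp add: ext_Y)
    moreover have "word_act a (w @ [(Y, True)]) 0 = a Y p" using w by simp
    ultimately show ?case using w(1) act_lt(1) by blast
  next
    case (X p)
    then obtain w where w: "p < n" "c w = \<tau> p" "\<forall>h\<in>carrier F. word_act ext w (0, h) = (p, h)"
      "word_act a w 0 = p" by blast
    have "tree p" using X.hyps by (simp add: tree_def)
    then have e: "edge p = \<^bold>1\<^sub>F" by (simp add: edge_def edge_word_def one_F)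
    have "c (w @ [(X, True)]) = \<tau> (a X p)" using w X.hyps by (simp add: gcls_append)
    moreover have "\<forall>h\<in>carrier F. word_act ext (w @ [(X, True)]) (0, h) = (a X p, h)"
      using w by (simp add: ext_X e)
    moreover have "word_act a (w @ [(X, True)]) 0 = a X p" using w by simp
    ultimately show ?case using w(1) act_lt(1) by blast
  qed
  with that show thesis by blast
qed

text \<open>A word for \<tau> p moves 0 to p, so p can be read off; different edges therefore have
  different names in \<open>basis\<close>.\<close>

lemma inj_\<tau>: "inj_on \<tau> A"
proof (rule inj_onI)
  fix p p' assume "p \<in> A" "p' \<in> A" and eq: "\<tau> p = \<tau> p'"
  then have pn: "p < n" "p' < n" by auto
  obtain w where w: "c w = \<tau> p" "\<forall>h\<in>carrier F. word_act ext w (0, h) = (p, h)"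
    "word_act a w 0 = p" by (rule tree_path[OF pn(1)])
  obtain w' where w': "c w' = \<tau> p'" "\<forall>h\<in>carrier F. word_act ext w' (0, h) = (p', h)"
    "word_act a w' 0 = p'" by (rule tree_path[OF pn(2)])
  have "word_act a w = word_act a w'"
    using Gamma_action_gcls[OF Gamma_structs_action[OF structs_a]] w(1) w'(1) eq by simp
  then show "p = p'" using w(3) w'(3) by simp
qed

section \<open>Schreier generators and the homomorphism from the free group\<close>

definition edge_val :: "nat \<Rightarrow> gen word set" where
  "edge_val p = \<tau> p \<cdot> x \<cdot> inv\<^bsub>\<Gamma>\<^esub> \<tau> (a X p)"

lemma edge_val_closed: "p < n \<Longrightarrow> edge_val p \<in> carrier \<Gamma>"
  by (simp add: edge_val_def)

lemma edge_val_X: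
  assumes p: "p < n"
  shows "edge_val (a X p) = inv\<^bsub>\<Gamma>\<^esub> edge_val p"
proof -
  have "edge_val (a X p) = \<tau> (a X p) \<cdot> x \<cdot> inv\<^bsub>\<Gamma>\<^esub> (\<tau> p \<cdot> (x \<cdot> x))"
    using p by (simp add: edge_val_def \<tau>_XX)
  also have "\<dots> = \<tau> (a X p) \<cdot> (inv\<^bsub>\<Gamma>\<^esub> x \<cdot> inv\<^bsub>\<Gamma>\<^esub> \<tau> p)"
    using p by (simp add: inv_mult_group m_assoc) (simp flip: m_assoc)
  also have "\<dots> = inv\<^bsub>\<Gamma>\<^esub> edge_val p"
    using p by (simp add: edge_val_def inv_mult_group m_assoc)
  finally show ?thesis .
qed

lemma edge_val_X_pow:
  "p < n \<Longrightarrow> edge_val ((a X ^^ i) p) = (if even i then edge_val p else inv\<^bsub>\<Gamma>\<^esub> edge_val p)"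
  by (induction i) (simp_all add: edge_val_X edge_val_closed)

definition basis_val :: "gen word set \<Rightarrow> gen word set" where
  "basis_val s = edge_val (inv_into A \<tau> s)"

lemma basis_val_\<tau>: "p < n \<Longrightarrow> basis_val (\<tau> p) = edge_val p"
  using inj_\<tau> by (simp add: basis_val_def inv_into_f_f)

lemma basis_val_closed: "basis_val \<in> basis \<rightarrow> carrier \<Gamma>"
  by (auto simp: basis_def basis_val_\<tau> rep_lt edge_val_closed)

abbreviation "\<psi> \<equiv> free_lift \<Gamma> basis_val"

lemma \<psi>_fc: "w \<in> words_over basis \<Longrightarrow> \<psi> (fc w) = eval_word \<Gamma> basis_val w"
  by (rule free_lift_wcls[OF basis_val_closed])

lemma \<psi>_hom: "\<psi> \<in> hom F \<Gamma>"
  by (rule free_lift_hom[OF basis_val_closed])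

lemma \<psi>_closed: "h \<in> carrier F \<Longrightarrow> \<psi> h \<in> carrier \<Gamma>"
  using \<psi>_hom by (rule hom_in_carrier)

lemma \<psi>_edge:
  assumes p: "p < n"
  shows "\<psi> (edge p) = edge_val p"
proof (cases "tree p")
  case True
  then have "edge_val p = \<^bold>1" using p by (simp add: edge_val_def tree_def)
  then show ?thesis using True edge_word_closed[OF p] by (simp add: edge_def \<psi>_fc edge_word_def)
next
  case False
  obtain i where i: "(a X ^^ i) p = rep p" using rep_ex by blast
  have pos: "pos p \<longleftrightarrow> even i"
  proof
    assume "pos p"
    then obtain j where "even j" "(a X ^^ j) p = rep p" unfolding pos_def by blast
    then show "even i" using X_pow_eq_parity[OF p, of i j] i by simp
  qed (use i in \<open>auto simp: pos_def\<close>)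
  have "basis_val (\<tau> (rep p)) = (if pos p then edge_val p else inv\<^bsub>\<Gamma>\<^esub> edge_val p)"
    using edge_val_X_pow[OF p, of i] rep_lt[OF p] by (simp add: i pos basis_val_\<tau>)
  then show ?thesis
    using False edge_word_closed[OF p] edge_val_closed[OF p] by (simp add: edge_def \<psi>_fc edge_word_def)
qed

text \<open>The Schreier generator \<open>edge_val\<close> is exactly the correction under which (p,
  h) -> \<open>\<psi> h \<cdot> \<tau> p\<close> turns the lifted action into right
  multiplication.\<close>

lemma \<psi>_ext:
  assumes "p < n" "h \<in> carrier F"
  shows "\<psi> (snd (ext g (p, h))) \<cdot> \<tau> (fst (ext g (p, h)))
    = \<psi> h \<cdot> \<tau> p \<cdot> c [(g, True)]"
proof (cases g)
  case X
  have "\<psi> (h \<bullet> edge p) = \<psi> h \<cdot> edge_val p"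
    using hom_mult[OF \<psi>_hom assms(2) edge_closed[OF assms(1)]] by (simp add: \<psi>_edge[OF assms(1)])
  then show ?thesis
    using assms X \<psi>_closed by (simp add: ext_X edge_val_def m_assoc)
next
  case Y
  then show ?thesis using assms \<psi>_closed by (simp add: ext_Y \<tau>_Y m_assoc)
qed

text \<open>Used with words fixing 0: there p = 0 and \<tau> p is trivial, so the element of the
  word is \<open>\<psi> h\<close>. This gives surjectivity onto the stabiliser.\<close>

lemma word_act_ext:
  "\<exists>p h. word_act ext w (0, \<^bold>1\<^sub>F) = (p, h) \<and> p < n \<and> h \<in> carrier F
    \<and> \<psi> h \<cdot> \<tau> p = c w \<and> word_act a w 0 = p"
proof (induction w rule: rev_induct)
  case Nil
  interpret F: group F by (rule group_F)
  have "\<psi> \<^bold>1\<^sub>F = \<^bold>1" using \<psi>_fc[of "[]"] by (simp add: one_F)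
  then show ?case using n by (simp add: \<tau>_0 gcls_Nil)
next
  case (snoc l w)
  then obtain p h where ph: "word_act ext w (0, \<^bold>1\<^sub>F) = (p, h)" "p < n" "h \<in> carrier F"
    "\<psi> h \<cdot> \<tau> p = c w" "word_act a w 0 = p" by blast
  obtain g b where l: "l = (g, b)" by (cases l)
  have fst_ext: "fst (ext g (p, h)) = a g p" if "p < n" "h \<in> carrier F" for p h
    using that by (simp add: ext_def)
  show ?case
  proof (cases b)
    case True
    obtain p' h' where e: "ext g (p, h) = (p', h')" by (cases "ext g (p, h)")
    have in': "p' < n" "h' \<in> carrier F" using ext_in[OF ph(2,3), of g] e by auto
    have "\<psi> h' \<cdot> \<tau> p' = c (w @ [l])"
      using \<psi>_ext[OF ph(2,3), of g] e ph(4) l True by (simp add: gcls_append)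
    moreover have "word_act a (w @ [l]) 0 = p'" using fst_ext[OF ph(2,3)] e ph(5) l True by simp
    ultimately show ?thesis using in' ph(1) e l True by simp
  next
    case False
    obtain p' h' where e: "letter_act ext (g, False) (p, h) = (p', h')" "p' < n" "h' \<in> carrier F"
      "ext g (p', h') = (p, h)" using ext_letter_backwards[OF ph(2,3)] by blast
    have "\<psi> h' \<cdot> \<tau> p' \<cdot> c [(g, True)] = c w"
      using \<psi>_ext[OF e(2,3), of g] ph(4) by (simp add: e(4))
    moreover have "c (w @ [l]) = c w \<cdot> inv\<^bsub>\<Gamma>\<^esub> c [(g, True)]"
      using gcls_inv[of m q "[(g, True)]"] by (simp add: gcls_append l False)
    ultimately have "\<psi> h' \<cdot> \<tau> p' = c (w @ [l])"
      using \<psi>_closed[OF e(3)] e(2) by (metis gcls_closed inv_solve_right m_closed \<tau>_closed)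
    moreover have "a g p' = p" using fst_ext[OF e(2,3)] e(4) by simp
    then have "fun_inv (a g) p = p'" using bij_is_inj[OF bijectiveD[OF a_bijective]] by auto
    then have "word_act a (w @ [l]) 0 = p'" using ph(5) l False by simp
    moreover have "word_act ext (w @ [l]) (0, \<^bold>1\<^sub>F) = (p', h')" using e(1) ph(1) l False by simp
    ultimately show ?thesis using e(2,3) by blast
  qed
qed

text \<open>Go through the tree to the representative of the edge, cross the edge, and return
  through the tree; only the crossing carries a nontrivial label.\<close>

lemma basis_path:
  assumes "s \<in> basis"
  obtains w where "c w = basis_val s"
    "\<forall>h\<in>carrier F. word_act ext w (0, h) = (0, h \<bullet> fc [(s, True)])"
proof -
  interpret F: group F by (rule group_F)
  obtain p where p: "p < n" "\<not> tree p" "s = \<tau> (rep p)" using assms by (auto simp: basis_def)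
  define z where "z = rep p"
  have z: "z < n" "rep z = z" "pos z" using p rep_lt rep_rep pos_rep by (simp_all add: z_def)
  have "\<not> tree z" using p(2) tree_X_pow[OF p(1)] rep_ex[of p] unfolding z_def by metis
  then have edge: "edge z = fc [(s, True)]"
    using z p(3) by (simp add: edge_def edge_word_def z_def)
  obtain u where u: "c u = \<tau> z" "\<forall>h\<in>carrier F. word_act ext u (0, h) = (z, h)"
    "word_act a u 0 = z" by (rule tree_path[OF z(1)])
  obtain v where v: "c v = \<tau> (a X z)" "\<forall>h\<in>carrier F. word_act ext v (0, h) = (a X z, h)"
    "word_act a v 0 = a X z" by (rule tree_path[OF act_lt(1)[OF z(1)]])
  show thesis
  proof (rule that[of "u @ [(X, True)] @ word_inv v"])
    show "c (u @ [(X, True)] @ word_inv v) = basis_val s"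
      using z(1) p(3) unfolding gcls_append gcls_inv u(1) v(1)
      by (simp add: z_def[symmetric] basis_val_\<tau> edge_val_def m_assoc)
    show "\<forall>h\<in>carrier F. word_act ext (u @ [(X, True)] @ word_inv v) (0, h) = (0, h \<bullet> fc [(s, True)])"
    proof
    fix h assume h: "h \<in> carrier F"
    then have he: "h \<bullet> edge z \<in> carrier F" using edge_closed[OF z(1)] by simp
    have "word_act ext (word_inv v) (a X z, h \<bullet> edge z) = (0, h \<bullet> edge z)"
      using word_act_inv_cancel[OF ext_bijective, of v "(0, h \<bullet> edge z)"] v(2)[rule_format, OF he] by simp
    then show "word_act ext (u @ [(X, True)] @ word_inv v) (0, h) = (0, h \<bullet> fc [(s, True)])"
      using u(2)[rule_format, OF h] z(1) h by (simp add: ext_X edge)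
    qed
  qed
qed

lemma free_word_path:
  assumes "v \<in> words_over basis"
  shows "\<exists>w. c w = eval_word \<Gamma> basis_val v \<and>
    (\<forall>h\<in>carrier F. word_act ext w (0, h) = (0, h \<bullet> fc v))"
  using assms
proof (induction v)
  case Nil
  interpret F: group F by (rule group_F)
  show ?case by (rule exI[of _ "[]"]) (simp add: gcls_Nil one_F[symmetric])
next
  case (Cons l v)
  interpret F: group F by (rule group_F)
  obtain s b where l: "l = (s, b)" by (cases l)
  have s: "s \<in> basis" using Cons.hyps l by auto
  have v: "v \<in> words_over basis" using Cons.hyps by simp
  obtain w where w: "c w = eval_word \<Gamma> basis_val v"
    "\<And>h. h \<in> carrier F \<Longrightarrow> word_act ext w (0, h) = (0, h \<bullet> fc v)"
    using Cons.IH by blast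
  obtain u where u: "c u = basis_val s"
    "\<forall>h\<in>carrier F. word_act ext u (0, h) = (0, h \<bullet> fc [(s, True)])"
    by (rule basis_path[OF s])
  have one: "[(s, b)] \<in> words_over basis" for b using s by simp
  have sc: "fc [(s, b)] \<in> carrier F" for b using one unfolding carrier_F by blast
  have vc: "fc v \<in> carrier F" using v unfolding carrier_F by blast
  have canc: "fc [(s, False)] \<bullet> fc [(s, True)] = \<^bold>1\<^sub>F"
  proof -
    have "([] @ [(s, False), (s, \<not> False)] @ [], [] @ []) \<in> word_cong basis {}"
      using s by (intro word_cong.cancel) auto
    then have "fc [(s, False), (s, True)] = fc []"
      by (intro equiv_class_eq[OF equiv_word_cong]) simp
    then show ?thesis using mult_F[OF one one, of False True] by (simp add: one_F)
  qed
  define u' where "u' = (if b then u else word_inv u)"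
  have u': "word_act ext u' (0, h) = (0, h \<bullet> fc [(s, b)])" if h: "h \<in> carrier F" for h
  proof (cases b)
    case True
    then show ?thesis using u(2)[rule_format, OF h] by (simp add: u'_def)
  next
    case False
    have h': "h \<bullet> fc [(s, False)] \<in> carrier F" using h sc by simp
    have "word_act ext u (0, h \<bullet> fc [(s, False)]) = (0, h)"
      using u(2)[rule_format, OF h'] h sc by (simp add: F.m_assoc canc)
    then show ?thesis
      using word_act_inv_cancel[OF ext_bijective, of u "(0, h \<bullet> fc [(s, False)])"] False
      by (simp add: u'_def)
  qed
  have "c (u' @ w) = eval_word \<Gamma> basis_val (l # v)"
    using u(1) w(1) by (simp add: u'_def l gcls_append gcls_inv)
  moreover have "word_act ext (u' @ w) (0, h) = (0, h \<bullet> fc (l # v))" if h: "h \<in> carrier F" for h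
  proof -
    have "word_act ext (u' @ w) (0, h) = (0, h \<bullet> fc [(s, b)] \<bullet> fc v)"
      using u'[OF h] w(2) h sc by simp
    also have "h \<bullet> fc [(s, b)] \<bullet> fc v = h \<bullet> fc (l # v)"
      using mult_F[OF one v, of b] h sc vc by (simp add: F.m_assoc l)
    finally show ?thesis .
  qed
  ultimately show ?case by blast
qed

text \<open>Injectivity of \<open>\<psi>\<close>: a word representing \<open>\<psi> h\<close>
  carries the base point to the sheet h, and this endpoint depends only on the represented element,
  \<open>ext\<close> being an action of \<open>\<Gamma>\<close>.\<close>

theorem stabiliser_free: "is_free_group (\<Gamma>\<lparr>carrier := c ` stab a 0\<rparr>)"
proof -
  interpret F: group F by (rule group_F)
  let ?H = "c ` stab a 0"
  have path: "\<exists>w. c w = \<psi> h \<and> word_act ext w (0, \<^bold>1\<^sub>F) = (0, h)" if h: "h \<in> carrier F" for h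
  proof -
    obtain v where v: "v \<in> words_over basis" "h = fc v" using h unfolding carrier_F by blast
    then show ?thesis
      using free_word_path[OF v(1)] h by (auto simp: \<psi>_fc)
  qed
  have inj: "inj_on \<psi> (carrier F)"
  proof (rule inj_onI)
    fix h h' assume hh: "h \<in> carrier F" "h' \<in> carrier F" "\<psi> h = \<psi> h'"
    obtain w where w: "c w = \<psi> h" "word_act ext w (0, \<^bold>1\<^sub>F) = (0, h)" using path[OF hh(1)] by blast
    obtain w' where w': "c w' = \<psi> h'" "word_act ext w' (0, \<^bold>1\<^sub>F) = (0, h')" using path[OF hh(2)] by blast
    have "word_act ext w = word_act ext w'"
      using Gamma_action_gcls[OF ext_action] w(1) w'(1) hh(3) by simp
    then show "h = h'" using w(2) w'(2) by simp
  qed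
  have "\<psi> ` carrier F = ?H"
  proof (intro equalityI subsetI)
    fix g assume "g \<in> \<psi> ` carrier F"
    then obtain h where h: "h \<in> carrier F" "g = \<psi> h" by blast
    obtain w where w: "c w = \<psi> h" "word_act ext w (0, \<^bold>1\<^sub>F) = (0, h)" using path[OF h(1)] by blast
    then have "word_act a w 0 = 0" using word_act_ext[of w] by auto
    then show "g \<in> ?H" using w(1) h(2) by (auto simp: stab_def intro!: image_eqI[of _ _ w])
  next
    fix g assume "g \<in> ?H"
    then obtain w where w: "g = c w" "word_act a w 0 = 0" by (auto simp: stab_def)
    obtain h where "h \<in> carrier F" "\<psi> h \<cdot> \<tau> 0 = c w" using word_act_ext[of w] w(2) by auto
    then show "g \<in> \<psi> ` carrier F" using w(1) \<psi>_closed by (auto simp: \<tau>_0)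
  qed
  then have "bij_betw \<psi> (carrier F) ?H" using inj by (simp add: bij_betw_def)
  moreover from this have "\<psi> \<in> hom F (\<Gamma>\<lparr>carrier := ?H\<rparr>)"
    using \<psi>_hom by (auto simp: hom_def bij_betw_def)
  ultimately have "\<psi> \<in> iso F (\<Gamma>\<lparr>carrier := ?H\<rparr>)" by (simp add: iso_def)
  then show ?thesis unfolding is_free_group_def is_iso_def by blast
qed

end

section \<open>Free subgroups and stabilisers\<close>

text \<open>The homomorphism from \<open>\<Gamma>\<^sub>m(q)\<close> to the integers modulo \<open>2qm\<close> with \<open>x \<mapsto> q\<close> and \<open>y \<mapsto> 2\<close>
  detects the orders of \<open>x\<close> and \<open>y\<close>.\<close>
definition weight :: "nat \<Rightarrow> gen word \<Rightarrow> int" where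
  "weight q w = (\<Sum>l\<leftarrow>w. (if snd l then 1 else -1) * (case fst l of X \<Rightarrow> int q | Y \<Rightarrow> 2))"

lemma weight_simps [simp]:
  "weight q [] = 0" "weight q (u @ v) = weight q u + weight q v"
  "weight q (l # w) = (if snd l then 1 else -1) * (case fst l of X \<Rightarrow> int q | Y \<Rightarrow> 2) + weight q w"
  by (simp_all add: weight_def)

lemma weight_pow_word [simp]:
  "weight q (pow_word g i) = int i * (case g of X \<Rightarrow> int q | Y \<Rightarrow> 2)"
  by (induction i) (simp_all add: algebra_simps)

lemma weight_word_cong:
  assumes "(u, v) \<in> word_cong UNIV (Gamma_rels m q)"
  shows "int (2 * q * m) dvd weight q u - weight q v"
  using assms
proof (induction rule: word_cong.induct)
  case (sym v w)
  then show ?case by (metis dvd_minus_iff minus_diff_eq)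
next
  case (trans u v w)
  then have "int (2 * q * m) dvd (weight q u - weight q v) + (weight q v - weight q w)"
    by (intro dvd_add)
  then show ?case by simp
next
  case (relation u v l r)
  then show ?case by (auto simp: algebra_simps)
qed auto

lemma pow_word_eq_one:
  assumes q: "q > 0"
  shows "gcls m q (pow_word X i) = \<one>\<^bsub>Gamma m q\<^esub> \<Longrightarrow> 2 * m dvd i"
    and "gcls m q (pow_word Y i) = \<one>\<^bsub>Gamma m q\<^esub> \<Longrightarrow> q * m dvd i"
proof -
  assume "gcls m q (pow_word X i) = \<one>\<^bsub>Gamma m q\<^esub>"
  then have "int (q * (2 * m)) dvd int (q * i)"
    using weight_word_cong[of "pow_word X i" "[]" m q]
    unfolding gcls_Nil[symmetric] gcls_eq_iff by (simp add: ac_simps)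
  then have "q * (2 * m) dvd q * i" by (simp only: int_dvd_int_iff)
  then show "2 * m dvd i" using q by (metis dvd_mult_cancel)
next
  assume "gcls m q (pow_word Y i) = \<one>\<^bsub>Gamma m q\<^esub>"
  then have "int (2 * (q * m)) dvd int (2 * i)"
    using weight_word_cong[of "pow_word Y i" "[]" m q]
    unfolding gcls_Nil[symmetric] gcls_eq_iff by (simp add: ac_simps)
  then have "2 * (q * m) dvd 2 * i" by (simp only: int_dvd_int_iff)
  then show "q * m dvd i" by (metis dvd_mult_cancel zero_less_numeral)
qed

lemma gcls_pow_dvd:
  assumes "gcls m q (pow_word g d) = \<one>\<^bsub>Gamma m q\<^esub>" "d dvd i"
  shows "gcls m q (pow_word g i) = \<one>\<^bsub>Gamma m q\<^esub>"
proof -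
  interpret group "Gamma m q" by (rule group_Gamma)
  from assms(2) obtain k where "i = d * k" ..
  then show ?thesis
    using assms(1) nat_pow_pow[of "gcls m q [(g, True)]" d k] by (simp add: gcls_pow)
qed

lemma stab_gcls:
  assumes a: "Gamma_action m q a" and "gcls m q u = gcls m q v"
  shows "u \<in> stab a p \<longleftrightarrow> v \<in> stab a p"
  using Gamma_action_gcls[OF assms] by (simp add: stab_def)

lemma gcls_in_image_stab:
  assumes a: "Gamma_action m q a"
  shows "gcls m q w \<in> gcls m q ` stab a p \<longleftrightarrow> w \<in> stab a p"
  using stab_gcls[OF a] by blast

lemma subgroup_image_stab:
  assumes a: "Gamma_action m q a"
  shows "subgroup (gcls m q ` stab a p) (Gamma m q)"
proof -
  interpret group "Gamma m q" by (rule group_Gamma)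
  have bij: "bijective a" using a by (simp add: Gamma_action_def)
  show ?thesis
  proof (rule subgroupI)
    show "gcls m q ` stab a p \<subseteq> carrier (Gamma m q)" by auto
    have "[] \<in> stab a p" by (simp add: stab_def)
    then show "gcls m q ` stab a p \<noteq> {}" by blast
  next
    fix g assume "g \<in> gcls m q ` stab a p"
    then obtain w where w: "g = gcls m q w" "word_act a w p = p" by (auto simp: stab_def)
    then have "word_inv w \<in> stab a p"
      using word_act_inv_cancel[OF bij, of w p] by (simp add: stab_def)
    then show "inv\<^bsub>Gamma m q\<^esub> g \<in> gcls m q ` stab a p"
      unfolding w(1) gcls_inv[symmetric] by (rule imageI)
  next
    fix g h assume "g \<in> gcls m q ` stab a p" "h \<in> gcls m q ` stab a p"
    then obtain u v where uv: "g = gcls m q u" "word_act a u p = p" "h = gcls m q v" "word_act a v p = p"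
      by (auto simp: stab_def)
    then have "u @ v \<in> stab a p" by (simp add: stab_def)
    then show "g \<otimes>\<^bsub>Gamma m q\<^esub> h \<in> gcls m q ` stab a p"
      unfolding uv gcls_append[symmetric] by (rule imageI)
  qed
qed

lemma rcoset_eq_iff:
  assumes "group G" "subgroup H G" "g \<in> carrier G" "h \<in> carrier G"
  shows "H #>\<^bsub>G\<^esub> g = H #>\<^bsub>G\<^esub> h \<longleftrightarrow> g \<otimes>\<^bsub>G\<^esub> inv\<^bsub>G\<^esub> h \<in> H"
proof -
  interpret group G by (rule assms(1))
  have "H #>\<^bsub>G\<^esub> g = H #>\<^bsub>G\<^esub> h \<longleftrightarrow> g \<in> H #>\<^bsub>G\<^esub> h"
    using rcos_self[OF assms(3,2)] repr_independence[OF _ assms(4,2), of g] by auto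
  also have "\<dots> \<longleftrightarrow> g \<otimes>\<^bsub>G\<^esub> inv\<^bsub>G\<^esub> h \<in> H"
    by (rule subgroup.rcos_module[OF assms(2,1,4,3)])
  finally show ?thesis .
qed

lemma card_rcosets_stab:
  assumes a: "a \<in> trans_structs (Gamma_stabs m q) A" and p: "p \<in> A"
  shows "card (rcosets\<^bsub>Gamma m q\<^esub> (gcls m q ` stab a p)) = card A"
proof -
  interpret group "Gamma m q" by (rule group_Gamma)
  let ?H = "gcls m q ` stab a p"
  let ?c = "gcls m q"
  let ?G = "Gamma m q"
  have act: "Gamma_action m q a" using Gamma_structs_action[OF trans_structsD(1)[OF a]] .
  have bij: "bijective a" using act by (simp add: Gamma_action_def)
  have orb: "orb a p = A" using trans_structsD(2)[OF a p] .
  have eq: "?H #>\<^bsub>?G\<^esub> ?c u = ?H #>\<^bsub>?G\<^esub> ?c v \<longleftrightarrow> word_act a u p = word_act a v p" for u v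
  proof -
    have "?H #>\<^bsub>?G\<^esub> ?c u = ?H #>\<^bsub>?G\<^esub> ?c v
        \<longleftrightarrow> ?c (u @ word_inv v) \<in> ?H"
      unfolding gcls_append gcls_inv
      by (rule rcoset_eq_iff[OF group_Gamma subgroup_image_stab[OF act]]) simp_all
    then show ?thesis
      unfolding gcls_in_image_stab[OF act] stab_word_eq[OF bij] .
  qed
  define W where "W x = (SOME w. word_act a w p = x)" for x
  have W: "word_act a (W x) p = x" if "x \<in> A" for x
  proof -
    have "x \<in> orb a p" using that orb by simp
    then have "\<exists>w. word_act a w p = x" by (auto elim: orbE)
    then show ?thesis unfolding W_def by (rule someI_ex)
  qed
  have "bij_betw (\<lambda>x. ?H #>\<^bsub>?G\<^esub> ?c (W x)) A (rcosets\<^bsub>?G\<^esub> ?H)"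
  proof (rule bij_betw_imageI)
    show "inj_on (\<lambda>x. ?H #>\<^bsub>?G\<^esub> ?c (W x)) A"
      by (rule inj_onI) (simp add: eq W)
    show "(\<lambda>x. ?H #>\<^bsub>?G\<^esub> ?c (W x)) ` A = rcosets\<^bsub>?G\<^esub> ?H"
    proof (intro equalityI subsetI)
      fix C assume "C \<in> (\<lambda>x. ?H #>\<^bsub>?G\<^esub> ?c (W x)) ` A"
      then show "C \<in> rcosets\<^bsub>?G\<^esub> ?H" by (auto simp: RCOSETS_def)
    next
      fix C assume "C \<in> rcosets\<^bsub>?G\<^esub> ?H"
      then obtain w where w: "C = ?H #>\<^bsub>?G\<^esub> ?c w"
        by (auto simp: RCOSETS_def carrier_Gamma)
      have "word_act a w p \<in> A" using orbI[of a w p] orb by simp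
      then show "C \<in> (\<lambda>x. ?H #>\<^bsub>?G\<^esub> ?c (W x)) ` A"
        by (intro image_eqI[of _ _ "word_act a w p"]) (simp_all add: w eq W)
    qed
  qed
  then show ?thesis by (rule bij_betw_same_card[symmetric])
qed

lemma ex_enumeration:
  assumes "card S = n" "n > 0" "s \<in> S"
  obtains e where "bij_betw e {..<n} S" "e 0 = s"
proof -
  have "finite S" using assms by (simp add: card_ge_0_finite)
  then obtain b where b: "bij_betw b {..<n} S"
    using assms(1) finite_same_card_bij[of "{..<n}" S] by auto
  then obtain i where i: "i < n" "b i = s" using assms(3) by (auto simp: bij_betw_def)
  have "bij_betw (transpose 0 i) {..<n} {..<n}"
    using i assms(2) by (intro permutes_imp_bij permutes_swap_id) auto
  then have "bij_betw (b \<circ> transpose 0 i) {..<n} S" using b by (rule bij_betw_trans)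
  moreover have "(b \<circ> transpose 0 i) 0 = s" using i by simp
  ultimately show thesis by (rule that)
qed

text \<open>The action is that on right cosets, numbered with \<open>H\<close> at 0. Freeness enters
  through torsion-freeness: a power of x or y fixing a coset is conjugate to an element of
  \<open>H\<close> of finite order, hence trivial, and the orders of x and y then give the
  divisibility.\<close>

lemma free_subgroup_is_stab:
  assumes q: "q > 0" and m: "m > 0" and n: "n > 0"
    and H: "subgroup H (Gamma m q)" and free: "is_free_group ((Gamma m q)\<lparr>carrier := H\<rparr>)"
    and index: "card (rcosets\<^bsub>Gamma m q\<^esub> H) = n"
  obtains a where "a \<in> trans_structs (Gamma_stabs m q) {..<n}" "H = gcls m q ` stab a 0"
proof -
  interpret group "Gamma m q" by (rule group_Gamma)
  interpret H: subgroup H "Gamma m q" by (rule H)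
  let ?G = "Gamma m q" and ?c = "gcls m q"
  let ?R = "rcosets\<^bsub>?G\<^esub> H"
  have HR: "H \<in> ?R" using H.subgroup_in_rcosets[OF group_Gamma] .
  obtain e where e: "bij_betw e {..<n} ?R" "e 0 = H" using ex_enumeration[OF index n HR] .
  have eR: "\<exists>u. e i = H #>\<^bsub>?G\<^esub> ?c u" if "i < n" for i
    using bij_betwE[OF e(1)] that by (fastforce simp: RCOSETS_def carrier_Gamma)
  have mult: "(H #>\<^bsub>?G\<^esub> ?c u) #>\<^bsub>?G\<^esub> ?c v = H #>\<^bsub>?G\<^esub> ?c (u @ v)" for u v
    unfolding gcls_append by (rule coset_mult_assoc) (simp_all add: H.subset)
  have undo: "?c (u @ [(g, True)] @ [(g, False)]) = ?c u" "?c (u @ [(g, False)] @ [(g, True)]) = ?c u" for u g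
    unfolding gcls_eq_iff
    using word_cong.cancel[of u UNIV "[]" g True] word_cong.cancel[of u UNIV "[]" g False] by simp_all
  have Rmult: "e i #>\<^bsub>?G\<^esub> ?c v \<in> ?R" if "i < n" for i v
    using eR[OF that] mult by (auto simp: RCOSETS_def)
  define a where "a g i = (if i < n then inv_into {..<n} e (e i #>\<^bsub>?G\<^esub> ?c [(g, True)]) else i)" for g i
  have surj: "e ` {..<n} = ?R" using e(1) by (simp add: bij_betw_def)
  have a_lt: "a g i < n" if "i < n" for g i
    using inv_into_into[of "e i #>\<^bsub>?G\<^esub> ?c [(g, True)]" e "{..<n}"] Rmult[OF that] that
    by (simp add: a_def surj)
  have e_a: "e (a g i) = e i #>\<^bsub>?G\<^esub> ?c [(g, True)]" if "i < n" for g i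
    using f_inv_into_f[of "e i #>\<^bsub>?G\<^esub> ?c [(g, True)]" e "{..<n}"] Rmult[OF that] that
    by (simp add: a_def surj)
  have canc: "(e i #>\<^bsub>?G\<^esub> ?c [(g, True)]) #>\<^bsub>?G\<^esub> ?c [(g, False)] = e i"
    if i: "i < n" for i g
  proof -
    obtain u where "e i = H #>\<^bsub>?G\<^esub> ?c u" using eR[OF i] ..
    then show ?thesis using undo(1)[of u g] by (simp add: mult)
  qed
  have inj_e: "i = j" if "e i = e j" "i < n" "j < n" for i j
    using bij_betw_imp_inj_on[OF e(1)] that by (simp add: inj_on_eq_iff)
  have a_perm: "a g permutes {..<n}" for g
  proof (rule bij_imp_permutes)
    have "inj_on (a g) {..<n}"
    proof (rule inj_onI)
      fix i j assume ij: "i \<in> {..<n}" "j \<in> {..<n}" "a g i = a g j"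
      then have lt: "i < n" "j < n" by simp_all
      have eq: "e i #>\<^bsub>?G\<^esub> ?c [(g, True)] = e j #>\<^bsub>?G\<^esub> ?c [(g, True)]"
        unfolding e_a[OF lt(1), symmetric] e_a[OF lt(2), symmetric] by (simp only: ij(3))
      have "e i = (e i #>\<^bsub>?G\<^esub> ?c [(g, True)]) #>\<^bsub>?G\<^esub> ?c [(g, False)]"
        by (rule canc[OF lt(1), symmetric])
      also have "\<dots> = e j" unfolding eq by (rule canc[OF lt(2)])
      finally have "e i = e j" .
      from inj_e[OF this] ij show "i = j" by simp
    qed
    then show "bij_betw (a g) {..<n} {..<n}"
      using a_lt by (intro bij_betw_imageI endo_inj_surj) auto
  qed (simp add: a_def)
  then have perm: "perm_rep a {..<n}" by (simp add: perm_rep_def)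
  have e_act: "e (word_act a w i) = e i #>\<^bsub>?G\<^esub> ?c w \<and> word_act a w i < n" if "i < n" for w i
    using that
  proof (induction w arbitrary: i)
    case Nil
    obtain u where u: "e i = H #>\<^bsub>?G\<^esub> ?c u" using eR[OF Nil] ..
    show ?case using Nil mult[of u "[]"] by (simp add: u)
  next
    case (Cons l w)
    obtain g b where l: "l = (g, b)" by (cases l)
    obtain u where u: "e i = H #>\<^bsub>?G\<^esub> ?c u" using eR[OF Cons.prems] ..
    have step: "e (letter_act a l i) = e i #>\<^bsub>?G\<^esub> ?c [l] \<and> letter_act a l i < n"
    proof (cases b)
      case True
      then show ?thesis using e_a[OF Cons.prems] a_lt[OF Cons.prems] l by simp
    next
      case False
      define j where "j = fun_inv (a g) i"
      have j: "j < n" "a g j = i"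
        using permutes_in_image[OF permutes_inv[OF a_perm]] Cons.prems permutes_inverses(1)[OF a_perm]
        by (auto simp: j_def)
      have "e i #>\<^bsub>?G\<^esub> ?c [(g, False)] = e j"
        using e_a[OF j(1), of g] canc[OF j(1), of g] j(2) by simp
      then show ?thesis using False l j by (simp add: j_def)
    qed
    then show ?case using Cons.IH[of "letter_act a l i"] mult[of u "[l]"] mult[of "u @ [l]" w] mult[of u "l # w"]
      by (simp add: u)
  qed
  have stab_a: "w \<in> stab a i \<longleftrightarrow> ?c (u @ w @ word_inv u) \<in> H"
    if i: "i < n" and u: "e i = H #>\<^bsub>?G\<^esub> ?c u" for w i u
  proof -
    have "w \<in> stab a i \<longleftrightarrow> e (word_act a w i) = e i"
      using e_act[OF i, of w] inj_e[of "word_act a w i" i] i by (auto simp: stab_def)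
    also have "\<dots> \<longleftrightarrow> H #>\<^bsub>?G\<^esub> ?c (u @ w) = H #>\<^bsub>?G\<^esub> ?c u"
      using e_act[OF i, of w] by (simp add: u mult)
    also have "\<dots> \<longleftrightarrow> ?c ((u @ w) @ word_inv u) \<in> H"
      unfolding gcls_append[of m q "u @ w"] gcls_inv
      by (rule rcoset_eq_iff[OF group_Gamma H]) simp_all
    finally show ?thesis by simp
  qed
  have tf: "?c (pow_word g i) = \<one>\<^bsub>?G\<^esub>"
    if "?c (u @ pow_word g i @ word_inv u) \<in> H" "?c (pow_word g d) = \<one>\<^bsub>?G\<^esub>" "d > 0" for u g i d
  proof -
    let ?t = "?c u \<otimes>\<^bsub>?G\<^esub> ?c (pow_word g i) \<otimes>\<^bsub>?G\<^esub> inv\<^bsub>?G\<^esub> ?c u"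
    have t: "?t = ?c (u @ pow_word g i @ word_inv u)"
      by (simp add: gcls_append gcls_inv m_assoc)
    have pow: "?t [^]\<^bsub>?G\<^esub> k = ?c u \<otimes>\<^bsub>?G\<^esub> ?c (pow_word g i) [^]\<^bsub>?G\<^esub> k \<otimes>\<^bsub>?G\<^esub> inv\<^bsub>?G\<^esub> ?c u" for k :: nat
    proof (induction k)
      case (Suc k)
      have "?t [^]\<^bsub>?G\<^esub> Suc k = ?c u \<otimes>\<^bsub>?G\<^esub> ?c (pow_word g i) [^]\<^bsub>?G\<^esub> k \<otimes>\<^bsub>?G\<^esub>
          (inv\<^bsub>?G\<^esub> ?c u \<otimes>\<^bsub>?G\<^esub> ?c u) \<otimes>\<^bsub>?G\<^esub> (?c (pow_word g i) \<otimes>\<^bsub>?G\<^esub> inv\<^bsub>?G\<^esub> ?c u)"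
        unfolding nat_pow_Suc Suc by (simp only: m_assoc m_closed inv_closed gcls_closed nat_pow_closed)
      then show ?case by (simp add: m_assoc)
    qed simp
    have "?c (pow_word g i) [^]\<^bsub>?G\<^esub> d = ?c (pow_word g (d * i))"
      by (simp add: gcls_pow nat_pow_pow mult.commute)
    also have "\<dots> = \<one>\<^bsub>?G\<^esub>" by (rule gcls_pow_dvd[OF that(2)]) simp
    finally have "?t [^]\<^bsub>?G\<^esub> d = \<one>\<^bsub>?G\<^esub>" unfolding pow by simp
    then have "?t [^]\<^bsub>?G\<lparr>carrier := H\<rparr>\<^esub> d = \<one>\<^bsub>?G\<lparr>carrier := H\<rparr>\<^esub>"
      by (simp flip: nat_pow_consistent)
    moreover have "?t \<in> carrier (?G\<lparr>carrier := H\<rparr>)" using that(1) unfolding t by simp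
    ultimately have "?t = \<one>\<^bsub>?G\<lparr>carrier := H\<rparr>\<^esub>"
      using is_free_group_torsion_free[OF free H.subgroup_is_group[OF group_Gamma]] that(3) by blast
    then have one: "?t = \<one>\<^bsub>?G\<^esub>" by simp
    have "?c (pow_word g i) = inv\<^bsub>?G\<^esub> ?c u \<otimes>\<^bsub>?G\<^esub> ?t \<otimes>\<^bsub>?G\<^esub> ?c u"
      by (simp add: m_assoc) (simp flip: m_assoc)
    then show ?thesis unfolding one by simp
  qed
  have a_struct: "a \<in> structs (Gamma_stabs m q) {..<n}"
    unfolding structs_def
  proof (intro CollectI conjI ballI perm)
    fix p assume "p \<in> {..<n}"
    then have p: "p < n" by simp
    obtain u where u: "e p = H #>\<^bsub>?G\<^esub> ?c u" using eR[OF p] ..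
    have triv: "w \<in> stab a p" if "?c w = \<one>\<^bsub>?G\<^esub>" for w
      using that H.one_closed unfolding stab_a[OF p u] by (simp add: gcls_append gcls_inv)
    have "pow_word X i \<in> stab a p \<longleftrightarrow> 2 * m dvd i" for i
    proof
      assume "pow_word X i \<in> stab a p"
      then have "?c (pow_word X i) = \<one>\<^bsub>?G\<^esub>"
        unfolding stab_a[OF p u] by (rule tf[OF _ gcls_rels(1)]) (use m in simp)
      then show "2 * m dvd i" by (rule pow_word_eq_one[OF q])
    qed (intro triv gcls_pow_dvd[OF gcls_rels(1)])
    moreover have "pow_word Y i \<in> stab a p \<longleftrightarrow> q * m dvd i" for i
    proof
      assume "pow_word Y i \<in> stab a p"
      then have "?c (pow_word Y i) = \<one>\<^bsub>?G\<^esub>"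
        unfolding stab_a[OF p u] by (rule tf[OF _ gcls_rels(2)]) (use m q in simp)
      then show "q * m dvd i" by (rule pow_word_eq_one[OF q])
    qed (intro triv gcls_pow_dvd[OF gcls_rels(2)])
    moreover have "pow_word X 2 @ word_inv (pow_word Y q) \<in> stab a p"
      by (rule triv) (simp add: gcls_append gcls_inv gcls_rels(3))
    ultimately show "stab a p \<in> Gamma_stabs m q" unfolding Gamma_stabs_def by blast
  qed
  moreover have "orb a p = {..<n}" if "p \<in> {..<n}" for p
  proof
    show "orb a p \<subseteq> {..<n}" using orb_subset[OF perm that] .
    show "{..<n} \<subseteq> orb a p"
    proof
      fix j assume "j \<in> {..<n}"
      then have j: "j < n" by simp
      have p: "p < n" using that by simp
      obtain u where u: "e p = H #>\<^bsub>?G\<^esub> ?c u" using eR[OF p] ..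
      obtain v where v: "e j = H #>\<^bsub>?G\<^esub> ?c v" using eR[OF j] ..
      have "?c (u @ word_inv u @ v) = ?c v" by (simp add: gcls_append gcls_inv flip: m_assoc)
      then have "e p #>\<^bsub>?G\<^esub> ?c (word_inv u @ v) = e j" by (simp only: u v mult)
      then have "e (word_act a (word_inv u @ v) p) = e j"
        using e_act[OF p, of "word_inv u @ v"] by (simp only:)
      from inj_e[OF this _ j] have "word_act a (word_inv u @ v) p = j"
        using e_act[OF p] by blast
      then show "j \<in> orb a p" using orbI[of a "word_inv u @ v" p] by (simp only:)
    qed
  qed
  ultimately have "a \<in> trans_structs (Gamma_stabs m q) {..<n}" by (simp add: trans_structs_def)
  moreover have "H = ?c ` stab a 0"
  proof -
    have "e 0 = H #>\<^bsub>?G\<^esub> ?c []"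
      using e(2) coset_mult_one[OF H.subset] by (simp add: gcls_Nil)
    from stab_a[OF n this] have "stab a 0 = {w. ?c w \<in> H}" by auto
    moreover have "H \<subseteq> range ?c" using H.subset carrier_Gamma by blast
    ultimately show ?thesis by blast
  qed
  ultimately show thesis by (rule that)
qed

text \<open>A word stabiliser is a union of classes of words, so it can be recovered from its image.
  The images are the free subgroups by \<open>stabiliser_free\<close> and
  \<open>free_subgroup_is_stab\<close>.\<close>

theorem stab_number_Gamma:
  assumes q: "q > 0" and m: "m > 0" and k: "k > 0"
  shows "stab_number (Gamma_stabs m q) (2 * q * m * k) = free_subgroup_number q m k"
proof -
  define n where "n = 2 * q * m * k"
  have n: "n > 0" using q m k by (simp add: n_def)
  let ?T = "trans_structs (Gamma_stabs m q) {..<n}"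
  let ?F = "{H. subgroup H (Gamma m q) \<and> is_free_group ((Gamma m q)\<lparr>carrier := H\<rparr>) \<and>
    card (rcosets\<^bsub>Gamma m q\<^esub> H) = n}"
  have "bij_betw ((`) (gcls m q)) ((\<lambda>a. stab a 0) ` ?T)
    ?F"
  proof (rule bij_betw_imageI)
    show "inj_on ((`) (gcls m q)) ((\<lambda>a. stab a 0) ` ?T)"
    proof (rule inj_onI, clarify)
      fix a b assume ab: "a \<in> ?T" "b \<in> ?T" and eq: "gcls m q ` stab a 0 = gcls m q ` stab b 0"
      show "stab a 0 = stab b 0"
      proof (rule Set.set_eqI)
        fix w
        have "w \<in> stab a 0 \<longleftrightarrow> gcls m q w \<in> gcls m q ` stab a 0"
          by (rule gcls_in_image_stab[OF Gamma_structs_action[OF trans_structsD(1)[OF ab(1)]], symmetric])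
        also have "\<dots> \<longleftrightarrow> gcls m q w \<in> gcls m q ` stab b 0" by (simp only: eq)
        also have "\<dots> \<longleftrightarrow> w \<in> stab b 0"
          by (rule gcls_in_image_stab[OF Gamma_structs_action[OF trans_structsD(1)[OF ab(2)]]])
        finally show "w \<in> stab a 0 \<longleftrightarrow> w \<in> stab b 0" .
      qed
    qed
    show "(`) (gcls m q) ` ((\<lambda>a. stab a 0) ` ?T) = ?F"
    proof (intro equalityI subsetI)
      fix H assume "H \<in> (`) (gcls m q) ` ((\<lambda>a. stab a 0) ` ?T)"
      then obtain a where aT: "a \<in> ?T" and Ha: "H = gcls m q ` stab a 0" by blast
      interpret free_Gamma_set m q n a by unfold_locales (use m q n aT in auto)
      show "H \<in> ?F"
        using subgroup_image_stab[OF Gamma_structs_action[OF structs_a]] stabiliser_free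
          card_rcosets_stab[OF aT zero_in] Ha by simp
    next
      fix H assume "H \<in> ?F"
      then obtain a where "a \<in> ?T" "H = gcls m q ` stab a 0"
        using free_subgroup_is_stab[OF q m n, of H] by blast
      then show "H \<in> (`) (gcls m q) ` ((\<lambda>a. stab a 0) ` ?T)" by blast
    qed
  qed
  then show ?thesis
    unfolding stab_number_def free_subgroup_number_def n_def[symmetric] by (rule bij_betw_same_card)
qed

section \<open>The differential equation of the generating function\<close>

text \<open>The weights are rational while u is integral. The equation is proved over the rationals,
  where G can be cancelled, and pulled back along this injective homomorphism.\<close>

definition rat_fps :: "int fps \<Rightarrow> rat fps" where
  "rat_fps f = Abs_fps (\<lambda>n. of_int (f $ n))"

lemma rat_fps_nth [simp]: "rat_fps f $ n = of_int (f $ n)"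
  by (simp add: rat_fps_def)

lemma rat_fps_add: "rat_fps (f + g) = rat_fps f + rat_fps g"
  by (simp add: fps_eq_iff)

lemma rat_fps_mult: "rat_fps (f * g) = rat_fps f * rat_fps g"
  by (simp add: fps_eq_iff fps_mult_nth)

lemma rat_fps_1: "rat_fps 1 = 1"
  by (simp add: fps_eq_iff)

lemma rat_fps_of_int: "rat_fps (of_int k) = of_int k"
  by (simp add: fps_eq_iff fps_of_int[symmetric])

lemma rat_fps_X: "rat_fps fps_X = fps_X"
  by (simp add: fps_eq_iff)

lemma rat_fps_XD: "rat_fps (fps_XD f) = fps_XD (rat_fps f)"
  by (simp add: fps_eq_iff)

lemma rat_fps_inject: "rat_fps f = rat_fps g \<longleftrightarrow> f = g"
  by (simp add: fps_eq_iff)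

lemma fps_XD_mult: "fps_XD (f * g) = fps_XD f * g + f * (fps_XD g :: 'a :: comm_ring_1 fps)"
  by (simp add: fps_XD_def algebra_simps)

text \<open>The odd numbers below \<open>2q\<close> other than \<open>q\<close>, for odd \<open>q\<close>.\<close>
definition odd_except :: "nat \<Rightarrow> nat \<Rightarrow> nat" where
  "odd_except q j = (if 2 * j + 1 < q then 2 * j + 1 else 2 * j + 3)"

lemma fact_add: "fact (n + k) = (fact n * (\<Prod>i<k. of_nat (n + Suc i)) :: 'a :: {semiring_char_0, comm_semiring_1})"
  by (induction k) (simp_all add: algebra_simps)

lemma prod_double:
  fixes f :: "nat \<Rightarrow> 'a :: comm_monoid_mult"
  shows "(\<Prod>i<2 * k. f i) = (\<Prod>i<k. f (2 * i)) * (\<Prod>i<k. f (2 * i + 1))"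
  by (induction k) (simp_all add: ac_simps)

lemma prod_odd_except:
  assumes "odd q"
  shows "(\<Prod>i<q. f (2 * i + 1)) = f q * (\<Prod>j<q - 1. f (odd_except q j) :: 'a :: comm_monoid_mult)"
proof -
  obtain s where s: "q = 2 * s + 1" using assms by (elim oddE)
  have "(\<Prod>i<q. f (2 * i + 1)) = (\<Prod>i\<in>insert s ({..<q} - {s}). f (2 * i + 1))"
    by (intro prod.cong) (auto simp: s)
  also have "\<dots> = f q * (\<Prod>i\<in>{..<q} - {s}. f (2 * i + 1))"
    by (subst prod.insert) (auto simp: s)
  also have "(\<Prod>i\<in>{..<q} - {s}. f (2 * i + 1)) = (\<Prod>j<q - 1. f (odd_except q j))"
    by (rule prod.reindex_bij_witness[where i = "\<lambda>j. if j < s then j else Suc j"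
          and j = "\<lambda>i. if i < s then i else i - 1"]) (auto simp: s odd_except_def intro!: arg_cong[of _ _ f])
  finally show ?thesis .
qed

text \<open>Passing from n to n + 1 brings 2q new factors into (2qn)!. The even ones cancel against
  (q(n+1))! and 2^q, and N + q = q(2n+1) cancels against a factor of (2(n+1))!; the other q - 1 odd
  ones remain and yield the constants.\<close>

lemma Gamma_weight_Suc:
  assumes m: "m > 0" and q: "odd q" "q \<ge> 3"
  shows "of_nat (2 * q * m * Suc n) * Gamma_weight m q (Suc n)
    = (\<Prod>j<q - 1. of_nat (2 * q * m * n + m * odd_except q j)) * Gamma_weight m q n"
proof -
  define N where "N = 2 * q * n"
  have q0: "q > 0" using q by simp
  define P where "P = (\<Prod>j<q - 1. of_nat (N + odd_except q j) :: rat)"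
  define E where "E = (\<Prod>i<q. of_nat (q * n + Suc i) :: rat)"
  have pos: "E \<noteq> 0" unfolding E_def by (simp add: prod_zero_iff del: of_nat_add of_nat_Suc)
  have 1: "fact (2 * q * Suc n) = fact N * ((of_nat N + of_nat q) * P * (2 ^ q * E) :: rat)"
  proof -
    have "2 * q * Suc n = N + 2 * q" by (simp add: N_def)
    then have "fact (2 * q * Suc n) = fact N * (\<Prod>i<2 * q. of_nat (N + Suc i) :: rat)"
      by (simp only: fact_add)
    also have "(\<Prod>i<2 * q. of_nat (N + Suc i) :: rat)
        = (\<Prod>i<q. of_nat (N + (2 * i + 1))) * (\<Prod>i<q. of_nat (N + Suc (2 * i + 1)))"
      unfolding prod_double by simp
    also have "(\<Prod>i<q. of_nat (N + Suc (2 * i + 1)) :: rat) = (\<Prod>i<q. 2 * of_nat (q * n + Suc i))"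
      by (intro prod.cong) (simp_all add: N_def)
    also have "\<dots> = 2 ^ q * E" unfolding prod.distrib E_def by simp
    also have "(\<Prod>i<q. of_nat (N + (2 * i + 1)) :: rat) = of_nat (N + q) * P"
      using prod_odd_except[OF q(1), of "\<lambda>i. of_nat (N + i) :: rat"] by (simp add: P_def)
    finally show ?thesis by simp
  qed
  have 2: "fact (q * Suc n) = (fact (q * n) * E :: rat)"
    using fact_add[of "q * n" q] by (simp add: E_def add.commute)
  have 3: "fact (2 * Suc n) = (fact (2 * n) * ((2 * of_nat n + 1) * (2 * of_nat (Suc n))) :: rat)"
    by (simp add: algebra_simps)
  have Nq: "of_nat N + of_nat q = (of_nat q * (2 * of_nat n + 1) :: rat)"
    by (simp add: N_def algebra_simps)
  have "(0 :: rat) < 2 * of_nat n + 1" by (intro add_nonneg_pos) simp_all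
  then have odd0: "(2 * of_nat n + 1 :: rat) \<noteq> 0" by (rule less_imp_neq[THEN not_sym])
  have PP: "(\<Prod>j<q - 1. of_nat (2 * q * m * n + m * odd_except q j) :: rat) = of_nat m ^ (q - 1) * P"
  proof -
    have "(\<Prod>j<q - 1. of_nat (2 * q * m * n + m * odd_except q j) :: rat)
        = (\<Prod>j<q - 1. of_nat m * of_nat (N + odd_except q j))"
      by (intro prod.cong) (simp_all add: N_def algebra_simps)
    then show ?thesis by (simp add: prod.distrib P_def)
  qed
  \<comment> \<open>Of the 2q new factors m, q - 1 enter the product on the right, q cancel against
    (2m)^q, and the last one, with the m of the prefactor, cancels against (qm)^2.\<close>
  have mq: "(of_nat m :: rat) ^ (2 * q * Suc n) = of_nat m ^ (2 * q * n) * (of_nat m ^ (q - 1) * of_nat m ^ q * of_nat m)"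
  proof -
    have "2 * q * Suc n = 2 * q * n + (q - 1 + q + 1)" using q0 by simp
    then show ?thesis by (simp only: power_add power_one_right)
  qed
  have e2: "(of_nat (2 * m) :: rat) ^ (q * Suc n) = of_nat (2 * m) ^ (q * n) * (2 ^ q * of_nat m ^ q)"
    by (simp add: power_add power_mult_distrib)
  have e3: "(of_nat (q * m) :: rat) ^ (2 * Suc n) = of_nat (q * m) ^ (2 * n) * (of_nat q * of_nat m * (of_nat q * of_nat m))"
    by (simp add: power_add power2_eq_square)
  define A where "A = (of_nat m :: rat) ^ (2 * q * n)"
  define B where "B = (of_nat (2 * m) :: rat) ^ (q * n)"
  define C where "C = (of_nat (q * m) :: rat) ^ (2 * n)"
  have nz: "A \<noteq> 0" "B \<noteq> 0" "C \<noteq> 0" using m q0 by (simp_all add: A_def B_def C_def)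
  define M where "M = (of_nat m :: rat)"
  define Q where "Q = (of_nat q :: rat)"
  define S where "S = (of_nat (Suc n) :: rat)"
  define d where "d = (2 * of_nat n + 1 :: rat)"
  have nz2: "M \<noteq> 0" "Q \<noteq> 0" "S \<noteq> 0" "d \<noteq> 0"
    using m q0 odd0 unfolding M_def Q_def S_def d_def of_nat_eq_0_iff by simp_all
  have main: "2 * Q * M * S * (A * (M ^ (q - 1) * M ^ q * M) * (fact N * (Q * d * P * (2 ^ q * E)))
      / (B * (2 ^ q * M ^ q) * (fact (q * n) * E) * (C * (Q * M * (Q * M)) * (fact (2 * n) * (d * (2 * S))))))
    = M ^ (q - 1) * P * (A * fact N / (B * fact (q * n) * (C * fact (2 * n))))"
    using nz nz2 pos by (simp add: field_simps)
  have g1: "Gamma_weight m q (Suc n)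
      = A * (M ^ (q - 1) * M ^ q * M) * (fact N * (Q * d * P * (2 ^ q * E)))
      / (B * (2 ^ q * M ^ q) * (fact (q * n) * E) * (C * (Q * M * (Q * M)) * (fact (2 * n) * (d * (2 * S)))))"
    unfolding Gamma_weight_eq[OF m q0] mq e2 e3 1 2 3 Nq A_def B_def C_def M_def Q_def S_def d_def
    by (rule HOL.refl)
  have g0: "Gamma_weight m q n = A * fact N / (B * fact (q * n) * (C * fact (2 * n)))"
    unfolding Gamma_weight_eq[OF m q0] A_def B_def C_def N_def by (rule HOL.refl)
  have c: "of_nat (2 * q * m * Suc n) = 2 * Q * M * S"
    by (simp only: M_def Q_def S_def of_nat_mult of_nat_numeral)
  show ?thesis unfolding c g1 g0 PP M_def[symmetric] by (rule main)
qed

text \<open>Since D G = u G, the Leibniz rule gives (D + c)(p G) = ((D + u + c) p) G. On the side of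
  p G the operators D + c are diagonal, so they only multiply coefficients.\<close>

lemma twisted_prod_times_Gamma:
  fixes G :: "rat fps" and u :: "int fps"
  assumes G: "of_nat a * fps_XD G = rat_fps u * G"
  shows "rat_fps (twisted_prod (\<lambda>f. of_nat a * fps_XD f) (\<lambda>j. of_int (c j)) u j) * G
    = Abs_fps (\<lambda>n. (\<Prod>i<j. of_nat (a * n) + of_int (c i)) * G $ n)"
proof (induction j)
  case 0
  then show ?case by (simp add: rat_fps_1 fps_eq_iff)
next
  case (Suc j)
  let ?p = "twisted_prod (\<lambda>f. of_nat a * fps_XD f) (\<lambda>j. of_int (c j)) u j"
  have "rat_fps (of_nat a * fps_XD ?p + (u + of_int (c j)) * ?p) * G
      = of_nat a * (fps_XD (rat_fps ?p) * G) + rat_fps ?p * (rat_fps u * G) + of_int (c j) * (rat_fps ?p * G)"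
    using rat_fps_of_int[of "int a"]
    by (simp add: rat_fps_add rat_fps_mult rat_fps_XD rat_fps_of_int algebra_simps)
  also have "\<dots> = of_nat a * fps_XD (rat_fps ?p * G) + of_int (c j) * (rat_fps ?p * G)"
    unfolding G[symmetric] fps_XD_mult by (simp add: algebra_simps)
  also have "\<dots> = Abs_fps (\<lambda>n. (\<Prod>i<Suc j. of_nat (a * n) + of_int (c i)) * G $ n)"
    unfolding Suc
    by (simp add: fps_eq_iff fps_of_nat[symmetric] fps_of_int[symmetric] algebra_simps)
  finally show ?case by simp
qed

text \<open>The exponential formula says D G = u G, and the recursion of the weights computes the
  same D G as z times a product of operators D + c_j applied to G. Conjugating by G and cancelling
  it gives the equation for u.\<close>

lemma free_subgroup_gf_riccati:
  assumes m: "m > 0" and q: "odd q" "q \<ge> 3"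
  defines "u \<equiv> free_subgroup_gf q m - 1"
  shows "u = fps_X * twisted_prod (\<lambda>f. of_nat (2 * (q * m)) * fps_XD f)
    (\<lambda>j. of_int (int (m * odd_except q j))) u (q - 1)" (is "u = fps_X * ?T")
proof -
  define G where "G = Abs_fps (Gamma_weight m q)"
  have q0: "q > 0" using q by simp
  have a: "2 * (q * m) = 2 * q * m" by simp
  have DG: "of_nat (2 * (q * m)) * fps_XD G = rat_fps u * G"
  proof (rule fps_ext)
    fix n
    have "(of_nat (2 * (q * m)) * fps_XD G) $ n = of_nat (2 * q * m * n) * Gamma_weight m q n"
      unfolding a by (simp only: fps_of_nat[symmetric] fps_mult_left_const_nth fps_XD_nth G_def fps_nth_Abs_fps of_nat_mult mult.assoc)
    also have "\<dots> = (\<Sum>k=1..n. of_nat (stab_number (Gamma_stabs m q) (2 * q * m * k)) * Gamma_weight m q (n - k))"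
      by (rule Gamma_weight_rec[OF m q(1)])
    also have "\<dots> = (\<Sum>k=1..n. of_int (u $ k) * Gamma_weight m q (n - k))"
      by (intro sum.cong) (simp_all add: u_def free_subgroup_gf_def stab_number_Gamma[OF q0 m])
    also have "\<dots> = (\<Sum>k=0..n. of_int (u $ k) * Gamma_weight m q (n - k))"
      by (intro sum.mono_neutral_left) (auto simp: u_def free_subgroup_gf_def)
    also have "\<dots> = (rat_fps u * G) $ n" by (simp add: fps_mult_nth G_def)
    finally show "(of_nat (2 * (q * m)) * fps_XD G) $ n = (rat_fps u * G) $ n" .
  qed
  have G0: "G \<noteq> 0"
  proof
    assume "G = 0"
    then have "G $ 0 = 0" by simp
    then show False by (simp add: G_def Gamma_weight_def struct_weight_0)
  qed
  have "rat_fps u * G = fps_X * (rat_fps ?T * G)"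
  proof (rule fps_ext)
    fix n
    show "(rat_fps u * G) $ n = (fps_X * (rat_fps ?T * G)) $ n"
    proof (cases n)
      case 0
      then show ?thesis by (simp add: u_def free_subgroup_gf_def)
    next
      case (Suc k)
      have "(rat_fps u * G) $ n = of_nat (2 * q * m * Suc k) * Gamma_weight m q (Suc k)"
        unfolding DG[symmetric] a Suc
        by (simp only: fps_of_nat[symmetric] fps_mult_left_const_nth fps_XD_nth G_def fps_nth_Abs_fps of_nat_mult mult.assoc)
      also have "\<dots> = (\<Prod>j<q - 1. of_nat (2 * q * m * k + m * odd_except q j)) * Gamma_weight m q k"
        by (rule Gamma_weight_Suc[OF m q])
      also have "\<dots> = (fps_X * (rat_fps ?T * G)) $ n"
        unfolding twisted_prod_times_Gamma[OF DG] Suc by (simp add: G_def ac_simps)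
      finally show ?thesis .
    qed
  qed
  also have "\<dots> = rat_fps (fps_X * ?T) * G" by (simp add: rat_fps_mult rat_fps_X mult.assoc)
  finally have "rat_fps u = rat_fps (fps_X * ?T)" using G0 by simp
  then show ?thesis by (simp only: rat_fps_inject)
qed

theorem corollary34:
  fixes f q \<gamma> :: nat
  assumes "q = 2 ^ (2 ^ f) + 1" and "prime q" and "\<gamma> \<ge> 1"
  shows "\<forall>m\<ge>1. \<exists>P :: int fls poly.
    degree P \<le> 2 ^ (2 ^ f) * \<gamma> - 1 \<and>
    (\<forall>i. is_laurent_poly (coeff P i)) \<and>
    fls_cong (2 ^ \<gamma>)
      (fls_compose_power (fps_to_fls (free_subgroup_gf q m)) (q - 2))
      (poly P (Phi (2 ^ f)))"
proof (intro allI impI)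
  fix m :: nat assume m: "m \<ge> 1"
  define h where "h = (2 :: nat) ^ f"
  have h: "h \<ge> 1" by (simp add: h_def)
  have qh: "q = 2 ^ h + 1" using assms(1) by (simp add: h_def)
  have h2: "(2 :: nat) ^ h \<ge> 2" "even ((2 :: nat) ^ h)" using h by (auto simp: self_le_power)
  have q: "odd q" "q \<ge> 3" "q - 1 = 2 ^ h" "q - 2 > 0" using h2 by (simp_all add: qh)
  define u where "u = free_subgroup_gf q m - 1"
  have "u = fps_X * twisted_prod (\<lambda>f. of_nat (2 * (q * m)) * fps_XD f)
      (\<lambda>j. of_int (int (m * odd_except q j))) u (2 ^ h)"
    using free_subgroup_gf_riccati[of m q] m q unfolding u_def by simp
  \<comment> \<open>All values of \<open>odd_except\<close> are odd, so each constant has the parity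
    of \<open>m\<close>.\<close>
  moreover have "even (int (m * odd_except q j) - int m)" for j
    by (simp add: odd_except_def)
  moreover have "u $ 0 = 0" by (simp add: u_def free_subgroup_gf_def)
  ultimately have "fls_compose_power (fps_to_fls u) (q - 2) \<in> poly_in_mod (2 ^ \<gamma>) (Phi h)"
    using h qh assms(3) by (intro riccati_mod_power_of_two)
  then have "fls_compose_power (fps_to_fls u) (q - 2) + 1 \<in> poly_in_mod (2 ^ \<gamma>) (Phi h)"
    by (rule poly_in_mod_add) (simp add: poly_in_mod_laurent)
  moreover have "fls_compose_power (fps_to_fls (free_subgroup_gf q m)) (q - 2)
      = fls_compose_power (fps_to_fls u) (q - 2) + 1"
    using q(4) by (simp add: u_def)
  ultimately obtain P where "laurent_coeffs P" "degree P \<le> 2 ^ h * \<gamma> - 1"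
    "of_int (2 ^ \<gamma>) dvd fls_compose_power (fps_to_fls (free_subgroup_gf q m)) (q - 2) - poly P (Phi h)"
    using poly_in_mod_Phi_degree[OF h assms(3)] by metis
  then show "\<exists>P :: int fls poly. degree P \<le> 2 ^ (2 ^ f) * \<gamma> - 1 \<and>
    (\<forall>i. is_laurent_poly (coeff P i)) \<and>
    fls_cong (2 ^ \<gamma>) (fls_compose_power (fps_to_fls (free_subgroup_gf q m)) (q - 2))
      (poly P (Phi (2 ^ f)))"
    unfolding fls_cong_iff_dvd laurent_coeffs_def h_def by blast
qed

end
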